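(* For every finite set $A\subseteq \mathbb{R}$, \[ \max\{|AA|,|A+A|\}\geq |A|^{\frac{4}{3}+\frac{2}{1167}-o(1)}\,. \]
   Context: For finite sets $A,B\subseteq\mathbb{R}$, $A+B=\{a+b: a\in A, b\in B\}$ and $AB=\{ab: a\in A,b\in B\}$. The term $o(1)$ denotes a quantity tending to $0$ as $|A|\to\infty$ (uniformly over all such sets $A$); i.e. for every $\epsilon>0$ there is $n_0$ such that the inequality with $o(1)$ replaced by $\epsilon$ holds whenever $|A|\ge n_0$. *)

theory Defs
  imports "HOL-Analysis.Analysis" "HOL-Library.Set_Algebras"
begin

end

theory Submission
  imports Defs "HOL-Real_Asymp.Real_Asymp"
begin

text \<open>
  Let \<open>n = |A|\<close>, \<open>m = max |AA| |A+A|\<close>, let \<open>A\<^sub>\<lambda> = {a \<in> A. \<lambda>a \<in> A}\<close>, and let \<open>S\<close> be a dyadic level set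
  \<open>|A\<^sub>\<lambda>| \<approx> \<tau>\<close> of ratios that carries the multiplicative energy, so that \<open>|S| \<tau>\<^sup>2 \<gtrsim> n\<^sup>4 / m\<close>. Solymosi's argument gives
  \<open>|S| \<tau>\<^sup>2 \<lesssim> m\<^sup>2\<close> by adding points on neighbouring lines of slope \<open>\<lambda> \<in> S\<close>. Adding points on all pairs of lines in a
  window of \<open>W \<approx> m\<^sup>2 / (|S| \<tau>\<^sup>2)\<close> consecutive slopes would gain the factor \<open>W\<close> and contradict \<open>|A+A| \<le> m\<close>, unless
  many of these sums coincide; hence for most \<open>\<lambda> \<in> S\<close> the set \<open>A\<^sub>\<lambda>\<close> has a partial sumset of size \<open>O(\<tau>)\<close> along a graph
  with \<open>\<tau>\<^sup>2 / W\<^sup>2\<close> edges. By incidence bounds in grids such an \<open>A\<^sub>\<lambda>\<close> contains a large set of small multiplicative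
  energy, and Cauchy-Schwarz together with Solymosi's energy bound for \<open>A\<close> makes \<open>A A\<^sub>\<lambda>\<close> large.

  Since \<open>A A\<^sub>\<lambda>\<close> is contained in \<open>AA \<inter> \<lambda>\<^sup>-\<^sup>1 AA\<close>, most \<open>\<lambda> \<in> S\<close> have many representations as quotients of elements
  of \<open>AA\<close>. Dilates of the set of these \<open>\<lambda>\<close> by few elements of \<open>A\<close> cover a large part \<open>A'\<close> of \<open>A\<close>, so \<open>A'\<close> has
  strong multiplicative structure and incidence bounds control the number of popular differences \<open>A' - P\<close> for every
  \<open>P\<close>. Counting \<open>(a + b) - (a' + b) = a - a'\<close> over popular sums and differences then shows that \<open>|A'+A'|\<close> exceeds \<open>m\<close>
  unless \<open>m\<close> is as large as claimed.
\<close>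

section \<open>Counting lemmas\<close>


lemma card_fibre_eq_sum_sq:
  assumes "finite T"
  shows "real (card {(x, y). x \<in> T \<and> y \<in> T \<and> f x = f y}) = (\<Sum>z\<in>f ` T. (real (card {x\<in>T. f x = z}))\<^sup>2)"
proof -
  have eq: "{(x, y). x \<in> T \<and> y \<in> T \<and> f x = f y} = (\<Union>z\<in>f ` T. {x\<in>T. f x = z} \<times> {x\<in>T. f x = z})"
    by auto
  have "card {(x, y). x \<in> T \<and> y \<in> T \<and> f x = f y} = (\<Sum>z\<in>f ` T. card ({x\<in>T. f x = z} \<times> {x\<in>T. f x = z}))"
    unfolding eq using assms by (intro card_UN_disjoint) auto
  then show ?thesis by (simp add: card_cartesian_product power2_eq_square)
qed

lemma card_eq_sum_fibres:
  assumes "finite T"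
  shows "real (card T) = (\<Sum>z\<in>f ` T. real (card {x\<in>T. f x = z}))"
proof -
  have "card T = card (\<Union>z\<in>f ` T. {x\<in>T. f x = z})" by (rule arg_cong[where f=card]) auto
  also have "\<dots> = (\<Sum>z\<in>f ` T. card {x\<in>T. f x = z})"
    using assms by (intro card_UN_disjoint) auto
  finally show ?thesis by simp
qed

text \<open>Cauchy-Schwarz over the fibres of \<open>f\<close>: a map with few collisions takes many
  values. The lower bounds for sumsets and product sets below rest on it.\<close>

lemma card_sq_le_image_collisions:
  assumes "finite T"
  shows "(real (card T))\<^sup>2 \<le> real (card (f ` T)) * real (card {(x, y). x \<in> T \<and> y \<in> T \<and> f x = f y})"
  unfolding card_fibre_eq_sum_sq[OF assms] card_eq_sum_fibres[OF assms, of f]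
  using sum_squared_le_sum_of_squares[of "\<lambda>z. real (card {x\<in>T. f x = z})" "f ` T"]
  by (simp add: mult.commute)

section \<open>Dyadic decomposition\<close>

lemma nat_dyadic_level:
  fixes m :: nat
  assumes "1 \<le> m" "m < 2 ^ J"
  obtains j where "j < J" "2 ^ j \<le> m" "m < 2 ^ Suc j"
proof -
  obtain j where j: "2 ^ j \<le> m" "m < 2 ^ Suc j"
    using ex_power_ivl1[of 2 m] assms(1) by auto
  have "(2::nat) ^ j < 2 ^ J" using j(1) assms(2) by linarith
  then have "j < J" by simp
  with j show ?thesis using that by blast
qed

text \<open>Each positive value of \<open>f\<close> is within a factor 2 of some
  \<open>2 ^ j\<close> with \<open>j < J\<close>. This rounding costs \<open>2 ^ e\<close>, and the
  number of levels costs \<open>J\<close>. Points with \<open>f x = 0\<close> contribute nothing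
  because \<open>e\<close> is positive.\<close>

lemma dyadic_sum_power_le:
  fixes f :: "'a \<Rightarrow> nat" and K :: real
  assumes fin: "finite X" and bd: "\<And>x. x \<in> X \<Longrightarrow> f x < 2 ^ J" and e: "1 \<le> e"
    and lev: "\<And>j. j < J \<Longrightarrow> real (card {x\<in>X. 2 ^ j \<le> f x}) * (2 ^ j) ^ e \<le> K"
  shows "(\<Sum>x\<in>X. real (f x) ^ e) \<le> 2 ^ e * real J * K"
proof -
  have "real (f x) ^ e \<le> (\<Sum>j<J. if 2 ^ j \<le> f x then 2 ^ e * (2 ^ j) ^ e else 0)" if x: "x \<in> X" for x
  proof (cases "f x = 0")
    case True
    then show ?thesis using e by (simp add: power_0_left sum_nonneg)
  next
    case False
    then obtain j where j: "j < J" "2 ^ j \<le> f x" "f x < 2 ^ Suc j"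
      using nat_dyadic_level[OF _ bd[OF x]] by (metis One_nat_def Suc_leI gr0I)
    have "real (f x) < 2 * 2 ^ j" using j(3) by (simp flip: of_nat_less_iff[where 'a=real])
    then have "real (f x) ^ e \<le> (2 * 2 ^ j) ^ e" by (intro power_mono) auto
    also have "\<dots> = (if 2 ^ j \<le> f x then 2 ^ e * (2 ^ j) ^ e else 0)" using j by (simp add: power_mult_distrib)
    also have "\<dots> \<le> (\<Sum>j<J. if 2 ^ j \<le> f x then 2 ^ e * (2 ^ j) ^ e else 0)"
      using j by (intro member_le_sum) auto
    finally show ?thesis .
  qed
  then have "(\<Sum>x\<in>X. real (f x) ^ e) \<le> (\<Sum>x\<in>X. \<Sum>j<J. if 2 ^ j \<le> f x then 2 ^ e * (2 ^ j) ^ e else 0)"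
    by (rule sum_mono)
  also have "\<dots> = (\<Sum>j<J. \<Sum>x\<in>X. if 2 ^ j \<le> f x then 2 ^ e * (2 ^ j) ^ e else 0)"
    by (rule sum.swap)
  also have "\<dots> = (\<Sum>j<J. 2 ^ e * (real (card {x\<in>X. 2 ^ j \<le> f x}) * (2 ^ j) ^ e))"
    using fin by (intro sum.cong refl) (simp add: sum.If_cases Int_def mult_ac)
  also have "\<dots> \<le> (\<Sum>j<J. 2 ^ e * K)" using lev by (intro sum_mono mult_left_mono) auto
  finally show ?thesis by (simp add: mult_ac)
qed

text \<open>\<open>f\<close> sorts the points into levels, while \<open>g\<close> is the weight to
  be kept; the applications take \<open>g\<close> to be \<open>f\<close> or its square. Values from
  1 on put every point into exactly one of \<open>J\<close> levels, and the heaviest level carries a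
  share \<open>1 / J\<close>.\<close>

lemma dyadic_pigeonhole:
  fixes f :: "'a \<Rightarrow> nat" and g :: "'a \<Rightarrow> real"
  assumes fin: "finite X" and bd: "\<And>x. x \<in> X \<Longrightarrow> 1 \<le> f x" "\<And>x. x \<in> X \<Longrightarrow> f x < 2 ^ J"
    and J: "0 < J"
  obtains j where "j < J" "(\<Sum>x\<in>X. g x) \<le> real J * (\<Sum>x\<in>{x\<in>X. 2 ^ j \<le> f x \<and> f x < 2 ^ Suc j}. g x)"
proof -
  let ?L = "\<lambda>j. {x\<in>X. 2 ^ j \<le> f x \<and> f x < 2 ^ Suc j}"
  have X: "X = (\<Union>j\<in>{..<J}. ?L j)"
  proof -
    have "\<exists>j<J. 2 ^ j \<le> f x \<and> f x < 2 ^ Suc j" if "x \<in> X" for x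
      using nat_dyadic_level[OF bd(1)[OF that] bd(2)[OF that]] by blast
    then show ?thesis by blast
  qed
  have disj: "?L i \<inter> ?L j = {}" if "i \<noteq> j" for i j
  proof -
    have *: False if "2 ^ i \<le> f x" "f x < 2 ^ Suc i" "2 ^ j \<le> f x" "f x < 2 ^ Suc j" for x
    proof -
      have "(2::nat) ^ i < 2 ^ Suc j" "(2::nat) ^ j < 2 ^ Suc i" using that by linarith+
      then have "i < Suc j" "j < Suc i" by (simp_all only: power_strict_increasing_iff one_less_numeral_iff semiring_norm)
      with \<open>i \<noteq> j\<close> show False by simp
    qed
    show ?thesis using * by blast
  qed
  have S: "(\<Sum>x\<in>X. g x) = (\<Sum>j<J. \<Sum>x\<in>?L j. g x)"
    by (subst X, rule sum.UNION_disjoint) (use fin disj in auto)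
  have "\<exists>j<J. (\<Sum>x\<in>X. g x) \<le> real J * (\<Sum>x\<in>?L j. g x)"
  proof (rule ccontr)
    assume "\<not> ?thesis"
    then have "real J * (\<Sum>x\<in>?L j. g x) < (\<Sum>x\<in>X. g x)" if "j < J" for j using that by force
    then have "(\<Sum>j<J. real J * (\<Sum>x\<in>?L j. g x)) < (\<Sum>j<J. \<Sum>x\<in>X. g x)"
      using J by (intro sum_strict_mono) auto
    then show False using S by (simp add: sum_distrib_left[symmetric])
  qed
  then show ?thesis using that by blast
qed

section \<open>Rich lines in grids\<close>


text \<open>The block number is the rank, scaled to \<open>s\<close> values and rounded down. A
  block consists of consecutive ranks, hence has at most \<open>card P / s + 1\<close> elements, and
  \<open>s \<le> card P\<close> turns the 1 into another \<open>card P / s\<close>.\<close>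

lemma ex_monotone_blocks:
  fixes P :: "real set" and s :: nat
  assumes P: "finite P" and s: "1 \<le> s" "s \<le> card P"
  obtains i :: "real \<Rightarrow> nat" where "mono i" "\<And>x. x \<in> P \<Longrightarrow> i x < s"
    "\<And>j. real (card {y\<in>P. i y = j}) \<le> 2 * real (card P) / real s"
proof -
  define N where "N = card P"
  have N: "1 \<le> N" using s by (simp add: N_def)
  define rk where "rk = (\<lambda>x. card {p\<in>P. p < x})"
  define i where "i = (\<lambda>x. (rk x * s) div N)"
  have rkmono: "mono rk" unfolding rk_def using P by (intro monoI card_mono) auto
  have rklt: "rk x < rk y" if "x \<in> P" "x < y" for x y
    unfolding rk_def using P that by (intro psubset_card_mono) auto
  have rkN: "rk x < N" if "x \<in> P" for x
    unfolding rk_def N_def using P that by (intro psubset_card_mono) auto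
  have inj: "inj_on rk P" using rklt by (intro linorder_inj_onI) (auto simp: less_le)
  show ?thesis
  proof (rule that[of i])
    show "mono i" unfolding i_def using rkmono by (auto intro!: monoI div_le_mono dest: monoD)
    show "i x < s" if "x \<in> P" for x
      using rkN[OF that] N s unfolding i_def by (simp add: div_less_iff_less_mult)
    show "real (card {y\<in>P. i y = j}) \<le> 2 * real (card P) / real s" for j
    proof (cases "{y\<in>P. i y = j} = {}")
      case True
      then show ?thesis by (simp only: True) simp
    next
      case False
      define R where "R = rk ` {y\<in>P. i y = j}"
      have fR: "finite R" "R \<noteq> {}" using P False by (auto simp: R_def)
      have cR: "card R = card {y\<in>P. i y = j}" unfolding R_def
        by (rule card_image) (rule inj_on_subset[OF inj], auto)
      have R: "j * N \<le> q * s \<and> q * s < (j + 1) * N" if q: "q \<in> R" for q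
      proof -
        obtain y where y: "y \<in> P" "i y = j" "q = rk y" using q unfolding R_def by blast
        have "q * s div N = j" using y by (simp add: i_def)
        then have "q * s = j * N + q * s mod N" using div_mult_mod_eq[of "q * s" N] by simp
        moreover have "q * s mod N < N" using N by simp
        ultimately show ?thesis by (simp add: algebra_simps)
      qed
      have "R \<subseteq> {Min R..Max R}" using fR by auto
      from card_mono[OF finite_atLeastAtMost this] have "card R \<le> Max R + 1 - Min R" by simp
      moreover have "Min R \<le> Max R" using fR by simp
      ultimately have c: "real (card R) \<le> real (Max R) - real (Min R) + 1" by linarith
      have "real (Max R) * s < real (j+1) * N" using R[of "Max R"] fR by (metis Max_in of_nat_less_iff of_nat_mult)
      moreover have "real j * N \<le> real (Min R) * s" using R[of "Min R"] fR by (metis Min_in of_nat_le_iff of_nat_mult)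
      ultimately have "(real (Max R) - real (Min R)) * s < N" by (simp add: algebra_simps)
      then have "(real (card R) - 1) * s \<le> N" using c s
        by (smt (verit) mult_right_mono of_nat_0_le_iff)
      then have "real (card R) * s \<le> 2 * N" using s by (simp add: algebra_simps N_def)
      then show ?thesis using s cR by (simp add: N_def field_simps)
    qed
  qed
qed

text \<open>Cutting the grid into \<open>s \<times> s\<close> blocks, an increasing line meets at most \<open>2s - 1\<close> of them, so that it
  has many pairs of points in a common block as soon as it has at least \<open>4s\<close> points; every pair of points
  lies on one line only.\<close>
theorem szemeredi_trotter_grid:
  fixes P Q :: "real set" and L :: "(real \<times> real) set" and h0 :: real
  assumes P: "finite P" and Q: "finite Q" and L: "finite L"
    and pos: "\<And>m c. (m, c) \<in> L \<Longrightarrow> 0 < m"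
    and rich: "\<And>m c. (m, c) \<in> L \<Longrightarrow> h0 \<le> real (card {x\<in>P. m * x + c \<in> Q})"
    and h0: "2 \<le> h0"
  shows "h0 * (\<Sum>(m, c)\<in>L. (real (card {x\<in>P. m * x + c \<in> Q}))\<^sup>2) \<le> 128 * (real (card P))\<^sup>2 * (real (card Q))\<^sup>2"
proof (cases "L = {}")
  case True
  then show ?thesis by simp
next
  case False
  define T where "T = (\<lambda>l::real\<times>real. {x\<in>P. fst l * x + snd l \<in> Q})"
  define h where "h = (\<lambda>l. real (card (T l)))"
  have finT: "finite (T l)" for l using P by (simp add: T_def)
  have hl: "h0 \<le> h l" if "l \<in> L" for l using rich[of "fst l" "snd l"] that by (simp add: h_def T_def)
  have pl: "0 < fst l" if "l \<in> L" for l using pos[of "fst l" "snd l"] that by simp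
  \<comment> \<open>About \<open>h0 / 4\<close>: small enough that diagonal pairs can be absorbed
    below, large enough that \<open>h0 \<le> 8 * s\<close>, so that only a constant is lost.\<close>
  define s where "s = max 1 (nat \<lfloor>h0 / 4\<rfloor>)"
  have s1: "1 \<le> s" by (simp add: s_def)
  have sh: "s = 1 \<or> 4 * real s \<le> h0"
    using h0 unfolding s_def by (cases "nat \<lfloor>h0 / 4\<rfloor> \<le> 1") (auto simp: max_def, linarith)
  have h8: "h0 \<le> 8 * real s"
  proof -
    have "h0 / 4 < real_of_int \<lfloor>h0 / 4\<rfloor> + 1" by linarith
    moreover have "real_of_int \<lfloor>h0 / 4\<rfloor> \<le> real s" using h0 unfolding s_def by (simp add: le_max_iff_disj)
    ultimately show ?thesis using s1 by linarith
  qed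
  obtain l0 where l0: "l0 \<in> L" using False by auto
  have cP: "h l \<le> real (card P)" for l unfolding h_def T_def using P by (auto intro: card_mono)
  have cQ: "h l \<le> real (card Q)" if "l \<in> L" for l
  proof -
    have "inj_on (\<lambda>x. fst l * x + snd l) (T l)" using pl[OF that] by (auto simp: inj_on_def)
    moreover have "(\<lambda>x. fst l * x + snd l) ` T l \<subseteq> Q" by (auto simp: T_def)
    ultimately show ?thesis unfolding h_def using Q by (simp add: card_inj_on_le)
  qed
  have "real s \<le> h0" using sh h0 s1 by auto
  then have sP: "s \<le> card P" and sQ: "s \<le> card Q" using hl[OF l0] cP[of l0] cQ[OF l0] by linarith+
  obtain i where i: "mono i" "\<And>x. x \<in> P \<Longrightarrow> i x < s"
    "\<And>j. real (card {y\<in>P. i y = j}) \<le> 2 * real (card P) / real s"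
    using ex_monotone_blocks[OF P s1 sP] by blast
  obtain k where k: "mono k" "\<And>x. x \<in> Q \<Longrightarrow> k x < s"
    "\<And>j. real (card {y\<in>Q. k y = j}) \<le> 2 * real (card Q) / real s"
    using ex_monotone_blocks[OF Q s1 sQ] by blast
  \<comment> \<open>The block of a point is encoded by the sum of its two block numbers. Along an
    increasing line both are monotone, so equal sums force equal blocks, and only
    \<open>2 * s - 1\<close> sums are possible.\<close>
  define g where "g = (\<lambda>l x. i x + k (fst l * x + snd l))"
  define C where "C = (\<lambda>l. {(x, y). x \<in> T l \<and> y \<in> T l \<and> g l x = g l y})"
  define O' where "O' = (\<lambda>l. {(x, y). x \<in> T l \<and> y \<in> T l \<and> g l x = g l y \<and> x \<noteq> y})"
  define Pairs where "Pairs = (SIGMA x:P. SIGMA u:Q. {y\<in>P. i y = i x} \<times> {w\<in>Q. k w = k u})"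
  have finC: "finite (C l)" for l
    by (rule finite_subset[of _ "T l \<times> T l"]) (use finT in \<open>auto simp: C_def\<close>)
  have finO: "finite (O' l)" for l
    by (rule finite_subset[of _ "C l"]) (use finC in \<open>auto simp: C_def O'_def\<close>)
  have cC: "real (card (C l)) = real (card (O' l)) + h l" for l
  proof -
    have "C l = O' l \<union> (\<lambda>x. (x, x)) ` T l" by (auto simp: C_def O'_def)
    moreover have "O' l \<inter> (\<lambda>x. (x, x)) ` T l = {}" by (auto simp: O'_def)
    moreover have "card ((\<lambda>x. (x, x)) ` T l) = card (T l)" by (rule card_image) (auto simp: inj_on_def)
    ultimately show ?thesis using finO[of l] finT[of l] by (simp add: card_Un_disjoint h_def)
  qed
  \<comment> \<open>The \<open>h l\<close> diagonal collisions cost at most half of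
    \<open>(h l)\<^sup>2\<close>: for \<open>s = 1\<close> because \<open>2 \<le> h l\<close>,
    otherwise because \<open>4 * s \<le> h l\<close>.\<close>
  have main: "(h l)\<^sup>2 \<le> 4 * real s * real (card (O' l))" if l: "l \<in> L" for l
  proof -
    have "g l ` T l \<subseteq> {..<2 * s - 1}" using i(2) k(2) by (fastforce simp: T_def g_def)
    then have "card (g l ` T l) \<le> 2 * s - 1" using card_mono[OF finite_lessThan] by fastforce
    then have im: "real (card (g l ` T l)) \<le> 2 * real s - 1" using s1 by linarith
    have "(h l)\<^sup>2 \<le> real (card (g l ` T l)) * real (card (C l))"
      unfolding h_def C_def by (rule card_sq_le_image_collisions[OF finT])
    also have "\<dots> \<le> (2 * real s - 1) * real (card (C l))" using im by (intro mult_right_mono) auto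
    finally have *: "(h l)\<^sup>2 \<le> (2 * real s - 1) * (real (card (O' l)) + h l)" by (simp add: cC)
    have h: "2 \<le> h l" using hl[OF l] h0 by linarith
    from sh show ?thesis
    proof
      assume "s = 1"
      then have "(h l)\<^sup>2 \<le> real (card (O' l)) + h l" using * by simp
      moreover have "2 * h l \<le> (h l)\<^sup>2" using h by (simp add: power2_eq_square)
      moreover have "0 \<le> real (card (O' l))" by simp
      ultimately show ?thesis using \<open>s = 1\<close> by simp
    next
      assume "4 * real s \<le> h0"
      then have "4 * real s \<le> h l" using hl[OF l] by linarith
      then have "2 * (2 * real s - 1) * h l \<le> h l * h l" using h by (intro mult_right_mono) auto
      moreover have "(2 * real s - 1) * real (card (O' l)) \<le> 2 * real s * real (card (O' l))"
        by (intro mult_right_mono) auto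
      ultimately show ?thesis using * by (simp add: power2_eq_square algebra_simps)
    qed
  qed
  have sub: "(\<lambda>(l, x, y). (x, fst l * x + snd l, y, fst l * y + snd l)) ` (SIGMA l:L. O' l) \<subseteq> Pairs"
  proof -
    have key: "i x = i y \<and> k (fst l * x + snd l) = k (fst l * y + snd l)" if "l \<in> L" "g l x = g l y" for l x y
    proof -
      have *: "i x = i y \<and> k (fst l * x + snd l) = k (fst l * y + snd l)" if "x \<le> y" "g l x = g l y" for x y
      proof -
        have "i x \<le> i y" using monoD[OF i(1) \<open>x \<le> y\<close>] .
        moreover have "k (fst l * x + snd l) \<le> k (fst l * y + snd l)"
          using pl[OF \<open>l \<in> L\<close>] \<open>x \<le> y\<close> by (intro monoD[OF k(1)]) simp
        ultimately show ?thesis using that(2) by (simp add: g_def)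
      qed
      show ?thesis using *[of x y] *[of y x] that(2) by fastforce
    qed
    show ?thesis
    proof (clarify)
      fix m c x y assume a: "(m, c) \<in> L" "(x, y) \<in> O' (m, c)"
      show "(x, fst (m, c) * x + snd (m, c), y, fst (m, c) * y + snd (m, c)) \<in> Pairs"
        using a(2) key[OF a(1), of x y] by (auto simp: Pairs_def O'_def T_def)
    qed
  qed
  have inj: "inj_on (\<lambda>(l, x, y). (x, fst l * x + snd l, y, fst l * y + snd l)) (SIGMA l:L. O' l)"
  proof (rule inj_onI)
    fix p q
    assume p: "p \<in> (SIGMA l:L. O' l)" and q: "q \<in> (SIGMA l:L. O' l)"
      and e: "(case p of (l, x, y) \<Rightarrow> (x, fst l * x + snd l, y, fst l * y + snd l)) =
        (case q of (l, x, y) \<Rightarrow> (x, fst l * x + snd l, y, fst l * y + snd l))"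
    obtain m c x y where p': "p = ((m, c), x, y)" by (metis prod.collapse)
    obtain m' c' x' y' where q': "q = ((m', c'), x', y')" by (metis prod.collapse)
    have xy: "x = x'" "y = y'" "m * x + c = m' * x + c'" "m * y + c = m' * y + c'" using e p' q' by auto
    have "x \<noteq> y" using p p' by (simp add: O'_def)
    moreover have "(m - m') * (x - y) = 0" using xy(3,4) by (simp add: algebra_simps)
    ultimately have "m = m'" by simp
    then show "p = q" using p' q' xy by simp
  qed
  have finPairs: "finite Pairs" unfolding Pairs_def using P Q by (auto intro!: finite_SigmaI)
  have "real (card (SIGMA l:L. O' l)) \<le> real (card Pairs)"
    using card_inj_on_le[OF inj sub finPairs] by simp
  also have "real (card Pairs) = (\<Sum>x\<in>P. \<Sum>u\<in>Q. real (card {y\<in>P. i y = i x}) * real (card {w\<in>Q. k w = k u}))"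
    unfolding Pairs_def using P Q by (simp add: card_SigmaI card_cartesian_product)
  also have "\<dots> \<le> (\<Sum>x\<in>P. \<Sum>u\<in>Q. (2 * real (card P) / real s) * (2 * real (card Q) / real s))"
    using i(3) k(3) by (intro sum_mono mult_mono) auto
  also have "\<dots> = 4 * (real (card P))\<^sup>2 * (real (card Q))\<^sup>2 / (real s)\<^sup>2"
    by (simp add: power2_eq_square)
  finally have tot: "(\<Sum>l\<in>L. real (card (O' l))) \<le> 4 * (real (card P))\<^sup>2 * (real (card Q))\<^sup>2 / (real s)\<^sup>2"
    using L finO by (simp add: card_SigmaI)
  have "(\<Sum>l\<in>L. (h l)\<^sup>2) \<le> (\<Sum>l\<in>L. 4 * real s * real (card (O' l)))" by (rule sum_mono) (rule main)
  also have "\<dots> = 4 * real s * (\<Sum>l\<in>L. real (card (O' l)))" by (simp add: sum_distrib_left)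
  also have "\<dots> \<le> 4 * real s * (4 * (real (card P))\<^sup>2 * (real (card Q))\<^sup>2 / (real s)\<^sup>2)"
    using tot by (intro mult_left_mono) auto
  also have "\<dots> = 16 * (real (card P))\<^sup>2 * (real (card Q))\<^sup>2 / real s"
    using s1 by (simp add: power2_eq_square field_simps)
  finally have S: "(\<Sum>l\<in>L. (h l)\<^sup>2) \<le> 16 * (real (card P))\<^sup>2 * (real (card Q))\<^sup>2 / real s" .
  have "h0 * (\<Sum>l\<in>L. (h l)\<^sup>2) \<le> (8 * real s) * (16 * (real (card P))\<^sup>2 * (real (card Q))\<^sup>2 / real s)"
    using h8 S by (intro mult_mono) (auto intro: sum_nonneg)
  also have "\<dots> = 128 * (real (card P))\<^sup>2 * (real (card Q))\<^sup>2" using s1 by simp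
  finally show ?thesis by (simp add: h_def T_def case_prod_unfold)
qed

section \<open>Sums of points on neighbouring lines\<close>


text \<open>For positive \<open>A\<close> its size counts the representations of \<open>l\<close> as
  a quotient of elements of \<open>A\<close>, so that the squares of these sizes add up to the
  multiplicative energy. Geometrically it consists of the first coordinates of the points of
  \<open>A \<times> A\<close> on the line of slope \<open>l\<close> through the origin.\<close>

definition mult_fibre :: "real set \<Rightarrow> real \<Rightarrow> real set" where
  "mult_fibre A l = {a\<in>A. l * a \<in> A}"

text \<open>A partial sumset of size at most \<open>M\<close> along a graph with more than
  \<open>\<sigma>\<close> edges. The second summand \<open>Y\<close> and the target \<open>Z\<close>
  are left arbitrary, so that dilates of other fibres can take these roles.\<close>

definition sum_rich :: "real set \<Rightarrow> real \<Rightarrow> real \<Rightarrow> bool" where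
  "sum_rich B M \<sigma> \<longleftrightarrow> (\<exists>Y Z. finite Y \<and> finite Z \<and> real (card Y) \<le> M \<and> real (card Z) \<le> M \<and>
     \<sigma> < real (card {(b, y). b \<in> B \<and> y \<in> Y \<and> b + y \<in> Z}))"

lemma finite_mult_fibre [simp]: "finite A \<Longrightarrow> finite (mult_fibre A l)"
  by (simp add: mult_fibre_def)

lemma mult_fibre_subset: "mult_fibre A l \<subseteq> A"
  by (auto simp: mult_fibre_def)

text \<open>Apply the linear functional that vanishes on the direction \<open>(1, l)\<close>.\<close>
lemma collisions_le:
  fixes Ai Aj Ak Al :: "real set"
  assumes fin: "finite Ai" "finite Aj" "finite Ak"
    and cM: "real (card Aj) \<le> M" "real (card Ak) \<le> M"
    and ne: "l \<noteq> i" "l \<noteq> j" "k \<noteq> l" "i \<noteq> j"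
    and nr: "\<not> sum_rich Ai M \<sigma>"
  shows "real (card {(a, b, c, d). a \<in> Ai \<and> b \<in> Aj \<and> c \<in> Ak \<and> d \<in> Al \<and>
      a + b = c + d \<and> i * a + j * b = k * c + l * d}) \<le> \<sigma>" (is "real (card ?X) \<le> \<sigma>")
proof -
  \<comment> \<open>The functional \<open>(x, y) \<mapsto> y - l * x\<close> removes
    \<open>d\<close> and turns a collision into \<open>a + \<theta> * b = \<eta> * c\<close>, an
    edge of a partial sumset of \<open>Ai\<close> with dilates of \<open>Aj\<close> and
    \<open>Ak\<close>.\<close>
  define \<theta> where "\<theta> = (j - l) / (i - l)"
  define \<eta> where "\<eta> = (k - l) / (i - l)"
  define Y where "Y = (\<lambda>b. \<theta> * b) ` Aj"
  define Z where "Z = (\<lambda>b. \<eta> * b) ` Ak"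
  have YZ: "finite Y" "finite Z" "real (card Y) \<le> M" "real (card Z) \<le> M"
    using fin cM card_image_le[of Aj "\<lambda>b. \<theta> * b"] card_image_le[of Ak "\<lambda>b. \<eta> * b"]
    by (auto simp: Y_def Z_def)
  let ?R = "{(b, y). b \<in> Ai \<and> y \<in> Y \<and> b + y \<in> Z}"
  have finR: "finite ?R" by (rule finite_subset[of _ "Ai \<times> Y"]) (use fin YZ in auto)
  have R: "real (card ?R) \<le> \<sigma>" using nr YZ unfolding sum_rich_def by force
  define g where "g = (\<lambda>(a::real, b::real, c::real, d::real). (a, \<theta> * b))"
  have \<theta>0: "\<theta> \<noteq> 0" using ne by (simp add: \<theta>_def)
  \<comment> \<open>Given \<open>a\<close> and \<open>b\<close>, the two equations determine
    \<open>c\<close> and \<open>d\<close>, since \<open>k\<close> and \<open>l\<close>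
    differ.\<close>
  have inj: "inj_on g ?X"
  proof (rule inj_onI)
    fix u v assume u: "u \<in> ?X" and v: "v \<in> ?X" and uv: "g u = g v"
    obtain a b c d where u': "u = (a, b, c, d)" by (metis prod.collapse)
    obtain a' b' c' d' where v': "v = (a', b', c', d')" by (metis prod.collapse)
    have ab: "a = a'" "b = b'" using uv u' v' \<theta>0 by (auto simp: g_def)
    have h: "c + d = c' + d'" "k * c + l * d = k * c' + l * d'" using u v u' v' ab by auto
    have "(k - l) * (c - c') = (k * c + l * d - (k * c' + l * d')) - l * (c + d - (c' + d'))"
      by (simp add: algebra_simps)
    then have "(k - l) * (c - c') = 0" using h by simp
    then have "c = c'" using ne by simp
    then show "u = v" using h(1) ab u' v' by simp
  qed
  have "g ` ?X \<subseteq> ?R"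
  proof
    fix z assume "z \<in> g ` ?X"
    then obtain u where u: "u \<in> ?X" "z = g u" by blast
    obtain a b c d where u': "u = (a, b, c, d)" by (metis prod.collapse)
    have z: "z = (a, \<theta> * b)" and h: "a \<in> Ai" "b \<in> Aj" "c \<in> Ak"
      "a + b = c + d" "i * a + j * b = k * c + l * d"
      using u u' by (auto simp: g_def)
    have "(i - l) * a + (j - l) * b = (i * a + j * b) - l * (a + b)" by (simp add: algebra_simps)
    also have "\<dots> = (k - l) * c" unfolding h(4,5) by (simp add: algebra_simps)
    finally have e: "(i - l) * a + (j - l) * b = (k - l) * c" .
    have "a + \<theta> * b = ((i - l) * a + (j - l) * b) / (i - l)"
      using ne by (simp add: \<theta>_def add_divide_distrib)
    then have "a + \<theta> * b = \<eta> * c" using e by (simp add: \<eta>_def)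
    then have "a + \<theta> * b \<in> Z" unfolding Z_def using h(3) by blast
    moreover have "\<theta> * b \<in> Y" unfolding Y_def using h(2) by blast
    ultimately show "z \<in> ?R" using z h(1) by simp
  qed
  then have "card ?X \<le> card ?R" using card_inj_on_le[OF inj _ finR] by blast
  then show ?thesis using R by linarith
qed

definition slope_pairs :: "real set \<Rightarrow> (real \<times> real) set" where
  "slope_pairs F = {(i, j). i \<in> F \<and> j \<in> F \<and> i < j}"

text \<open>The points are the sums \<open>(a, i * a) + (b, j * b)\<close> of two points of
  \<open>A \<times> A\<close> on lines through the origin with different slopes in
  \<open>F\<close>.\<close>

definition cone_sums :: "real set \<Rightarrow> real set \<Rightarrow> (real \<times> real) set" where
  "cone_sums A F = {(a + b, i * a + j * b) | i j a b.
     (i, j) \<in> slope_pairs F \<and> a \<in> mult_fibre A i \<and> b \<in> mult_fibre A j}"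

lemma card_slope_pairs:
  assumes "finite F"
  shows "real (card (slope_pairs F)) = real (card F) * (real (card F) - 1) / 2"
proof -
  let ?U = "slope_pairs F" and ?D = "(\<lambda>x. (x, x)) ` F"
  have fU: "finite ?U" by (rule finite_subset[of _ "F \<times> F"]) (use assms in \<open>auto simp: slope_pairs_def\<close>)
  have e: "F \<times> F = (?U \<union> prod.swap ` ?U) \<union> ?D"
    by (auto simp: slope_pairs_def image_iff)
  have c1: "card (prod.swap ` ?U) = card ?U" by (rule card_image) auto
  have c2: "card ?D = card F" by (rule card_image) (auto simp: inj_on_def)
  have d1: "?U \<inter> prod.swap ` ?U = {}" by (auto simp: slope_pairs_def)
  have d2: "(?U \<union> prod.swap ` ?U) \<inter> ?D = {}" by (auto simp: slope_pairs_def)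
  have "card (F \<times> F) = card (?U \<union> prod.swap ` ?U) + card ?D"
    unfolding e by (rule card_Un_disjoint) (use fU assms d2 in auto)
  also have "card (?U \<union> prod.swap ` ?U) = card ?U + card (prod.swap ` ?U)"
    by (rule card_Un_disjoint) (use fU d1 in auto)
  finally have "card F * card F = card ?U + card ?U + card F" using c1 c2 by (simp add: card_cartesian_product)
  then have "real (card F) * real (card F) = 2 * real (card ?U) + real (card F)"
    by (metis mult_2 of_nat_add of_nat_mult)
  then show ?thesis by (simp add: algebra_simps)
qed

text \<open>One pair of lines yields at least \<open>\<tau>\<^sup>2\<close> different sums, and two
  different pairs of lines have at most \<open>\<sigma>\<close> coincidences. As the number of pairs
  times \<open>\<sigma>\<close> is at most \<open>\<tau>\<^sup>2\<close>, these coincidences at most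
  double the trivial collisions, and Cauchy-Schwarz loses only a factor 2. The guard
  \<open>2 < card F\<close> covers the case of two lines, where there is just one pair.\<close>

lemma card_cone_sums_ge:
  assumes A: "finite A" and F: "finite F"
    and fib: "\<And>l. l \<in> F \<Longrightarrow> \<tau> \<le> real (card (mult_fibre A l))" "\<And>l. l \<in> F \<Longrightarrow> real (card (mult_fibre A l)) \<le> M"
    and \<tau>: "0 \<le> \<tau>"
    and nr: "\<And>l. 2 < card F \<Longrightarrow> l \<in> F \<Longrightarrow> \<not> sum_rich (mult_fibre A l) M \<sigma>"
    and \<sigma>: "0 \<le> \<sigma>" "real (card (slope_pairs F)) * \<sigma> \<le> \<tau>\<^sup>2"
  shows "finite (cone_sums A F)" "real (card (slope_pairs F)) * \<tau>\<^sup>2 / 2 \<le> real (card (cone_sums A F))"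
proof -
  let ?U = "slope_pairs F"
  define p where "p = real (card ?U)"
  have fU: "finite ?U" by (rule finite_subset[of _ "F \<times> F"]) (use F in \<open>auto simp: slope_pairs_def\<close>)
  define T where "T = (SIGMA e:?U. mult_fibre A (fst e) \<times> mult_fibre A (snd e))"
  have fT: "finite T" unfolding T_def using fU A by (auto intro!: finite_SigmaI)
  define f where "f = (\<lambda>(e::real\<times>real, a::real, b::real). (a + b, fst e * a + snd e * b))"
  have im: "cone_sums A F = f ` T"
  proof
    show "cone_sums A F \<subseteq> f ` T"
    proof
      fix z assume "z \<in> cone_sums A F"
      then obtain i j a b where z: "z = (a + b, i * a + j * b)" "(i, j) \<in> ?U" "a \<in> mult_fibre A i" "b \<in> mult_fibre A j"
        unfolding cone_sums_def by blast
      then have "((i, j), a, b) \<in> T" "f ((i, j), a, b) = z" by (auto simp: T_def f_def)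
      then show "z \<in> f ` T" by blast
    qed
    show "f ` T \<subseteq> cone_sums A F"
      by (fastforce simp: T_def f_def cone_sums_def)
  qed
  show "finite (cone_sums A F)" using im fT by simp
  have cT: "p * \<tau>\<^sup>2 \<le> real (card T)"
  proof -
    have "p * \<tau>\<^sup>2 = (\<Sum>e\<in>?U. \<tau> * \<tau>)" by (simp add: p_def power2_eq_square)
    also have "\<dots> \<le> (\<Sum>e\<in>?U. real (card (mult_fibre A (fst e))) * real (card (mult_fibre A (snd e))))"
      using fib(1) \<tau> by (intro sum_mono mult_mono) (auto simp: slope_pairs_def)
    also have "\<dots> = real (card T)" unfolding T_def using fU A by (simp add: card_SigmaI card_cartesian_product)
    finally show ?thesis .
  qed
  define Co where "Co = (\<lambda>e e'. {(a, b, c, d). a \<in> mult_fibre A (fst e) \<and> b \<in> mult_fibre A (snd e) \<and>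
     c \<in> mult_fibre A (fst e') \<and> d \<in> mult_fibre A (snd e') \<and> a + b = c + d \<and>
     fst e * a + snd e * b = fst e' * c + snd e' * d})"
  have finCo: "finite (Co e e')" for e e'
    by (rule finite_subset[of _ "A \<times> A \<times> A \<times> A"]) (use A in \<open>auto simp: Co_def mult_fibre_def\<close>)
  have Co: "real (card (Co e e')) \<le> \<sigma>" if e: "e \<in> ?U" "e' \<in> ?U" "e \<noteq> e'" for e e'
  proof -
    obtain i j where ij: "e = (i, j)" "i < j" "i \<in> F" "j \<in> F" using e(1) by (auto simp: slope_pairs_def)
    obtain k l where kl: "e' = (k, l)" "k < l" "k \<in> F" "l \<in> F" using e(2) by (auto simp: slope_pairs_def)
    \<comment> \<open>Two different pairs involve at least three slopes, so the guard in the
      richness assumption is met.\<close>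
    have c3: "\<exists>x. {i, j, x} \<subseteq> F \<and> x \<noteq> i \<and> x \<noteq> j"
    proof (cases "l = i \<or> l = j")
      case True
      then have "k \<noteq> i \<and> k \<noteq> j" using e(3) ij kl by auto
      then show ?thesis using ij kl by blast
    next
      case False
      then show ?thesis using ij kl by blast
    qed
    then obtain x where x: "{i, j, x} \<subseteq> F" "x \<noteq> i" "x \<noteq> j" by blast
    have "card {i, j, x} = 3" using x ij by auto
    then have "2 < card F" using card_mono[OF F x(1)] by linarith
    then have nr': "\<not> sum_rich (mult_fibre A i) M \<sigma>" using nr ij by blast
    \<comment> \<open>The slope eliminated in \<open>collisions_le\<close> must differ from
      \<open>i\<close> and \<open>j\<close>. If \<open>l\<close> is one of them then
      \<open>k\<close> is not, and the two points of the second pair change roles.\<close>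
    show ?thesis
    proof (cases "l = i \<or> l = j")
      case False
      then show ?thesis unfolding Co_def ij(1) kl(1) fst_conv snd_conv
        using A fib(2)[OF ij(4)] fib(2)[OF kl(3)] kl(2) ij(2) nr'
        by (intro collisions_le) auto
    next
      case True
      then have k: "k \<noteq> i" "k \<noteq> j" using e(3) ij kl by auto
      let ?Y = "{(a, b, c, d). a \<in> mult_fibre A i \<and> b \<in> mult_fibre A j \<and>
        c \<in> mult_fibre A l \<and> d \<in> mult_fibre A k \<and> a + b = c + d \<and> i * a + j * b = l * c + k * d}"
      have fY: "finite ?Y"
        by (rule finite_subset[of _ "A \<times> A \<times> A \<times> A"]) (use A in \<open>auto simp: mult_fibre_def\<close>)
      have "Co e e' \<subseteq> (\<lambda>(a, b, c, d). (a, b, d, c)) ` ?Y"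
      proof
        fix z assume z: "z \<in> Co e e'"
        obtain a b c d where z': "z = (a, b, c, d)" by (metis prod.collapse)
        have "(a, b, d, c) \<in> ?Y" using z z' by (simp add: Co_def ij(1) kl(1) add.commute)
        then show "z \<in> (\<lambda>(a, b, c, d). (a, b, d, c)) ` ?Y" unfolding z' by force
      qed
      then have "card (Co e e') \<le> card ?Y" by (rule surj_card_le[OF fY])
      moreover have "real (card ?Y) \<le> \<sigma>"
        using A fib(2)[OF ij(4)] fib(2)[OF kl(4)] kl(2) ij(2) nr' k
        by (intro collisions_le) auto
      ultimately show ?thesis by linarith
    qed
  qed
  define CC where "CC = {(x, y). x \<in> T \<and> y \<in> T \<and> f x = f y}"
  define N where "N = (SIGMA e:?U. SIGMA e':?U - {e}. Co e e')"
  have finN: "finite N" unfolding N_def using fU finCo by (auto intro!: finite_SigmaI)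
  have sub: "CC \<subseteq> (\<lambda>x. (x, x)) ` T \<union> (\<lambda>(e, e', a, b, c, d). ((e, a, b), (e', c, d))) ` N"
  proof
    fix z assume z: "z \<in> CC"
    obtain e a b e' c d where zz: "z = ((e, a, b), (e', c, d))" by (metis prod.collapse)
    have T: "(e, a, b) \<in> T" "(e', c, d) \<in> T" and eq: "f (e, a, b) = f (e', c, d)" using z zz by (auto simp: CC_def)
    have h: "e \<in> ?U" "e' \<in> ?U" "a \<in> mult_fibre A (fst e)" "b \<in> mult_fibre A (snd e)"
      "c \<in> mult_fibre A (fst e')" "d \<in> mult_fibre A (snd e')"
      using T by (auto simp: T_def)
    have q: "a + b = c + d" "fst e * a + snd e * b = fst e' * c + snd e' * d"
      using eq by (auto simp: f_def)
    show "z \<in> (\<lambda>x. (x, x)) ` T \<union> (\<lambda>(e, e', a, b, c, d). ((e, a, b), (e', c, d))) ` N"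
    proof (cases "e = e'")
      case True
      \<comment> \<open>Within one pair of lines a sum determines its summands, as the slopes
        differ.\<close>
      have lt: "fst e < snd e" using h(1) by (auto simp: slope_pairs_def)
      have "(fst e - snd e) * (a - c) = (fst e * a + snd e * b - (fst e * c + snd e * d)) - snd e * (a + b - (c + d))"
        by (simp add: algebra_simps)
      then have "(fst e - snd e) * (a - c) = 0" using q True by simp
      then have "a = c" using lt by simp
      then have "b = d" using q by simp
      then show ?thesis using T(1) zz True \<open>a = c\<close> by blast
    next
      case False
      then have "(e, e', a, b, c, d) \<in> N" using h q by (auto simp: N_def Co_def)
      then show ?thesis using zz by force
    qed
  qed
  have "card CC \<le> card ((\<lambda>x. (x, x)) ` T \<union> (\<lambda>(e, e', a, b, c, d). ((e, a, b), (e', c, d))) ` N)"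
    using fT finN by (intro card_mono sub) auto
  also have "\<dots> \<le> card T + card N"
    using card_Un_le card_image_le[OF fT, of "\<lambda>x. (x, x)"]
      card_image_le[OF finN, of "\<lambda>(e, e', a, b, c, d). ((e, a, b), (e', c, d))"]
    by (meson add_mono le_trans)
  finally have "real (card CC) \<le> real (card T) + real (card N)" by linarith
  also have "real (card N) \<le> p * \<tau>\<^sup>2"
  proof -
    have "real (card N) = (\<Sum>e\<in>?U. \<Sum>e'\<in>?U - {e}. real (card (Co e e')))"
      unfolding N_def using fU finCo by (simp add: card_SigmaI)
    also have "\<dots> \<le> (\<Sum>e\<in>?U. \<Sum>e'\<in>?U - {e}. \<sigma>)" using Co by (intro sum_mono) auto
    also have "\<dots> \<le> (\<Sum>e\<in>?U. p * \<sigma>)"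
    proof (rule sum_mono)
      fix e assume "e \<in> ?U"
      have "real (card (?U - {e})) \<le> p" unfolding p_def using fU by (simp add: card_Diff1_le)
      then show "(\<Sum>e'\<in>?U - {e}. \<sigma>) \<le> p * \<sigma>" using \<sigma>(1) by (simp add: mult_right_mono)
    qed
    also have "\<dots> \<le> (\<Sum>e\<in>?U. \<tau>\<^sup>2)" using \<sigma>(2) by (intro sum_mono) (simp add: p_def)
    finally show ?thesis by (simp add: p_def)
  qed
  finally have CCle: "real (card CC) \<le> 2 * real (card T)" using cT by linarith
  have "(real (card T))\<^sup>2 \<le> real (card (f ` T)) * real (card CC)"
    unfolding CC_def by (rule card_sq_le_image_collisions[OF fT])
  also have "\<dots> \<le> real (card (f ` T)) * (2 * real (card T))" using CCle by (intro mult_left_mono) auto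
  finally have "real (card T) * real (card T) \<le> (2 * real (card (f ` T))) * real (card T)"
    by (simp add: power2_eq_square mult_ac)
  then have "real (card T) \<le> 2 * real (card (f ` T))"
    by (cases "card T = 0") (auto simp: mult_le_cancel_right)
  then show "real (card ?U) * \<tau>\<^sup>2 / 2 \<le> real (card (cone_sums A F))"
    using cT im by (simp add: p_def)
qed

text \<open>After Solymosi, Konyagin and Shkredov: a sum of two points on lines of one window lies in the cone spanned by
  that window, and the cones of different windows are disjoint.\<close>
lemma card_sumset_ge_windows:
  assumes A: "finite A" and Apos: "\<And>a. a \<in> A \<Longrightarrow> 0 < a"
    and S: "finite S" and W: "2 \<le> W"
    and fib: "\<And>l. l \<in> S \<Longrightarrow> \<tau> \<le> real (card (mult_fibre A l))" "\<And>l. l \<in> S \<Longrightarrow> real (card (mult_fibre A l)) \<le> M"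
    and \<tau>: "0 \<le> \<tau>"
    and nr: "\<And>l. 2 < W \<Longrightarrow> l \<in> S \<Longrightarrow> \<not> sum_rich (mult_fibre A l) M \<sigma>"
    and \<sigma>: "0 \<le> \<sigma>" "(real W * (real W - 1) / 2) * \<sigma> \<le> \<tau>\<^sup>2"
  shows "real (card S div W) * (real W * (real W - 1) / 4) * \<tau>\<^sup>2 \<le> (real (card (A + A)))\<^sup>2"
proof -
  define rk where "rk = (\<lambda>x. card {y\<in>S. y < x})"
  have rklt: "rk x < rk y" if "x \<in> S" "x < y" for x y
    unfolding rk_def using S that by (intro psubset_card_mono) auto
  have inj: "inj_on rk S" using rklt by (intro linorder_inj_onI) (auto simp: less_le)
  have rkmono: "rk x \<le> rk y" if "x \<le> y" for x y unfolding rk_def using S that by (intro card_mono) auto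
  have "rk ` S \<subseteq> {..<card S}"
    unfolding rk_def using S by (auto intro!: psubset_card_mono)
  then have rkS: "rk ` S = {..<card S}"
    using card_image[OF inj] by (intro card_subset_eq) auto
  \<comment> \<open>The windows consist of \<open>W\<close> consecutive slopes in increasing order;
    only the \<open>card S div W\<close> full ones are counted.\<close>
  define F where "F = (\<lambda>i. {x\<in>S. rk x div W = i})"
  have finF: "finite (F i)" for i using S by (simp add: F_def)
  have cF: "card (F i) = W" if i: "i < card S div W" for i
  proof -
    have "rk ` F i = {i * W..<(i + 1) * W}"
    proof
      show "rk ` F i \<subseteq> {i * W..<(i + 1) * W}"
      proof
        fix q assume "q \<in> rk ` F i"
        then have "q div W = i" by (auto simp: F_def)
        then have "q = i * W + q mod W" using div_mult_mod_eq[of q W] by simp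
        moreover have "q mod W < W" using W by simp
        ultimately have "i * W \<le> q" "q < (i + 1) * W" by (simp_all add: algebra_simps)
        then show "q \<in> {i * W..<(i + 1) * W}" by simp
      qed
      show "{i * W..<(i + 1) * W} \<subseteq> rk ` F i"
      proof
        fix q assume q: "q \<in> {i * W..<(i + 1) * W}"
        have "(i + 1) * W \<le> (card S div W) * W" using i by (intro mult_right_mono) auto
        also have "\<dots> \<le> card S" by simp
        finally have "q \<in> rk ` S" using q rkS by simp
        then obtain x where x: "x \<in> S" "rk x = q" by blast
        have "q div W = i" using q W by (intro div_nat_eqI) (auto simp: algebra_simps)
        then show "q \<in> rk ` F i" using x by (auto simp: F_def)
      qed
    qed
    moreover have "card (rk ` F i) = card (F i)" by (rule card_image) (rule inj_on_subset[OF inj], auto simp: F_def)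
    ultimately show ?thesis by simp
  qed
  define p where "p = real W * (real W - 1) / 2"
  have U: "finite (cone_sums A (F i))" "p * \<tau>\<^sup>2 / 2 \<le> real (card (cone_sums A (F i)))" if "i < card S div W" for i
  proof -
    have pp: "real (card (slope_pairs (F i))) = p" using card_slope_pairs[OF finF] cF[OF that] by (simp add: p_def)
    have "finite (cone_sums A (F i)) \<and> real (card (slope_pairs (F i))) * \<tau>\<^sup>2 / 2 \<le> real (card (cone_sums A (F i)))"
      by (intro conjI card_cone_sums_ge[OF A finF, where \<sigma>=\<sigma> and M=M and \<tau>=\<tau>])
        (use fib \<tau> \<sigma> nr cF[OF that] pp in \<open>auto simp: F_def p_def[symmetric]\<close>)
    then show "finite (cone_sums A (F i))" "p * \<tau>\<^sup>2 / 2 \<le> real (card (cone_sums A (F i)))"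
      using pp by auto
  qed
  have sep: False if "z \<in> cone_sums A (F i)" "z \<in> cone_sums A (F i')" "i < i'" for z i i'
  proof -
    obtain k l a b where z: "z = (a + b, k * a + l * b)" "(k, l) \<in> slope_pairs (F i)" "a \<in> mult_fibre A k" "b \<in> mult_fibre A l"
      using \<open>z \<in> cone_sums A (F i)\<close> unfolding cone_sums_def by blast
    obtain k' l' a' b' where z': "z = (a' + b', k' * a' + l' * b')" "(k', l') \<in> slope_pairs (F i')"
      "a' \<in> mult_fibre A k'" "b' \<in> mult_fibre A l'"
      using \<open>z \<in> cone_sums A (F i')\<close> unfolding cone_sums_def by blast
    have pos: "0 < a" "0 < b" "0 < a'" "0 < b'" using z z' Apos by (auto simp: mult_fibre_def)
    have kl: "k < l" "l \<in> S" "rk l div W = i" "k' < l'" "k' \<in> S" "rk k' div W = i'"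
      using z(2) z'(2) by (auto simp: slope_pairs_def F_def)
    have "l < k'"
    proof (rule ccontr)
      assume "\<not> l < k'"
      then have "rk k' \<le> rk l" by (intro rkmono) simp
      then have "rk k' div W \<le> rk l div W" by (rule div_le_mono)
      then show False using kl \<open>i < i'\<close> by simp
    qed
    \<comment> \<open>All coordinates are positive, so the slope of a sum lies between the slopes of
      its two summands; this separates the windows.\<close>
    have "k * a + l * b \<le> l * (a + b)" using kl pos by (simp add: algebra_simps)
    also have "\<dots> < k' * (a + b)" using \<open>l < k'\<close> pos by simp
    also have "\<dots> = k' * (a' + b')" using z z' by simp
    also have "\<dots> \<le> k' * a' + l' * b'" using kl pos by (simp add: algebra_simps)
    finally show False using z z' by simp
  qed
  have finAA: "finite (A + A)" using A by (simp add: finite_set_plus)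
  have subAA: "cone_sums A (F i) \<subseteq> (A + A) \<times> (A + A)" for i
    by (auto simp: cone_sums_def mult_fibre_def intro: set_plus_intro)
  let ?I = "{..<card S div W}"
  have "real (card S div W) * (p * \<tau>\<^sup>2 / 2) = (\<Sum>i\<in>?I. p * \<tau>\<^sup>2 / 2)" by simp
  also have "\<dots> \<le> (\<Sum>i\<in>?I. real (card (cone_sums A (F i))))" using U by (intro sum_mono) auto
  also have "\<dots> = real (card (\<Union>i\<in>?I. cone_sums A (F i)))"
  proof -
    have "card (\<Union>i\<in>?I. cone_sums A (F i)) = (\<Sum>i\<in>?I. card (cone_sums A (F i)))"
    proof (rule card_UN_disjoint)
      show "\<forall>i\<in>?I. \<forall>j\<in>?I. i \<noteq> j \<longrightarrow> cone_sums A (F i) \<inter> cone_sums A (F j) = {}"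
        using sep by (metis disjoint_iff linorder_neqE_nat)
    qed (use U in auto)
    then show ?thesis by simp
  qed
  also have "\<dots> \<le> real (card ((A + A) \<times> (A + A)))"
    using finAA subAA by (intro of_nat_mono card_mono) auto
  also have "\<dots> = (real (card (A + A)))\<^sup>2" by (simp add: card_cartesian_product power2_eq_square)
  finally show ?thesis by (simp add: p_def algebra_simps)
qed

section \<open>Multiplicative energy of sets with additive structure\<close>


text \<open>The window bound for \<open>W = 2\<close> and \<open>\<sigma> = 0\<close>, where the
  richness assumption is vacuous. Once there are two slopes, \<open>card S div 2\<close> is at least
  a third of \<open>card S\<close>; a single slope is covered by
  \<open>card A \<le> card (A + A)\<close>.\<close>

lemma solymosi_level:
  assumes A: "finite A" and Apos: "\<And>a. a \<in> A \<Longrightarrow> 0 < a"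
    and S: "finite S" and fib: "\<And>l. l \<in> S \<Longrightarrow> k \<le> real (card (mult_fibre A l))" and k: "0 \<le> k"
  shows "real (card S) * k\<^sup>2 \<le> 6 * (real (card (A + A)))\<^sup>2"
proof (cases "card S \<le> 1")
  case True
  show ?thesis
  proof (cases "S = {}")
    case False
    then obtain l where l: "l \<in> S" by blast
    have "k \<le> real (card A)"
      using fib[OF l] card_mono[OF A mult_fibre_subset[of A l]] by linarith
    moreover have "card A \<le> card (A + A)"
    proof (cases "A = {}")
      case False
      then obtain a where "a \<in> A" by blast
      then have "(+) a ` A \<subseteq> A + A" by (auto intro: set_plus_intro)
      then have "card ((+) a ` A) \<le> card (A + A)" using A by (intro card_mono) (auto simp: finite_set_plus)
      then show ?thesis by (simp add: card_image)
    qed simp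
    ultimately have "k\<^sup>2 \<le> (real (card (A + A)))\<^sup>2" using k by (intro power_mono) auto
    moreover have "real (card S) * k\<^sup>2 \<le> 1 * k\<^sup>2" using True by (intro mult_right_mono) auto
    ultimately show ?thesis by (smt (verit) zero_le_power2)
  qed simp
next
  case False
  have "real (card S div 2) * (real 2 * (real 2 - 1) / 4) * k\<^sup>2 \<le> (real (card (A + A)))\<^sup>2"
    by (rule card_sumset_ge_windows[OF A Apos S _ fib, where \<sigma>=0 and M="real (card A)"])
      (use k A in \<open>auto intro!: card_mono mult_fibre_subset\<close>)
  moreover have "card S \<le> 3 * (card S div 2)" using False by presburger
  then have "real (card S) \<le> 3 * real (card S div 2)" by linarith
  then have "real (card S) * k\<^sup>2 \<le> 3 * real (card S div 2) * k\<^sup>2" by (intro mult_right_mono) auto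
  ultimately show ?thesis by simp
qed

text \<open>Solymosi's bound for the multiplicative energy, by dyadic summation of the level bound;
  \<open>24 = 2\<^sup>2 * 6\<close>. The set \<open>\<Lambda>\<close> is left free so that two
  energies can later be taken over the same ratios.\<close>

lemma solymosi_energy:
  assumes A: "finite A" and Apos: "\<And>a. a \<in> A \<Longrightarrow> 0 < a"
    and \<Lambda>: "finite \<Lambda>" and J: "card A < 2 ^ J"
  shows "(\<Sum>l\<in>\<Lambda>. (real (card (mult_fibre A l)))\<^sup>2) \<le> 24 * real J * (real (card (A + A)))\<^sup>2"
proof -
  have "(\<Sum>l\<in>\<Lambda>. (real (card (mult_fibre A l)))\<^sup>2) \<le> 2\<^sup>2 * real J * (6 * (real (card (A + A)))\<^sup>2)"
  proof (rule dyadic_sum_power_le[OF \<Lambda>])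
    show "card (mult_fibre A l) < 2 ^ J" for l
      using card_mono[OF A mult_fibre_subset[of A l]] J by linarith
    show "real (card {x \<in> \<Lambda>. 2 ^ j \<le> card (mult_fibre A x)}) * (2 ^ j)\<^sup>2 \<le> 6 * (real (card (A + A)))\<^sup>2" for j
    proof (rule solymosi_level[OF A Apos])
      fix l assume "l \<in> {x \<in> \<Lambda>. 2 ^ j \<le> card (mult_fibre A x)}"
      then have "2 ^ j \<le> card (mult_fibre A l)" by simp
      then show "2 ^ j \<le> real (card (mult_fibre A l))" by (metis of_nat_le_iff of_nat_numeral of_nat_power)
    qed (use \<Lambda> in auto)
  qed simp_all
  then show ?thesis by simp
qed

lemma sum_mult_fibre_le:
  assumes B: "finite B" and B0: "\<And>b. b \<in> B \<Longrightarrow> 0 < b" and X: "finite \<Xi>"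
  shows "(\<Sum>l\<in>\<Xi>. real (card (mult_fibre B l))) \<le> (real (card B))\<^sup>2"
proof -
  let ?g = "\<lambda>(l, b). (b, l * b)"
  have inj: "inj_on ?g (SIGMA l:\<Xi>. mult_fibre B l)"
    using B0 by (force simp: inj_on_def mult_fibre_def)
  have sub: "?g ` (SIGMA l:\<Xi>. mult_fibre B l) \<subseteq> B \<times> B" by (auto simp: mult_fibre_def)
  have "(\<Sum>l\<in>\<Xi>. real (card (mult_fibre B l))) = real (card (SIGMA l:\<Xi>. mult_fibre B l))"
    using X B by (simp add: card_SigmaI)
  also have "\<dots> \<le> real (card (B \<times> B))"
    using card_inj_on_le[OF inj sub] B by (intro of_nat_mono) simp
  finally show ?thesis by (simp add: card_cartesian_product power2_eq_square)
qed

text \<open>The lines of slope \<open>\<mu>\<close> through the points of \<open>Y \<times> Y\<close> are rich in \<open>Z \<times> Z\<close>.\<close>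
lemma few_sums_mult_level:
  fixes B Y Z \<Xi> :: "real set"
  assumes B: "finite B" and Bpos: "\<And>b. b \<in> B \<Longrightarrow> 0 < b" and Y: "finite Y" and Z: "finite Z"
    and cB: "real (card B) \<le> M" and cY: "real (card Y) \<le> M" and cZ: "real (card Z) \<le> M"
    and deg: "\<And>b. b \<in> B \<Longrightarrow> \<delta> \<le> real (card {y\<in>Y. b + y \<in> Z})" and \<delta>: "0 < \<delta>"
    and X: "finite \<Xi>" and Xpos: "\<And>\<mu>. \<mu> \<in> \<Xi> \<Longrightarrow> 0 < \<mu>"
    and fib: "\<And>\<mu>. \<mu> \<in> \<Xi> \<Longrightarrow> k \<le> real (card (mult_fibre B \<mu>))" and k: "0 < k"
  shows "real (card \<Xi>) * k\<^sup>2 * \<delta> ^ 4 \<le> 1024 * M ^ 6"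
proof (cases "\<Xi> = {}")
  case True
  have "0 \<le> M" using cB by (smt (verit) of_nat_0_le_iff)
  then show ?thesis using True by simp
next
  case False
  have "B \<noteq> {}" using False fib k by (force simp: mult_fibre_def)
  then obtain b0 where b0: "b0 \<in> B" by blast
  have "card {y\<in>Y. b0 + y \<in> Z} \<le> card Y" using Y by (intro card_mono) auto
  then have \<delta>M: "\<delta> \<le> M" using deg[OF b0] cY by linarith
  have M: "0 < M" using \<delta> \<delta>M by linarith
  \<comment> \<open>Half of a lower bound for the average of \<open>h\<close> over the lines,
    weighted by \<open>\<nu>\<close>. If it is below 2, the first moment bound \<open>gk\<close>
    suffices.\<close>
  define h0 where "h0 = k * \<delta>\<^sup>2 / (2 * M\<^sup>2)"
  define g where "g = real (card \<Xi>)"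
  have gk: "g * k \<le> M\<^sup>2"
  proof -
    have "g * k \<le> (\<Sum>\<mu>\<in>\<Xi>. real (card (mult_fibre B \<mu>)))"
      using sum_mono[of \<Xi> "\<lambda>_. k" "\<lambda>\<mu>. real (card (mult_fibre B \<mu>))"] fib by (simp add: g_def)
    also have "\<dots> \<le> (real (card B))\<^sup>2" by (rule sum_mult_fibre_le[OF B Bpos X])
    also have "\<dots> \<le> M\<^sup>2" using cB by (intro power_mono) auto
    finally show ?thesis .
  qed
  show ?thesis
  proof (cases "h0 < 2")
    case True
    then have kd: "k * \<delta>\<^sup>2 \<le> 4 * M\<^sup>2" using M by (simp add: h0_def field_simps)
    have "g * k\<^sup>2 * \<delta> ^ 4 = (g * k) * ((k * \<delta>\<^sup>2) * \<delta>\<^sup>2)" by (simp add: power2_eq_square power4_eq_xxxx)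
    also have "\<dots> \<le> M\<^sup>2 * ((4 * M\<^sup>2) * M\<^sup>2)"
      by (intro mult_mono[OF gk] mult_mono[OF kd]) (use \<delta> \<delta>M k M in \<open>auto intro: power_mono\<close>)
    also have "\<dots> = 4 * M ^ 6" by (simp add: power2_eq_square eval_nat_numeral)
    also have "\<dots> \<le> 1024 * M ^ 6" using M by simp
    finally show ?thesis by (simp add: g_def)
  next
    case False
    then have h0: "2 \<le> h0" by simp
    define \<nu> where "\<nu> = (\<lambda>(m, c). real (card {y\<in>Y. m * y + c \<in> Y}))"
    define h where "h = (\<lambda>(m, c). real (card {x\<in>Z. m * x + c \<in> Z}))"
    define Lm where "Lm = (\<lambda>m. (\<lambda>(y, y'). y' - m * y) ` (Y \<times> Y))"
    define L where "L = (SIGMA m:\<Xi>. Lm m)"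
    have finLm: "finite (Lm m)" for m using Y by (simp add: Lm_def)
    have finL: "finite L" using X finLm by (simp add: L_def)
    have cfib: "real (card {p \<in> Y \<times> Y. (case p of (y, y') \<Rightarrow> y' - m * y) = c}) = \<nu> (m, c)" for m c
    proof -
      have "{p \<in> Y \<times> Y. (case p of (y, y') \<Rightarrow> y' - m * y) = c} = (\<lambda>y. (y, m * y + c)) ` {y\<in>Y. m * y + c \<in> Y}"
        by (auto simp: image_iff)
      moreover have "inj_on (\<lambda>y. (y, m * y + c)) {y\<in>Y. m * y + c \<in> Y}" by (auto simp: inj_on_def)
      ultimately show ?thesis by (simp add: card_image \<nu>_def)
    qed
    have \<nu>sum: "(\<Sum>c\<in>Lm m. \<nu> (m, c)) = (real (card Y))\<^sup>2" for m
    proof -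
      have "(\<Sum>c\<in>Lm m. \<nu> (m, c)) = real (card (Y \<times> Y))"
        unfolding cfib[symmetric] Lm_def
        by (rule card_eq_sum_fibres[symmetric]) (use Y in auto)
      then show ?thesis by (simp add: card_cartesian_product power2_eq_square)
    qed
    \<comment> \<open>For \<open>b\<close> and \<open>m * b\<close> in \<open>B\<close>, admissible
      summands \<open>y\<close> and \<open>y'\<close> give a point
      \<open>(b + y, m * b + y')\<close> of \<open>Z \<times> Z\<close> on the line of slope
      \<open>m\<close> through \<open>(y, y')\<close>.\<close>
    have inc: "k * \<delta>\<^sup>2 \<le> (\<Sum>c\<in>Lm m. \<nu> (m, c) * h (m, c))" if m: "m \<in> \<Xi>" for m
    proof -
      define D where "D = (SIGMA b:mult_fibre B m. {y\<in>Y. b + y \<in> Z} \<times> {y\<in>Y. m * b + y \<in> Z})"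
      define D' where "D' = (SIGMA p:Y \<times> Y. {x\<in>Z. m * x + (snd p - m * fst p) \<in> Z})"
      have finD': "finite D'" unfolding D'_def using Y Z by auto
      have "k * \<delta>\<^sup>2 \<le> (\<Sum>b\<in>mult_fibre B m. \<delta> * \<delta>)"
        using fib[OF m] \<delta> by (simp add: power2_eq_square mult_right_mono)
      also have "\<dots> \<le> (\<Sum>b\<in>mult_fibre B m. real (card {y\<in>Y. b + y \<in> Z}) * real (card {y\<in>Y. m * b + y \<in> Z}))"
        using deg \<delta> by (intro sum_mono mult_mono) (auto simp: mult_fibre_def)
      also have "\<dots> = real (card D)" unfolding D_def using B Y by (simp add: card_SigmaI card_cartesian_product)
      also have "\<dots> \<le> real (card D')"
      proof -
        let ?g = "\<lambda>(b, y, y'). ((y, y'), b + y)"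
        have "inj_on ?g D" by (rule inj_onI) (auto split: prod.splits)
        moreover have "?g ` D \<subseteq> D'"
        proof
          fix z assume "z \<in> ?g ` D"
          then obtain u where u: "u \<in> D" "z = ?g u" by blast
          obtain b y y' where u': "u = (b, y, y')" by (metis prod.collapse)
          have h: "y \<in> Y" "y' \<in> Y" "b + y \<in> Z" "m * b + y' \<in> Z" using u u' by (auto simp: D_def)
          have "m * (b + y) + (y' - m * y) = m * b + y'" by (simp add: algebra_simps)
          then have "m * (b + y) + (y' - m * y) \<in> Z" using h(4) by (simp only:)
          then show "z \<in> D'" using h u u' by (simp add: D'_def)
        qed
        ultimately have "card D \<le> card D'" using card_inj_on_le finD' by blast
        then show ?thesis by simp
      qed
      also have "\<dots> = (\<Sum>p\<in>Y \<times> Y. h (m, snd p - m * fst p))"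
        unfolding D'_def using Y Z by (simp add: card_SigmaI h_def)
      also have "\<dots> = (\<Sum>c\<in>Lm m. \<Sum>p\<in>{p \<in> Y \<times> Y. (case p of (y, y') \<Rightarrow> y' - m * y) = c}. h (m, snd p - m * fst p))"
        unfolding Lm_def by (rule sum.image_gen) (use Y in auto)
      also have "\<dots> = (\<Sum>c\<in>Lm m. \<Sum>p\<in>{p \<in> Y \<times> Y. (case p of (y, y') \<Rightarrow> y' - m * y) = c}. h (m, c))"
        by (intro sum.cong refl) auto
      also have "\<dots> = (\<Sum>c\<in>Lm m. \<nu> (m, c) * h (m, c))" by (simp add: cfib)
      finally show ?thesis .
    qed
    have tot: "g * (k * \<delta>\<^sup>2) \<le> (\<Sum>l\<in>L. \<nu> l * h l)"
    proof -
      have "g * (k * \<delta>\<^sup>2) = (\<Sum>m\<in>\<Xi>. k * \<delta>\<^sup>2)" by (simp add: g_def)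
      also have "\<dots> \<le> (\<Sum>m\<in>\<Xi>. \<Sum>c\<in>Lm m. \<nu> (m, c) * h (m, c))" by (intro sum_mono inc)
      also have "\<dots> = (\<Sum>l\<in>L. \<nu> l * h l)"
        unfolding L_def by (subst sum.Sigma) (use X finLm in auto)
      finally show ?thesis .
    qed
    have \<nu>tot: "(\<Sum>l\<in>L. \<nu> l) \<le> g * M\<^sup>2"
    proof -
      have "(\<Sum>l\<in>L. \<nu> l) = (\<Sum>m\<in>\<Xi>. \<Sum>c\<in>Lm m. \<nu> (m, c))"
        unfolding L_def by (subst sum.Sigma) (use X finLm in auto)
      also have "\<dots> = g * (real (card Y))\<^sup>2" by (simp add: \<nu>sum g_def)
      also have "\<dots> \<le> g * M\<^sup>2" using cY by (intro mult_left_mono power_mono) (auto simp: g_def)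
      finally show ?thesis .
    qed
    have nn: "0 \<le> \<nu> l" "0 \<le> h l" for l by (auto simp: \<nu>_def h_def case_prod_unfold)
    define L1 where "L1 = {l\<in>L. h0 \<le> h l}"
    define L2 where "L2 = {l\<in>L. h0 \<le> \<nu> l}"
    \<comment> \<open>Lines with \<open>h l < h0\<close> account for at most half of the
      incidences.\<close>
    have "(\<Sum>l\<in>L. \<nu> l * h l) \<le> (\<Sum>l\<in>L. (if h0 \<le> h l then \<nu> l * h l else 0) + h0 * \<nu> l)"
    proof (rule sum_mono)
      fix l
      show "\<nu> l * h l \<le> (if h0 \<le> h l then \<nu> l * h l else 0) + h0 * \<nu> l"
      proof (cases "h0 \<le> h l")
        case True
        then show ?thesis using nn h0 by simp
      next
        case False
        then have "\<nu> l * h l \<le> \<nu> l * h0" using nn by (intro mult_left_mono) auto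
        then show ?thesis using False by (simp add: mult.commute)
      qed
    qed
    also have "\<dots> = (\<Sum>l\<in>L1. \<nu> l * h l) + h0 * (\<Sum>l\<in>L. \<nu> l)"
      using finL by (simp add: sum.distrib sum_distrib_left L1_def sum.inter_filter)
    also have "\<dots> \<le> (\<Sum>l\<in>L1. \<nu> l * h l) + h0 * (g * M\<^sup>2)"
      using \<nu>tot h0 by (intro add_left_mono mult_left_mono) auto
    also have "h0 * (g * M\<^sup>2) = g * (k * \<delta>\<^sup>2) / 2" using M by (simp add: h0_def)
    finally have half: "g * (k * \<delta>\<^sup>2) / 2 \<le> (\<Sum>l\<in>L1. \<nu> l * h l)" using tot by linarith
    have fin12: "finite L1" "finite L2" using finL by (auto simp: L1_def L2_def)
    \<comment> \<open>The product is split into squares. Where \<open>\<nu> l < h0\<close>, the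
      square of \<open>\<nu> l\<close> is at most that of \<open>h l\<close>, because
      \<open>h0 \<le> h l\<close> on \<open>L1\<close>. Thus the incidence bound is applied only to
      lines that are rich in \<open>Z \<times> Z\<close> or rich in
      \<open>Y \<times> Y\<close>.\<close>
    have "2 * (\<Sum>l\<in>L1. \<nu> l * h l) \<le> (\<Sum>l\<in>L1. 2 * (h l)\<^sup>2 + (if h0 \<le> \<nu> l then (\<nu> l)\<^sup>2 else 0))"
      unfolding sum_distrib_left
    proof (rule sum_mono)
      fix l assume l: "l \<in> L1"
      have am: "2 * (\<nu> l * h l) \<le> (\<nu> l)\<^sup>2 + (h l)\<^sup>2" using sum_squares_bound[of "\<nu> l" "h l"] by simp
      show "2 * (\<nu> l * h l) \<le> 2 * (h l)\<^sup>2 + (if h0 \<le> \<nu> l then (\<nu> l)\<^sup>2 else 0)"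
      proof (cases "h0 \<le> \<nu> l")
        case True
        have "2 * (\<nu> l * h l) \<le> 2 * (h l)\<^sup>2 + (\<nu> l)\<^sup>2" using am zero_le_power2[of "h l"] by linarith
        then show ?thesis using True by simp
      next
        case False
        then have "(\<nu> l)\<^sup>2 \<le> (h l)\<^sup>2" using l nn by (intro power_mono) (auto simp: L1_def)
        then show ?thesis using am False by simp
      qed
    qed
    also have "\<dots> = 2 * (\<Sum>l\<in>L1. (h l)\<^sup>2) + (\<Sum>l\<in>L1. if h0 \<le> \<nu> l then (\<nu> l)\<^sup>2 else 0)"
      by (simp add: sum.distrib sum_distrib_left)
    also have "(\<Sum>l\<in>L1. if h0 \<le> \<nu> l then (\<nu> l)\<^sup>2 else 0) \<le> (\<Sum>l\<in>L. if h0 \<le> \<nu> l then (\<nu> l)\<^sup>2 else 0)"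
      using finL by (intro sum_mono2) (auto simp: L1_def)
    also have "\<dots> = (\<Sum>l\<in>L2. (\<nu> l)\<^sup>2)" using finL by (simp add: L2_def sum.inter_filter)
    finally have S12: "2 * (\<Sum>l\<in>L1. \<nu> l * h l) \<le> 2 * (\<Sum>l\<in>L1. (h l)\<^sup>2) + (\<Sum>l\<in>L2. (\<nu> l)\<^sup>2)" by simp
    have "h0 * (\<Sum>(m, c)\<in>L1. (real (card {x\<in>Z. m * x + c \<in> Z}))\<^sup>2) \<le> 128 * (real (card Z))\<^sup>2 * (real (card Z))\<^sup>2"
      by (rule szemeredi_trotter_grid[OF Z Z fin12(1)])
        (use h0 Xpos in \<open>auto simp: L1_def L_def h_def\<close>)
    also have "\<dots> \<le> 128 * M\<^sup>2 * M\<^sup>2" using cZ by (intro mult_mono power_mono) auto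
    finally have ST1: "h0 * (\<Sum>l\<in>L1. (h l)\<^sup>2) \<le> 128 * M ^ 4"
      by (simp add: h_def case_prod_unfold power2_eq_square power4_eq_xxxx)
    have "h0 * (\<Sum>(m, c)\<in>L2. (real (card {x\<in>Y. m * x + c \<in> Y}))\<^sup>2) \<le> 128 * (real (card Y))\<^sup>2 * (real (card Y))\<^sup>2"
      by (rule szemeredi_trotter_grid[OF Y Y fin12(2)])
        (use h0 Xpos in \<open>auto simp: L2_def L_def \<nu>_def\<close>)
    also have "\<dots> \<le> 128 * M\<^sup>2 * M\<^sup>2" using cY by (intro mult_mono power_mono) auto
    finally have ST2: "h0 * (\<Sum>l\<in>L2. (\<nu> l)\<^sup>2) \<le> 128 * M ^ 4"
      by (simp add: \<nu>_def case_prod_unfold power2_eq_square power4_eq_xxxx)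
    have "h0 * (g * (k * \<delta>\<^sup>2)) \<le> h0 * (2 * (\<Sum>l\<in>L1. \<nu> l * h l))" using half h0 by (intro mult_left_mono) auto
    also have "\<dots> \<le> h0 * (2 * (\<Sum>l\<in>L1. (h l)\<^sup>2) + (\<Sum>l\<in>L2. (\<nu> l)\<^sup>2))" using S12 h0 by (intro mult_left_mono) auto
    also have "\<dots> \<le> 384 * M ^ 4" using ST1 ST2 by (simp add: algebra_simps)
    finally have "h0 * (g * (k * \<delta>\<^sup>2)) * (2 * M\<^sup>2) \<le> 384 * M ^ 4 * (2 * M\<^sup>2)" using M by (intro mult_right_mono) auto
    moreover have "h0 * (g * (k * \<delta>\<^sup>2)) * (2 * M\<^sup>2) = g * k\<^sup>2 * \<delta> ^ 4"
      using M by (simp add: h0_def power2_eq_square power4_eq_xxxx)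
    moreover have "384 * M ^ 4 * (2 * M\<^sup>2) = 768 * M ^ 6" by (simp add: eval_nat_numeral)
    moreover have "768 * M ^ 6 \<le> 1024 * M ^ 6" using M by simp
    ultimately have "g * k\<^sup>2 * \<delta> ^ 4 \<le> 1024 * M ^ 6" by linarith
    then show ?thesis by (simp add: g_def)
  qed
qed

lemma few_sums_mult_energy:
  fixes B Y Z \<Lambda> :: "real set"
  assumes B: "finite B" and Bpos: "\<And>b. b \<in> B \<Longrightarrow> 0 < b" and Y: "finite Y" and Z: "finite Z"
    and cB: "real (card B) \<le> M" and cY: "real (card Y) \<le> M" and cZ: "real (card Z) \<le> M"
    and deg: "\<And>b. b \<in> B \<Longrightarrow> \<delta> \<le> real (card {y\<in>Y. b + y \<in> Z})" and \<delta>: "0 < \<delta>"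
    and X: "finite \<Lambda>" and Xpos: "\<And>\<mu>. \<mu> \<in> \<Lambda> \<Longrightarrow> 0 < \<mu>" and J: "card B < 2 ^ J"
  shows "(\<Sum>l\<in>\<Lambda>. (real (card (mult_fibre B l)))\<^sup>2) * \<delta> ^ 4 \<le> 4096 * real J * M ^ 6"
proof -
  have "(\<Sum>l\<in>\<Lambda>. (real (card (mult_fibre B l)))\<^sup>2) \<le> 2\<^sup>2 * real J * (1024 * M ^ 6 / \<delta> ^ 4)"
  proof (rule dyadic_sum_power_le[OF X])
    show "card (mult_fibre B l) < 2 ^ J" for l
      using card_mono[OF B mult_fibre_subset[of B l]] J by linarith
    show "real (card {x \<in> \<Lambda>. 2 ^ j \<le> card (mult_fibre B x)}) * (2 ^ j)\<^sup>2 \<le> 1024 * M ^ 6 / \<delta> ^ 4" for j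
    proof -
      have "2 ^ j \<le> real (card (mult_fibre B l))" if "l \<in> {x \<in> \<Lambda>. 2 ^ j \<le> card (mult_fibre B x)}" for l
        using that by (metis (mono_tags) mem_Collect_eq of_nat_le_iff of_nat_numeral of_nat_power)
      then have "real (card {x \<in> \<Lambda>. 2 ^ j \<le> card (mult_fibre B x)}) * (2 ^ j)\<^sup>2 * \<delta> ^ 4 \<le> 1024 * M ^ 6"
        using assms by (intro few_sums_mult_level[OF B Bpos Y Z cB cY cZ deg \<delta>]) auto
      then show ?thesis using \<delta> by (simp add: field_simps)
    qed
  qed simp_all
  then show ?thesis using \<delta> by (simp add: field_simps)
qed

text \<open>A collision \<open>a * b = a' * b'\<close> amounts to an element \<open>a\<close> of the
  fibre of \<open>A\<close> and an element \<open>b'\<close> of the fibre of \<open>B\<close> over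
  the common ratio \<open>b / b' = a' / a\<close>. A second Cauchy-Schwarz separates the energies of
  \<open>A\<close> and \<open>B\<close>.\<close>

lemma card_product_ge:
  fixes A B :: "real set"
  assumes A: "finite A" and Apos: "\<And>a. a \<in> A \<Longrightarrow> 0 < a" and B: "finite B" and Bpos: "\<And>b. b \<in> B \<Longrightarrow> 0 < b"
  obtains \<Lambda> where "finite \<Lambda>" "\<And>l. l \<in> \<Lambda> \<Longrightarrow> 0 < l"
    "(real (card A) * real (card B)) ^ 4 \<le> (real (card (A * B)))\<^sup>2 *
      ((\<Sum>l\<in>\<Lambda>. (real (card (mult_fibre A l)))\<^sup>2) * (\<Sum>l\<in>\<Lambda>. (real (card (mult_fibre B l)))\<^sup>2))"
proof -
  define \<Lambda> where "\<Lambda> = (\<lambda>(b, b'). b / b') ` (B \<times> B)"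
  define f where "f = (\<lambda>(a::real, b::real). a * b)"
  define CC where "CC = {(x, y). x \<in> A \<times> B \<and> y \<in> A \<times> B \<and> f x = f y}"
  define D where "D = (SIGMA l:\<Lambda>. mult_fibre A l \<times> mult_fibre B l)"
  have fin: "finite \<Lambda>" using B by (simp add: \<Lambda>_def)
  have finD: "finite D" using A B fin by (simp add: D_def)
  define g where "g = (\<lambda>((a::real, b::real), (a'::real, b'::real)). (b / b', a, b'))"
  have "inj_on g CC"
  proof (rule inj_onI)
    fix u v assume u: "u \<in> CC" and v: "v \<in> CC" and e: "g u = g v"
    obtain a b a' b' where u': "u = ((a, b), (a', b'))" by (metis prod.collapse)
    obtain c d c' d' where v': "v = ((c, d), (c', d'))" by (metis prod.collapse)
    have pos: "0 < b'" "0 < d'" using u v u' v' Bpos by (auto simp: CC_def)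
    have "a = c" "b' = d'" "b / b' = d / d'" using e u' v' by (auto simp: g_def)
    then have "b = d" using pos by simp
    moreover have "a * b = a' * b'" "c * d = c' * d'" using u v u' v' by (auto simp: CC_def f_def)
    ultimately have "a' = c'" using pos \<open>a = c\<close> \<open>b' = d'\<close> by simp
    then show "u = v" using u' v' \<open>a = c\<close> \<open>b' = d'\<close> \<open>b = d\<close> by simp
  qed
  moreover have "g ` CC \<subseteq> D"
  proof
    fix z assume "z \<in> g ` CC"
    then obtain u where u: "u \<in> CC" "z = g u" by blast
    obtain a b a' b' where u': "u = ((a, b), (a', b'))" by (metis prod.collapse)
    have h: "a \<in> A" "b \<in> B" "a' \<in> A" "b' \<in> B" "a * b = a' * b'" using u u' by (auto simp: CC_def f_def)
    then have "0 < b'" using Bpos by blast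
    then have "b / b' * a = a'" "b / b' * b' = b" using h by (simp_all add: field_simps)
    then show "z \<in> D" using u u' h by (auto simp: g_def D_def \<Lambda>_def mult_fibre_def)
  qed
  ultimately have "card CC \<le> card D" using card_inj_on_le finD by blast
  have "(real (card (A \<times> B)))\<^sup>2 \<le> real (card (f ` (A \<times> B))) * real (card CC)"
    unfolding CC_def by (rule card_sq_le_image_collisions) (use A B in auto)
  also have "f ` (A \<times> B) = A * B" by (auto simp: f_def set_times_def)
  also have "real (card (A * B)) * real (card CC) \<le> real (card (A * B)) * real (card D)"
    using \<open>card CC \<le> card D\<close> by (intro mult_left_mono) auto
  also have "real (card D) = (\<Sum>l\<in>\<Lambda>. real (card (mult_fibre A l)) * real (card (mult_fibre B l)))"
    unfolding D_def using fin A B by (simp add: card_SigmaI card_cartesian_product)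
  finally have 1: "(real (card A) * real (card B))\<^sup>2 \<le> real (card (A * B)) *
      (\<Sum>l\<in>\<Lambda>. real (card (mult_fibre A l)) * real (card (mult_fibre B l)))" by (simp add: card_cartesian_product)
  have "(real (card A) * real (card B)) ^ 4 = ((real (card A) * real (card B))\<^sup>2)\<^sup>2" by simp
  also have "\<dots> \<le> (real (card (A * B)) *
      (\<Sum>l\<in>\<Lambda>. real (card (mult_fibre A l)) * real (card (mult_fibre B l))))\<^sup>2"
    using 1 by (intro power_mono) auto
  also have "\<dots> = (real (card (A * B)))\<^sup>2 *
      (\<Sum>l\<in>\<Lambda>. real (card (mult_fibre A l)) * real (card (mult_fibre B l)))\<^sup>2" by (simp add: power_mult_distrib)
  also have "\<dots> \<le> (real (card (A * B)))\<^sup>2 *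
      ((\<Sum>l\<in>\<Lambda>. (real (card (mult_fibre A l)))\<^sup>2) * (\<Sum>l\<in>\<Lambda>. (real (card (mult_fibre B l)))\<^sup>2))"
    by (intro mult_left_mono Cauchy_Schwarz_ineq_sum) auto
  finally show ?thesis using that[of \<Lambda>] fin Bpos by (force simp: \<Lambda>_def)
qed

text \<open>Let \<open>\<delta>\<close> be a dyadic degree that carries the edges and
  \<open>B'\<close> the elements of about that degree. The energy of \<open>B'\<close> is at most of
  order \<open>M ^ 6 / \<delta> ^ 4\<close>, while \<open>card B' * \<delta>\<close> is at least of
  order \<open>\<sigma> / J\<close>, so the unknown \<open>\<delta>\<close> cancels in the fourth
  powers. The energy of \<open>A\<close> is bounded by \<open>solymosi_energy\<close>.\<close>

lemma card_product_fibre_ge: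
  fixes A B :: "real set"
  assumes A: "finite A" and Apos: "\<And>a. a \<in> A \<Longrightarrow> 0 < a" and B: "B \<subseteq> A"
    and cB: "real (card B) \<le> M" and rich: "sum_rich B M \<sigma>" and \<sigma>: "0 \<le> \<sigma>"
    and J: "card A < 2 ^ J" "M < 2 ^ J" "0 < J"
  shows "(real (card A)) ^ 4 * \<sigma> ^ 4 \<le> 2 ^ 21 * real J ^ 6 * (real (card (A + A)))\<^sup>2 * M ^ 6 * (real (card (A * B)))\<^sup>2"
proof -
  obtain Y Z where Y: "finite Y" and Z: "finite Z" and cY: "real (card Y) \<le> M" and cZ: "real (card Z) \<le> M"
    and big: "\<sigma> < real (card {(b, y). b \<in> B \<and> y \<in> Y \<and> b + y \<in> Z})"
    using rich unfolding sum_rich_def by blast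
  have finB: "finite B" using A B finite_subset by blast
  define dg where "dg = (\<lambda>b. card {y\<in>Y. b + y \<in> Z})"
  define X where "X = {b\<in>B. 1 \<le> dg b}"
  have dgY: "dg b < 2 ^ J" for b
  proof -
    have "dg b \<le> card Y" unfolding dg_def using Y by (intro card_mono) auto
    then have "real (dg b) < 2 ^ J" using cY J(2) by linarith
    then show ?thesis by (metis of_nat_less_iff of_nat_numeral of_nat_power)
  qed
  have "{(b, y). b \<in> B \<and> y \<in> Y \<and> b + y \<in> Z} = (SIGMA b:B. {y\<in>Y. b + y \<in> Z})" by auto
  then have "real (card {(b, y). b \<in> B \<and> y \<in> Y \<and> b + y \<in> Z}) = (\<Sum>b\<in>B. real (dg b))"
    using finB Y by (simp add: card_SigmaI dg_def)
  also have "\<dots> = (\<Sum>b\<in>X. real (dg b))"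
    unfolding X_def using finB by (intro sum.mono_neutral_right) auto
  finally have S: "\<sigma> < (\<Sum>b\<in>X. real (dg b))" using big by simp
  have finX: "finite X" using finB by (simp add: X_def)
  obtain j where j: "j < J" "(\<Sum>b\<in>X. real (dg b)) \<le> real J * (\<Sum>b\<in>{b\<in>X. 2 ^ j \<le> dg b \<and> dg b < 2 ^ Suc j}. real (dg b))"
    by (rule dyadic_pigeonhole[of X dg J "\<lambda>b. real (dg b)"]) (use finX dgY J in \<open>auto simp: X_def\<close>)
  define B' where "B' = {b\<in>X. 2 ^ j \<le> dg b \<and> dg b < 2 ^ Suc j}"
  define \<delta> where "\<delta> = (2::real) ^ j"
  have \<delta>: "0 < \<delta>" by (simp add: \<delta>_def)
  have B'B: "B' \<subseteq> B" by (auto simp: B'_def X_def)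
  note B' = B'B finite_subset[OF B'B finB]
  have deg1: "\<delta> \<le> real (card {y\<in>Y. b + y \<in> Z})" if "b \<in> B'" for b
  proof -
    have "2 ^ j \<le> dg b" using that by (simp add: B'_def)
    then show ?thesis unfolding dg_def \<delta>_def by (metis of_nat_le_iff of_nat_numeral of_nat_power)
  qed
  have deg2: "real (dg b) \<le> 2 * \<delta>" if "b \<in> B'" for b
  proof -
    have "dg b \<le> 2 ^ Suc j" using that by (simp add: B'_def)
    then have "real (dg b) \<le> real (2 ^ Suc j)" by (simp only: of_nat_le_iff)
    then show ?thesis by (simp add: \<delta>_def)
  qed
  have "\<sigma> \<le> real J * (\<Sum>b\<in>B'. real (dg b))" using S j(2) by (simp add: B'_def)
  also have "\<dots> \<le> real J * (\<Sum>b\<in>B'. 2 * \<delta>)" using deg2 by (intro mult_left_mono sum_mono) auto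
  finally have \<sigma>B: "\<sigma> \<le> 2 * real J * (real (card B') * \<delta>)" by (simp add: mult_ac)
  have Bpos: "\<And>b. b \<in> B' \<Longrightarrow> 0 < b" using B' B Apos by blast
  obtain \<Lambda> where \<Lambda>: "finite \<Lambda>" "\<And>l. l \<in> \<Lambda> \<Longrightarrow> 0 < l" and
    prod: "(real (card A) * real (card B')) ^ 4 \<le> (real (card (A * B')))\<^sup>2 *
      ((\<Sum>l\<in>\<Lambda>. (real (card (mult_fibre A l)))\<^sup>2) * (\<Sum>l\<in>\<Lambda>. (real (card (mult_fibre B' l)))\<^sup>2))"
    using card_product_ge[OF A Apos B'(2) Bpos] by blast
  define m where "m = real (card (A + A))"
  define t where "t = real (card (A * B))"
  have cB': "card B' \<le> card B" "card B' \<le> card A" using B' B A finB by (auto intro!: card_mono)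
  have E1: "(\<Sum>l\<in>\<Lambda>. (real (card (mult_fibre A l)))\<^sup>2) \<le> 24 * real J * m\<^sup>2"
    unfolding m_def by (rule solymosi_energy[OF A Apos \<Lambda>(1) J(1)])
  have E2: "(\<Sum>l\<in>\<Lambda>. (real (card (mult_fibre B' l)))\<^sup>2) * \<delta> ^ 4 \<le> 4096 * real J * M ^ 6"
    by (rule few_sums_mult_energy[OF B'(2) Bpos Y Z _ cY cZ deg1 \<delta> \<Lambda>]) (use cB cB' J in auto)
  have t: "real (card (A * B')) \<le> t" unfolding t_def
    using A B finB B' by (intro of_nat_mono card_mono finite_set_times set_times_mono2) auto
  have "(real (card A)) ^ 4 * \<sigma> ^ 4 \<le> (real (card A)) ^ 4 * (2 * real J * (real (card B') * \<delta>)) ^ 4"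
    using \<sigma>B \<sigma> by (intro mult_left_mono power_mono) auto
  also have "\<dots> = 16 * real J ^ 4 * ((real (card A) * real (card B')) ^ 4 * \<delta> ^ 4)"
    by (simp add: power_mult_distrib)
  also have "\<dots> \<le> 16 * real J ^ 4 * (((real (card (A * B')))\<^sup>2 *
      ((\<Sum>l\<in>\<Lambda>. (real (card (mult_fibre A l)))\<^sup>2) * (\<Sum>l\<in>\<Lambda>. (real (card (mult_fibre B' l)))\<^sup>2))) * \<delta> ^ 4)"
    using prod \<delta> by (intro mult_left_mono mult_right_mono) auto
  also have "\<dots> = 16 * real J ^ 4 * ((real (card (A * B')))\<^sup>2 *
      ((\<Sum>l\<in>\<Lambda>. (real (card (mult_fibre A l)))\<^sup>2) * ((\<Sum>l\<in>\<Lambda>. (real (card (mult_fibre B' l)))\<^sup>2) * \<delta> ^ 4)))"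
    by (simp add: mult_ac)
  also have "\<dots> \<le> 16 * real J ^ 4 * (t\<^sup>2 * ((24 * real J * m\<^sup>2) * (4096 * real J * M ^ 6)))"
    by (intro mult_left_mono mult_mono power_mono t E1 E2) (auto intro!: mult_nonneg_nonneg sum_nonneg simp: \<delta>_def)
  also have "\<dots> = 1572864 * (real J ^ 6 * m\<^sup>2 * M ^ 6 * t\<^sup>2)" by (simp add: eval_nat_numeral)
  also have "\<dots> \<le> 2 ^ 21 * (real J ^ 6 * m\<^sup>2 * M ^ 6 * t\<^sup>2)"
  proof (rule mult_right_mono)
    have "0 \<le> M" using cB by (smt (verit) of_nat_0_le_iff)
    then show "0 \<le> real J ^ 6 * m\<^sup>2 * M ^ 6 * t\<^sup>2" by simp
  qed simp
  finally show ?thesis by (simp add: m_def t_def mult_ac)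
qed

section \<open>Additive control from multiplicative structure\<close>


text \<open>The condition of a Szemeredi-Trotter set: for every finite \<open>P\<close>, the number
  of \<open>x\<close> with at least \<open>k\<close> representations \<open>x = a - u\<close> with
  \<open>a\<close> in \<open>A\<close> and \<open>u\<close> in \<open>P\<close> decays like the
  inverse cube of \<open>k\<close>. A small \<open>D\<close> means little additive
  structure.\<close>

definition controlled :: "real set \<Rightarrow> real \<Rightarrow> bool" where
  "controlled A D \<longleftrightarrow> (\<forall>P X k. finite P \<and> finite X \<and> 1 \<le> k \<and> (\<forall>x\<in>X. k \<le> real (card {u\<in>P. x + u \<in> A})) \<longrightarrow>
     real (card X) * k ^ 3 \<le> D * (real (card P))\<^sup>2)"

lemma controlledD:
  assumes "controlled A D" "finite P" "finite X" "1 \<le> k" "\<And>x. x \<in> X \<Longrightarrow> k \<le> real (card {u\<in>P. x + u \<in> A})"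
  shows "real (card X) * k ^ 3 \<le> D * (real (card P))\<^sup>2"
  using assms unfolding controlled_def by blast

lemma sum_add_fibre_le:
  fixes A P X :: "real set"
  assumes A: "finite A" and P: "finite P" and X: "finite X"
  shows "(\<Sum>x\<in>X. real (card {u\<in>P. x + u \<in> A})) \<le> real (card A) * real (card P)"
proof -
  let ?g = "\<lambda>(x::real, u). (x + u, u)"
  have inj: "inj_on ?g (SIGMA x:X. {u\<in>P. x + u \<in> A})" by (auto simp: inj_on_def)
  have sub: "?g ` (SIGMA x:X. {u\<in>P. x + u \<in> A}) \<subseteq> A \<times> P" by auto
  have "(\<Sum>x\<in>X. real (card {u\<in>P. x + u \<in> A})) = real (card (SIGMA x:X. {u\<in>P. x + u \<in> A}))"
    using X P by (simp add: card_SigmaI)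
  also have "\<dots> \<le> real (card (A \<times> P))"
    using card_inj_on_le[OF inj sub] A P by (intro of_nat_mono) simp
  finally show ?thesis by (simp add: card_cartesian_product)
qed

text \<open>If \<open>x + u = a\<close> and \<open>c * a\<close> is in \<open>Q\<close>, then
  \<open>(u, c * a)\<close> lies on the line of slope \<open>c\<close> and intercept
  \<open>c * x\<close>. An \<open>x\<close> with many representations thus makes its
  \<open>card C\<close> lines rich in \<open>P \<times> Q\<close> on average, and the incidence
  bound limits the number of such lines.\<close>

lemma controlled_of_products:
  fixes A C Q :: "real set"
  assumes A: "finite A" and Apos: "\<And>a. a \<in> A \<Longrightarrow> 0 < a" and C: "finite C" and Cpos: "\<And>c. c \<in> C \<Longrightarrow> 0 < c"
    and Q: "finite Q" and AQ: "card A \<le> card Q"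
    and rep: "\<And>a. a \<in> A \<Longrightarrow> t \<le> real (card {c\<in>C. c * a \<in> Q})" and t: "0 < t"
  shows "controlled A (1024 * (real (card Q))\<^sup>2 * (real (card C))\<^sup>2 / t ^ 3)"
  unfolding controlled_def
proof (intro allI impI, elim conjE)
  fix P X :: "real set" and k :: real
  assume P: "finite P" and X: "finite X" and k: "1 \<le> k" and fib: "\<forall>x\<in>X. k \<le> real (card {u\<in>P. x + u \<in> A})"
  define q c p x where "q = real (card Q)" and "c = real (card C)" and "p = real (card P)" and "x = real (card X)"
  have "x * k ^ 3 * t ^ 3 \<le> 1024 * q\<^sup>2 * c\<^sup>2 * p\<^sup>2"
  proof (cases "X = {}")
    case True
    then show ?thesis by (simp add: x_def)
  next
    case False
    then obtain x0 where "x0 \<in> X" by blast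
    then have "0 < card {u\<in>P. x0 + u \<in> A}" using fib k by fastforce
    then have "{u\<in>P. x0 + u \<in> A} \<noteq> {}" by (metis card.empty less_irrefl)
    then obtain a0 where a0: "a0 \<in> A" and Pne: "P \<noteq> {}" by blast
    have "0 < card {c\<in>C. c * a0 \<in> Q}" using rep[OF a0] t by linarith
    then have "{c\<in>C. c * a0 \<in> Q} \<noteq> {}" by (metis card.empty less_irrefl)
    then have c1: "1 \<le> c" unfolding c_def using C by (auto simp: Suc_le_eq card_gt_0_iff)
    have tq: "t \<le> q"
    proof -
      have "inj_on (\<lambda>c. c * a0) {c\<in>C. c * a0 \<in> Q}" using Apos[OF a0] by (auto simp: inj_on_def)
      then have "card {c\<in>C. c * a0 \<in> Q} \<le> card Q" using Q by (intro card_inj_on_le) auto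
      then show ?thesis using rep[OF a0] by (simp add: q_def)
    qed
    have p1: "1 \<le> p" unfolding p_def using P Pne by (simp add: Suc_le_eq card_gt_0_iff)
    \<comment> \<open>Half of a lower bound for the average number of points on these lines, so that
      the lines below \<open>h\<close> carry at most half of the incidences. For
      \<open>h < 2\<close> the first moment suffices.\<close>
    define h where "h = k * t / (2 * c)"
    define R where "R = (\<lambda>c x. real (card {u\<in>P. c * u + c * x \<in> Q}))"
    have Rnn: "0 \<le> R c x" for c x by (simp add: R_def)
    show ?thesis
    proof (cases "h < 2")
      case True
      then have kt: "k * t \<le> 4 * c" using c1 by (simp add: h_def field_simps)
      have "x * k = (\<Sum>y\<in>X. k)" by (simp add: x_def)
      also have "\<dots> \<le> (\<Sum>y\<in>X. real (card {u\<in>P. y + u \<in> A}))" using fib by (intro sum_mono) auto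
      also have "\<dots> \<le> real (card A) * p" unfolding p_def by (rule sum_add_fibre_le[OF A P X])
      also have "\<dots> \<le> q * p" using AQ p1 by (intro mult_right_mono) (auto simp: q_def)
      finally have xk: "x * k \<le> q * p" .
      have "x * k ^ 3 * t ^ 3 = (x * k) * ((k * t)\<^sup>2 * t)" by (simp add: eval_nat_numeral)
      also have "\<dots> \<le> (q * p) * ((4 * c)\<^sup>2 * q)"
        by (intro mult_mono xk power_mono kt tq) (use t k tq p1 in \<open>auto simp: q_def\<close>)
      also have "\<dots> = 16 * q\<^sup>2 * c\<^sup>2 * p" by (simp add: power2_eq_square)
      also have "\<dots> \<le> 1024 * q\<^sup>2 * c\<^sup>2 * p\<^sup>2"
      proof -
        have "p \<le> p\<^sup>2" using p1 by (simp add: power2_eq_square)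
        then have "16 * p \<le> 1024 * p\<^sup>2" using p1 by linarith
        then have "(q\<^sup>2 * c\<^sup>2) * (16 * p) \<le> (q\<^sup>2 * c\<^sup>2) * (1024 * p\<^sup>2)" by (intro mult_left_mono) auto
        then show ?thesis by (simp add: mult_ac)
      qed
      finally show ?thesis .
    next
      case False
      then have h2: "2 \<le> h" by simp
      have tot: "x * (k * t) \<le> (\<Sum>(c, y)\<in>C \<times> X. R c y)"
      proof -
        define D where "D = (SIGMA y:X. SIGMA u:{u\<in>P. y + u \<in> A}. {c\<in>C. c * (y + u) \<in> Q})"
        define D' where "D' = (SIGMA z:C \<times> X. {u\<in>P. fst z * u + fst z * snd z \<in> Q})"
        have finD': "finite D'" unfolding D'_def using C X P by auto
        have "x * (k * t) = (\<Sum>y\<in>X. k * t)" by (simp add: x_def)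
        also have "\<dots> \<le> (\<Sum>y\<in>X. \<Sum>u\<in>{u\<in>P. y + u \<in> A}. real (card {c\<in>C. c * (y + u) \<in> Q}))"
        proof (rule sum_mono)
          fix y assume y: "y \<in> X"
          have "k * t \<le> (\<Sum>u\<in>{u\<in>P. y + u \<in> A}. t)" using fib y t by (simp add: mult_right_mono)
          also have "\<dots> \<le> (\<Sum>u\<in>{u\<in>P. y + u \<in> A}. real (card {c\<in>C. c * (y + u) \<in> Q}))"
            using rep by (intro sum_mono) auto
          finally show "k * t \<le> (\<Sum>u\<in>{u\<in>P. y + u \<in> A}. real (card {c\<in>C. c * (y + u) \<in> Q}))" .
        qed
        also have "\<dots> = real (card D)" unfolding D_def using X P C by (simp add: card_SigmaI)
        also have "\<dots> \<le> real (card D')"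
        proof -
          let ?g = "\<lambda>(y::real, u::real, c::real). ((c, y), u)"
          have "inj_on ?g D" by (rule inj_onI) (auto split: prod.splits)
          moreover have "?g ` D \<subseteq> D'"
          proof
            fix z assume "z \<in> ?g ` D"
            then obtain v where v: "v \<in> D" "z = ?g v" by blast
            obtain y u c where v': "v = (y, u, c)" by (metis prod.collapse)
            have e: "c * u + c * y = c * (y + u)" by (simp add: algebra_simps)
            have hh: "y \<in> X" "u \<in> P" "c \<in> C" "c * (y + u) \<in> Q" using v v' by (auto simp: D_def)
            have "c * u + c * y \<in> Q" unfolding e by (rule hh(4))
            then show "z \<in> D'" using v v' hh by (simp add: D'_def)
          qed
          ultimately have "card D \<le> card D'" using card_inj_on_le finD' by blast
          then show ?thesis by simp
        qed
        also have "\<dots> = (\<Sum>(c, y)\<in>C \<times> X. R c y)"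
          unfolding D'_def using X P C by (simp add: card_SigmaI R_def case_prod_unfold)
        finally show ?thesis .
      qed
      define H where "H = {z \<in> C \<times> X. h \<le> R (fst z) (snd z)}"
      have finH: "finite H" using C X by (simp add: H_def)
      have "(\<Sum>(c, y)\<in>C \<times> X. R c y) \<le> (\<Sum>z\<in>C \<times> X. (if h \<le> R (fst z) (snd z) then R (fst z) (snd z) else 0) + h)"
        unfolding case_prod_unfold using h2 by (intro sum_mono) auto
      also have "\<dots> = (\<Sum>z\<in>H. R (fst z) (snd z)) + c * x * h"
        using C X unfolding H_def by (simp add: sum.distrib sum.inter_filter c_def x_def card_cartesian_product)
      also have "c * x * h = x * (k * t) / 2" using c1 by (simp add: h_def)
      finally have half: "x * (k * t) / 2 \<le> (\<Sum>z\<in>H. R (fst z) (snd z))" using tot by linarith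
      define L where "L = (\<lambda>(c, y). (c, c * y)) ` H"
      have injL: "inj_on (\<lambda>(c, y). (c, c * y)) H"
        using Cpos by (force simp: inj_on_def H_def)
      have "h * (\<Sum>(m, b)\<in>L. (real (card {u\<in>P. m * u + b \<in> Q}))\<^sup>2) \<le> 128 * (real (card P))\<^sup>2 * (real (card Q))\<^sup>2"
        by (rule szemeredi_trotter_grid[OF P Q])
          (use finH Cpos h2 in \<open>auto simp: L_def H_def R_def\<close>)
      also have "(\<Sum>(m, b)\<in>L. (real (card {u\<in>P. m * u + b \<in> Q}))\<^sup>2) = (\<Sum>z\<in>H. (R (fst z) (snd z))\<^sup>2)"
        unfolding L_def by (subst sum.reindex[OF injL]) (simp add: R_def case_prod_unfold)
      finally have ST: "h * (\<Sum>z\<in>H. (R (fst z) (snd z))\<^sup>2) \<le> 128 * p\<^sup>2 * q\<^sup>2" by (simp add: p_def q_def)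
      have "h\<^sup>2 * (x * (k * t) / 2) \<le> h\<^sup>2 * (\<Sum>z\<in>H. R (fst z) (snd z))"
        using half by (intro mult_left_mono) auto
      also have "\<dots> = h * (\<Sum>z\<in>H. h * R (fst z) (snd z))"
        by (simp add: power2_eq_square sum_distrib_left mult_ac)
      also have "\<dots> \<le> h * (\<Sum>z\<in>H. (R (fst z) (snd z))\<^sup>2)"
        unfolding power2_eq_square using h2 Rnn by (intro mult_left_mono sum_mono mult_right_mono) (auto simp: H_def)
      finally have "h\<^sup>2 * (x * (k * t) / 2) * (8 * c\<^sup>2) \<le> (128 * p\<^sup>2 * q\<^sup>2) * (8 * c\<^sup>2)"
        using ST by (intro mult_right_mono) auto
      moreover have "h\<^sup>2 * (x * (k * t) / 2) * (8 * c\<^sup>2) = x * k ^ 3 * t ^ 3"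
        using c1 by (simp add: h_def power_divide power_mult_distrib) (simp add: eval_nat_numeral)
      ultimately have "x * k ^ 3 * t ^ 3 \<le> (128 * p\<^sup>2 * q\<^sup>2) * (8 * c\<^sup>2)" by linarith
      then show ?thesis by (simp add: mult_ac)
    qed
  qed
  then have "x * k ^ 3 \<le> 1024 * q\<^sup>2 * c\<^sup>2 / t ^ 3 * p\<^sup>2"
    using t by (simp add: field_simps)
  then show "real (card X) * k ^ 3 \<le> 1024 * (real (card Q))\<^sup>2 * (real (card C))\<^sup>2 / t ^ 3 * (real (card P))\<^sup>2"
    by (simp add: x_def q_def c_def p_def)
qed

lemma controlled_ge_1:
  assumes "controlled A D" "A \<noteq> {}"
  shows "1 \<le> D"
proof -
  obtain a where "a \<in> A" using assms(2) by blast
  then have "{u \<in> {a}. 0 + u \<in> A} = {a}" by auto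
  then have "real (card {0::real}) * 1 ^ 3 \<le> D * (real (card {a}))\<^sup>2"
    using controlledD[OF assms(1), of "{a}" "{0}" 1] by simp
  then show ?thesis by simp
qed

text \<open>For the number of \<open>x\<close> with at least \<open>k\<close> representations there
  is the trivial bound with weight \<open>k\<close> and the controlled one with weight
  \<open>k ^ 3\<close>; their geometric mean is a bound with weight \<open>k\<^sup>2\<close>. The
  claim is squared to avoid the root.\<close>

lemma controlled_second_moment:
  assumes ctl: "controlled A D" and A: "finite A" and P: "finite P" and X: "finite X" and J: "card A < 2 ^ J"
  shows "(\<Sum>x\<in>X. (real (card {u\<in>P. x + u \<in> A}))\<^sup>2)\<^sup>2 \<le> 16 * (real J)\<^sup>2 * (real (card A) * D * (real (card P)) ^ 3)"
proof -
  define K where "K = real (card A) * D * (real (card P)) ^ 3"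
  have K: "0 \<le> K" using controlled_ge_1[OF ctl] by (cases "A = {}") (auto simp: K_def)
  have cfA: "card {u\<in>P. x + u \<in> A} \<le> card A" for x
  proof -
    have "(+) x ` {u\<in>P. x + u \<in> A} \<subseteq> A" by auto
    then have "card ((+) x ` {u\<in>P. x + u \<in> A}) \<le> card A" using A by (intro card_mono) auto
    then show ?thesis by (simp add: card_image)
  qed
  have "(\<Sum>x\<in>X. (real (card {u\<in>P. x + u \<in> A}))\<^sup>2) \<le> 2\<^sup>2 * real J * sqrt K"
  proof (rule dyadic_sum_power_le[OF X])
    show "card {u\<in>P. x + u \<in> A} < 2 ^ J" for x using cfA[of x] J by linarith
    show "real (card {x \<in> X. 2 ^ j \<le> card {u\<in>P. x + u \<in> A}}) * (2 ^ j)\<^sup>2 \<le> sqrt K" for j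
    proof (rule real_le_rsqrt)
      let ?X = "{x \<in> X. 2 ^ j \<le> card {u\<in>P. x + u \<in> A}}"
      have le: "2 ^ j \<le> real (card {u\<in>P. x + u \<in> A})" if "x \<in> ?X" for x
        using that by (metis (mono_tags) mem_Collect_eq of_nat_le_iff of_nat_numeral of_nat_power)
      have "real (card ?X) * 2 ^ j = (\<Sum>x\<in>?X. 2 ^ j)" by simp
      also have "\<dots> \<le> (\<Sum>x\<in>?X. real (card {u\<in>P. x + u \<in> A}))" by (intro sum_mono le)
      also have "\<dots> \<le> real (card A) * real (card P)" using X by (intro sum_add_fibre_le[OF A P]) auto
      finally have 1: "real (card ?X) * 2 ^ j \<le> real (card A) * real (card P)" .
      have 2: "real (card ?X) * (2 ^ j) ^ 3 \<le> D * (real (card P))\<^sup>2"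
        using X by (intro controlledD[OF ctl P]) (use le in auto)
      have "(real (card ?X) * (2 ^ j)\<^sup>2)\<^sup>2 = (real (card ?X) * 2 ^ j) * (real (card ?X) * (2 ^ j) ^ 3)"
        by (simp add: power2_eq_square power3_eq_cube)
      also have "\<dots> \<le> (real (card A) * real (card P)) * (D * (real (card P))\<^sup>2)"
        by (intro mult_mono 1 2) auto
      also have "\<dots> = K" by (simp add: K_def power2_eq_square power3_eq_cube)
      finally show "(real (card ?X) * (2 ^ j)\<^sup>2)\<^sup>2 \<le> K" .
    qed
  qed simp_all
  then have "(\<Sum>x\<in>X. (real (card {u\<in>P. x + u \<in> A}))\<^sup>2)\<^sup>2 \<le> (2\<^sup>2 * real J * sqrt K)\<^sup>2"
    by (intro power_mono) (auto intro: sum_nonneg)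
  also have "\<dots> = 16 * (real J)\<^sup>2 * K" using K by (simp add: power_mult_distrib)
  finally show ?thesis by (simp add: K_def)
qed

lemma controlled_third_moment:
  assumes ctl: "controlled A D" and A: "finite A" and P: "finite P" and X: "finite X" and J: "card A < 2 ^ J"
  shows "(\<Sum>x\<in>X. (real (card {u\<in>P. x + u \<in> A})) ^ 3) \<le> 8 * real J * (D * (real (card P))\<^sup>2)"
proof -
  have cfA: "card {u\<in>P. x + u \<in> A} \<le> card A" for x
  proof -
    have "(+) x ` {u\<in>P. x + u \<in> A} \<subseteq> A" by auto
    then have "card ((+) x ` {u\<in>P. x + u \<in> A}) \<le> card A" using A by (intro card_mono) auto
    then show ?thesis by (simp add: card_image)
  qed
  have "(\<Sum>x\<in>X. (real (card {u\<in>P. x + u \<in> A})) ^ 3) \<le> 2 ^ 3 * real J * (D * (real (card P))\<^sup>2)"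
  proof (rule dyadic_sum_power_le[OF X])
    show "card {u\<in>P. x + u \<in> A} < 2 ^ J" for x using cfA[of x] J by linarith
    show "real (card {x \<in> X. 2 ^ j \<le> card {u\<in>P. x + u \<in> A}}) * (2 ^ j) ^ 3 \<le> D * (real (card P))\<^sup>2" for j
    proof (rule controlledD[OF ctl P])
      fix x assume "x \<in> {x \<in> X. 2 ^ j \<le> card {u\<in>P. x + u \<in> A}}"
      then show "2 ^ j \<le> real (card {u\<in>P. x + u \<in> A})"
        by (metis (mono_tags) mem_Collect_eq of_nat_le_iff of_nat_numeral of_nat_power)
    qed (use X in auto)
  qed simp_all
  then show ?thesis by simp
qed

section \<open>Sumsets of controlled sets\<close>


text \<open>A collision \<open>a + b = a' + b'\<close> is read as \<open>a - a' = b' - b\<close>, so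
  that the additive energy is counted through differences.\<close>

lemma card_sums_energy:
  fixes A :: "real set"
  assumes A: "finite A"
  defines "\<Delta> \<equiv> (\<lambda>(a, b). a - b) ` (A \<times> A)"
  shows "(real (card A)) ^ 4 \<le> real (card (A + A)) * (\<Sum>x\<in>\<Delta>. (real (card {u\<in>A. x + u \<in> A}))\<^sup>2)"
proof -
  define f where "f = (\<lambda>(a::real, b::real). a + b)"
  define CC where "CC = {(x, y). x \<in> A \<times> A \<and> y \<in> A \<times> A \<and> f x = f y}"
  define D where "D = (SIGMA x:\<Delta>. {u\<in>A. x + u \<in> A} \<times> {u\<in>A. x + u \<in> A})"
  have fin: "finite \<Delta>" using A by (simp add: \<Delta>_def)
  have finD: "finite D" using A fin by (simp add: D_def)
  define g where "g = (\<lambda>((a::real, b::real), (a'::real, b'::real)). (a - a', a', b))"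
  have "inj_on g CC"
  proof (rule inj_onI)
    fix u v assume u: "u \<in> CC" and v: "v \<in> CC" and e: "g u = g v"
    obtain a b a' b' where u': "u = ((a, b), (a', b'))" by (metis prod.collapse)
    obtain c d c' d' where v': "v = ((c, d), (c', d'))" by (metis prod.collapse)
    have "a' = c'" "b = d" "a - a' = c - c'" using e u' v' by (auto simp: g_def)
    moreover have "a + b = a' + b'" "c + d = c' + d'" using u v u' v' by (auto simp: CC_def f_def)
    ultimately show "u = v" using u' v' by simp
  qed
  moreover have "g ` CC \<subseteq> D"
  proof
    fix z assume "z \<in> g ` CC"
    then obtain u where u: "u \<in> CC" "z = g u" by blast
    obtain a b a' b' where u': "u = ((a, b), (a', b'))" by (metis prod.collapse)
    have h: "a \<in> A" "b \<in> A" "a' \<in> A" "b' \<in> A" "a + b = a' + b'" using u u' by (auto simp: CC_def f_def)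
    have "a - a' \<in> \<Delta>" using h by (auto simp: \<Delta>_def)
    moreover have "a - a' + b = b'" "a - a' + a' = a" using h(5) by linarith+
    then have "a - a' + b \<in> A" "a - a' + a' \<in> A" using h by (simp_all only:)
    ultimately show "z \<in> D" using u u' h by (simp add: g_def D_def)
  qed
  ultimately have CD: "card CC \<le> card D" using card_inj_on_le finD by blast
  have "(real (card (A \<times> A)))\<^sup>2 \<le> real (card (f ` (A \<times> A))) * real (card CC)"
    unfolding CC_def by (rule card_sq_le_image_collisions) (use A in auto)
  also have "f ` (A \<times> A) = A + A" by (auto simp: f_def set_plus_def)
  also have "real (card (A + A)) * real (card CC) \<le> real (card (A + A)) * real (card D)"
    using CD by (intro mult_left_mono) auto
  also have "real (card D) = (\<Sum>x\<in>\<Delta>. (real (card {u\<in>A. x + u \<in> A}))\<^sup>2)"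
    unfolding D_def using fin A by (simp add: card_SigmaI card_cartesian_product power2_eq_square)
  finally show ?thesis by (simp add: card_cartesian_product power2_eq_square power4_eq_xxxx)
qed

text \<open>Triples \<open>(x, u, b)\<close> with \<open>u, x + u, b\<close> in the set are counted through \<open>(x, x + u + b)\<close>; two triples with
  the same image are translates of each other, which accounts for the third moment.\<close>
lemma card_sq_le_third_moment:
  fixes A X U :: "real set" and G :: "real \<Rightarrow> real set"
  assumes A: "finite A" and X: "finite X" and G: "\<And>a. G a \<subseteq> A"
    and U: "U \<subseteq> A" and im: "\<And>x u b. x \<in> X \<Longrightarrow> u \<in> U \<Longrightarrow> x + u \<in> U \<Longrightarrow> b \<in> G (x + u) \<Longrightarrow> (x, x + u + b) \<in> W"
    and W: "finite W"
  defines "\<Delta> \<equiv> (\<lambda>(a, b). a - b) ` (A \<times> A)"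
  shows "(real (\<Sum>x\<in>X. \<Sum>u\<in>{u\<in>U. x + u \<in> U}. card (G (x + u))))\<^sup>2 \<le>
    real (card W) * (\<Sum>w\<in>\<Delta>. (real (card {u\<in>A. w + u \<in> A})) ^ 3)"
proof -
  define T where "T = (SIGMA x:X. SIGMA u:{u\<in>U. x + u \<in> U}. G (x + u))"
  have finG: "finite (G a)" for a using G A finite_subset by blast
  have finU: "finite U" using U A finite_subset by blast
  have fT: "finite T" unfolding T_def using X finU finG by (auto intro!: finite_SigmaI)
  have cT: "card T = (\<Sum>x\<in>X. \<Sum>u\<in>{u\<in>U. x + u \<in> U}. card (G (x + u)))"
    unfolding T_def using X finU finG by (simp add: card_SigmaI)
  define f where "f = (\<lambda>(x::real, u::real, b::real). (x, x + u + b))"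
  have imT: "f ` T \<subseteq> W" using im by (auto simp: f_def T_def)
  define CC where "CC = {(p, q). p \<in> T \<and> q \<in> T \<and> f p = f q}"
  define F where "F = (\<lambda>w. {u\<in>A. w + u \<in> A})"
  define D where "D = (SIGMA w:\<Delta>. F w \<times> F w \<times> F w)"
  have fin: "finite \<Delta>" using A by (simp add: \<Delta>_def)
  have finD: "finite D" using A fin by (simp add: D_def F_def)
  \<comment> \<open>The translation by \<open>u' - u\<close> takes \<open>u\<close> to
    \<open>u'\<close>, \<open>x + u\<close> to \<open>x' + u'\<close> and \<open>b'\<close> to
    \<open>b\<close>, so a collision yields three elements of \<open>A\<close> whose translates by
    the same number lie in \<open>A\<close> again.\<close>
  define g where "g = (\<lambda>((x::real, u::real, b::real), (x'::real, u'::real, b'::real)). (u' - u, u, x + u, b'))"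
  have "inj_on g CC"
  proof (rule inj_onI)
    fix y z assume y: "y \<in> CC" and z: "z \<in> CC" and e: "g y = g z"
    obtain x u b x' u' b' where y': "y = ((x, u, b), (x', u', b'))" by (metis prod.collapse)
    obtain p q r p' q' r' where z': "z = ((p, q, r), (p', q', r'))" by (metis prod.collapse)
    have "u = q" "x + u = p + q" "b' = r'" "u' - u = q' - q" using e y' z' by (auto simp: g_def)
    moreover have "x = x'" "x + u + b = x' + u' + b'" "p = p'" "p + q + r = p' + q' + r'"
      using y z y' z' by (auto simp: CC_def f_def)
    ultimately show "y = z" using y' z' by simp
  qed
  moreover have "g ` CC \<subseteq> D"
  proof
    fix v assume "v \<in> g ` CC"
    then obtain y where y: "y \<in> CC" "v = g y" by blast
    obtain x u b x' u' b' where y': "y = ((x, u, b), (x', u', b'))" by (metis prod.collapse)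
    have T: "(x, u, b) \<in> T" "(x', u', b') \<in> T" and e: "x = x'" "x + u + b = x' + u' + b'"
      using y y' by (auto simp: CC_def f_def)
    have h: "u \<in> A" "x + u \<in> A" "b \<in> A" "u' \<in> A" "x' + u' \<in> A" "b' \<in> A"
      using T U G by (auto simp: T_def)
    have "u' - u \<in> \<Delta>" using h by (auto simp: \<Delta>_def)
    moreover have "u' - u + u = u'" "u' - u + (x + u) = x' + u'" "u' - u + b' = b" using e by linarith+
    then have "u' - u + u \<in> A" "u' - u + (x + u) \<in> A" "u' - u + b' \<in> A" using h by (simp_all only:)
    ultimately show "v \<in> D" using y y' h by (simp add: g_def D_def F_def)
  qed
  ultimately have CD: "card CC \<le> card D" using card_inj_on_le finD by blast
  have "(real (card T))\<^sup>2 \<le> real (card (f ` T)) * real (card CC)"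
    unfolding CC_def by (rule card_sq_le_image_collisions[OF fT])
  also have "\<dots> \<le> real (card W) * real (card D)"
    using CD card_mono[OF W imT] by (intro mult_mono) auto
  also have "real (card D) = (\<Sum>w\<in>\<Delta>. (real (card {u\<in>A. w + u \<in> A})) ^ 3)"
    unfolding D_def using fin A by (simp add: card_SigmaI card_cartesian_product power3_eq_cube F_def mult.assoc)
  finally show ?thesis by (simp add: cT)
qed

text \<open>A pair \<open>(x, s)\<close> in \<open>W\<close> has at least \<open>\<rho>\<close>
  representations \<open>s = b + (s - b)\<close> in \<open>A\<close>. With \<open>y = b - x\<close>,
  both \<open>y + x = b\<close> and \<open>- y + (s - x) = s - b\<close> lie in \<open>A\<close>.
  The right-hand side is a product of two representation functions, ready for
  Cauchy-Schwarz.\<close>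

lemma popular_differences_of_sums:
  fixes A X Ps :: "real set"
  assumes A: "finite A" and X: "finite X" and P: "finite P"
    and pop: "\<And>s. s \<in> Ps \<Longrightarrow> \<rho> \<le> real (card {b\<in>A. s - b \<in> A})" and Ps: "finite Ps"
  defines "W \<equiv> {(x, s). x \<in> X \<and> s \<in> Ps \<and> s - x \<in> P}"
    and "Y \<equiv> (\<lambda>(a, x). a - x) ` (A \<times> X)"
  shows "real (card W) * \<rho> \<le> (\<Sum>y\<in>Y. real (card {x\<in>X. y + x \<in> A}) * real (card {s\<in>P. - y + s \<in> A}))"
proof -
  have fW: "finite W" by (rule finite_subset[of _ "X \<times> Ps"]) (use X Ps in \<open>auto simp: W_def\<close>)
  define T where "T = (SIGMA z:W. {b\<in>A. snd z - b \<in> A})"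
  define D where "D = (SIGMA y:Y. {x\<in>X. y + x \<in> A} \<times> {s\<in>P. - y + s \<in> A})"
  have finY: "finite Y" using A X by (simp add: Y_def)
  have finD: "finite D" unfolding D_def using finY X P by auto
  define g where "g = (\<lambda>((x::real, s::real), b::real). (b - x, x, s - x))"
  have "inj_on g T" by (rule inj_onI) (auto simp: g_def split: prod.splits)
  moreover have "g ` T \<subseteq> D"
  proof
    fix v assume "v \<in> g ` T"
    then obtain z where z: "z \<in> T" "v = g z" by blast
    obtain x s b where z': "z = ((x, s), b)" by (metis prod.collapse)
    have h: "x \<in> X" "s - x \<in> P" "b \<in> A" "s - b \<in> A" using z z' by (auto simp: T_def W_def)
    have "b - x \<in> Y" using h by (auto simp: Y_def)
    moreover have "b - x + x = b" "- (b - x) + (s - x) = s - b" by linarith+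
    ultimately show "v \<in> D" using z z' h by (simp add: g_def D_def)
  qed
  ultimately have TD: "card T \<le> card D" using card_inj_on_le finD by blast
  have "real (card W) * \<rho> = (\<Sum>z\<in>W. \<rho>)" by simp
  also have "\<dots> \<le> (\<Sum>z\<in>W. real (card {b\<in>A. snd z - b \<in> A}))" using pop by (intro sum_mono) (auto simp: W_def)
  also have "\<dots> = real (card T)" unfolding T_def using fW A by (simp add: card_SigmaI)
  also have "\<dots> \<le> real (card D)" using TD by simp
  also have "\<dots> = (\<Sum>y\<in>Y. real (card {x\<in>X. y + x \<in> A}) * real (card {s\<in>P. - y + s \<in> A}))"
    unfolding D_def using finY X P by (simp add: card_SigmaI card_cartesian_product)
  finally show ?thesis .
qed

text \<open>Pairs of a popular difference \<open>x\<close> and a popular sum \<open>s\<close> such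
  that \<open>s - x\<close> is again a sum are counted twice: the third moment bounds their number
  from below, second moments bound it from above. If \<open>D\<close> is of order
  \<open>n = card A\<close>, the result says that \<open>n ^ 22\<close> is at most
  \<open>card (A + A) ^ 14\<close> up to powers of \<open>J\<close>.\<close>

theorem controlled_sumset:
  fixes A :: "real set"
  assumes ctl: "controlled A D" and A: "finite A" and ne: "A \<noteq> {}" and J: "card A < 2 ^ J"
  shows "(real (card A)) ^ 30 \<le> 2 ^ 68 * real J ^ 15 * (real (card (A + A))) ^ 14 * D ^ 8"
proof -
  define n where "n = real (card A)"
  define m where "m = real (card (A + A))"
  define P where "P = A + A"
  have finP: "finite P" using A by (simp add: P_def finite_set_plus)
  have n1: "1 \<le> n" using A ne by (simp add: n_def Suc_le_eq card_gt_0_iff)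
  have "A + A \<noteq> {}" using ne by (auto simp: set_plus_def)
  then have m1: "1 \<le> m" using finP by (simp add: m_def P_def Suc_le_eq card_gt_0_iff)
  have D1: "1 \<le> D" by (rule controlled_ge_1[OF ctl ne])
  have J0: "0 < J" using J ne A by (cases J) (auto simp: card_gt_0_iff)
  define R where "R = (\<lambda>s. real (card {b\<in>A. s - b \<in> A}))"
  \<comment> \<open>Sums with fewer than \<open>n\<^sup>2 / (8 * m)\<close> representations use at
    most \<open>n\<^sup>2 / 8\<close> of all pairs. Hence all but at most \<open>n / 4\<close>
    elements have at least \<open>n / 2\<close> popular sums; these form \<open>A1\<close>.\<close>
  define Ps where "Ps = {s\<in>P. n\<^sup>2 / (8 * m) \<le> R s}"
  define G where "G = (\<lambda>a. {b\<in>A. a + b \<in> Ps})"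
  define A1 where "A1 = {a\<in>A. n / 2 \<le> real (card (G a))}"
  have finPs: "finite Ps" using finP by (simp add: Ps_def)
  have A1: "A1 \<subseteq> A" "finite A1" using A by (auto simp: A1_def)
  have cA1: "3 * n / 4 \<le> real (card A1)"
  proof -
    define Bd where "Bd = (SIGMA a:A. {b\<in>A. a + b \<notin> Ps})"
    have "card Bd \<le> card (SIGMA s:P - Ps. {b\<in>A. s - b \<in> A})"
    proof (rule card_inj_on_le[where f="\<lambda>(a, b). (a + b, b)"])
      show "inj_on (\<lambda>(a, b). (a + b, b)) Bd" by (auto simp: inj_on_def)
      show "(\<lambda>(a, b). (a + b, b)) ` Bd \<subseteq> (SIGMA s:P - Ps. {b\<in>A. s - b \<in> A})"
        by (auto simp: Bd_def P_def intro: set_plus_intro)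
    qed (use finP A in auto)
    then have "real (card Bd) \<le> real (card (SIGMA s:P - Ps. {b\<in>A. s - b \<in> A}))" by simp
    also have "\<dots> = (\<Sum>s\<in>P - Ps. R s)"
      using finP A by (simp add: card_SigmaI R_def)
    also have "\<dots> \<le> (\<Sum>s\<in>P - Ps. n\<^sup>2 / (8 * m))" by (intro sum_mono) (auto simp: Ps_def)
    also have "\<dots> \<le> m * (n\<^sup>2 / (8 * m))"
    proof -
      have "card (P - Ps) \<le> card P" using finP by (intro card_mono) auto
      then have "real (card (P - Ps)) \<le> m" by (simp add: m_def P_def)
      then have "real (card (P - Ps)) * (n\<^sup>2 / (8 * m)) \<le> m * (n\<^sup>2 / (8 * m))"
        using m1 by (intro mult_right_mono) auto
      then show ?thesis by (simp only: sum_constant)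
    qed
    also have "\<dots> = n\<^sup>2 / 8" using m1 by simp
    finally have up: "real (card Bd) \<le> n\<^sup>2 / 8" .
    have lowa: "n / 2 \<le> real (card {b\<in>A. a + b \<notin> Ps})" if "a \<in> A - A1" for a
    proof -
      have "A = G a \<union> {b\<in>A. a + b \<notin> Ps}" "G a \<inter> {b\<in>A. a + b \<notin> Ps} = {}" by (auto simp: G_def)
      then have "card A = card (G a) + card {b\<in>A. a + b \<notin> Ps}"
        using A card_Un_disjoint[of "G a" "{b\<in>A. a + b \<notin> Ps}"] by (auto simp: G_def)
      moreover have "real (card (G a)) < n / 2" using that by (auto simp: A1_def)
      ultimately show ?thesis by (simp add: n_def)
    qed
    have "real (card (A - A1)) * (n / 2) = (\<Sum>a\<in>A - A1. n / 2)" by simp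
    also have "\<dots> \<le> (\<Sum>a\<in>A - A1. real (card {b\<in>A. a + b \<notin> Ps}))" by (intro sum_mono lowa)
    also have "\<dots> \<le> (\<Sum>a\<in>A. real (card {b\<in>A. a + b \<notin> Ps}))" using A by (intro sum_mono2) auto
    also have "\<dots> = real (card Bd)" unfolding Bd_def using A by (simp add: card_SigmaI)
    finally have "real (card (A - A1)) * (n / 2) \<le> n\<^sup>2 / 8" using up by linarith
    then have "real (card (A - A1)) * n \<le> (n / 4) * n" by (simp add: power2_eq_square algebra_simps)
    then have "real (card (A - A1)) \<le> n / 4" using n1 by (simp add: mult_le_cancel_right)
    moreover have "card (A - A1) = card A - card A1" "card A1 \<le> card A" using A1 A by (auto intro: card_Diff_subset card_mono)
    ultimately show ?thesis by (simp add: n_def of_nat_diff)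
  qed
  define r where "r = (\<lambda>x. card {u\<in>A1. x + u \<in> A1})"
  define \<Delta> where "\<Delta> = (\<lambda>(a, b). a - b) ` (A1 \<times> A1)"
  have fin\<Delta>: "finite \<Delta>" using A1 by (simp add: \<Delta>_def)
  have rJ: "r x < 2 ^ J" for x
  proof -
    have "r x \<le> card A" unfolding r_def using A A1 by (intro card_mono) auto
    then show ?thesis using J by linarith
  qed
  define E where "E = (\<Sum>x\<in>\<Delta>. (real (r x))\<^sup>2)"
  have E: "n ^ 4 / (4 * m) \<le> E"
  proof -
    have "A1 + A1 \<subseteq> A + A" using A1 by (intro set_plus_mono2) auto
    then have "card (A1 + A1) \<le> card (A + A)" using finP by (intro card_mono) (auto simp: P_def)
    then have c: "real (card (A1 + A1)) \<le> m" by (simp add: m_def)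
    have "n ^ 4 / 4 \<le> (3 * n / 4) ^ 4" by (simp add: power_mult_distrib power_divide)
    also have "\<dots> \<le> (real (card A1)) ^ 4" using cA1 n1 by (intro power_mono) auto
    also have "\<dots> \<le> real (card (A1 + A1)) * E"
      unfolding E_def r_def \<Delta>_def by (rule card_sums_energy[OF A1(2)])
    also have "\<dots> \<le> m * E" using c by (intro mult_right_mono) (auto simp: E_def sum_nonneg)
    finally show ?thesis using m1 by (simp add: field_simps)
  qed
  define \<Delta>1 where "\<Delta>1 = {x\<in>\<Delta>. 1 \<le> r x}"
  have E1: "E = (\<Sum>x\<in>\<Delta>1. (real (r x))\<^sup>2)"
    unfolding E_def \<Delta>1_def using fin\<Delta> by (intro sum.mono_neutral_right) auto
  obtain j where j: "j < J" "(\<Sum>x\<in>\<Delta>1. (real (r x))\<^sup>2) \<le>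
      real J * (\<Sum>x\<in>{x\<in>\<Delta>1. 2 ^ j \<le> r x \<and> r x < 2 ^ Suc j}. (real (r x))\<^sup>2)"
    by (rule dyadic_pigeonhole[of \<Delta>1 r J "\<lambda>x. (real (r x))\<^sup>2"]) (use fin\<Delta> rJ J0 in \<open>auto simp: \<Delta>1_def\<close>)
  \<comment> \<open>The dyadic level of differences that carries the energy of \<open>A1\<close>;
    each has \<open>t\<close> to \<open>2 * t\<close> representations.\<close>
  define X where "X = {x\<in>\<Delta>1. 2 ^ j \<le> r x \<and> r x < 2 ^ Suc j}"
  define t where "t = (2::real) ^ j"
  define \<xi> where "\<xi> = real (card X)"
  have t1: "1 \<le> t" by (simp add: t_def)
  have finX: "finite X" using fin\<Delta> unfolding X_def \<Delta>1_def by simp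
  have rt: "t \<le> real (r x)" "real (r x) \<le> 2 * t" if "x \<in> X" for x
  proof -
    have h: "2 ^ j \<le> r x" "r x \<le> 2 ^ Suc j" using that by (auto simp: X_def)
    have "real (2 ^ j) \<le> real (r x)" "real (r x) \<le> real (2 ^ Suc j)" using h by (simp_all only: of_nat_le_iff)
    then show "t \<le> real (r x)" "real (r x) \<le> 2 * t" by (simp_all add: t_def)
  qed
  have Xt2: "n ^ 4 \<le> 16 * real J * m * (\<xi> * t\<^sup>2)"
  proof -
    have "n ^ 4 / (4 * m) \<le> real J * (\<Sum>x\<in>X. (real (r x))\<^sup>2)" using E E1 j(2) by (simp add: X_def)
    also have "\<dots> \<le> real J * (\<Sum>x\<in>X. (2 * t)\<^sup>2)" using rt by (intro mult_left_mono sum_mono power_mono) auto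
    also have "\<dots> = real J * (4 * \<xi> * t\<^sup>2)" by (simp add: \<xi>_def power_mult_distrib)
    finally show ?thesis using m1 by (simp add: field_simps)
  qed
  have \<xi>0: "0 < \<xi>"
  proof -
    have "0 < n ^ 4" using n1 by simp
    then have "\<xi> \<noteq> 0" using Xt2 by auto
    then show ?thesis by (simp add: \<xi>_def)
  qed
  have Xt3: "\<xi> * t ^ 3 \<le> D * n\<^sup>2"
  proof -
    have "t \<le> real (card {u\<in>A1. x + u \<in> A})" if "x \<in> X" for x
    proof -
      have "r x \<le> card {u\<in>A1. x + u \<in> A}" unfolding r_def using A1 by (intro card_mono) auto
      then show ?thesis using rt(1)[OF that] by linarith
    qed
    then have "\<xi> * t ^ 3 \<le> D * (real (card A1))\<^sup>2"
      unfolding \<xi>_def by (intro controlledD[OF ctl A1(2) finX t1])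
    also have "\<dots> \<le> D * n\<^sup>2" unfolding n_def using D1 A A1 by (intro mult_left_mono power_mono of_nat_mono card_mono) auto
    finally show ?thesis .
  qed
  define W where "W = {(x, s). x \<in> X \<and> s \<in> Ps \<and> s - x \<in> P}"
  have finW: "finite W" by (rule finite_subset[of _ "X \<times> Ps"]) (use finX finPs in \<open>auto simp: W_def\<close>)
  define w where "w = real (card W)"
  \<comment> \<open>Each \<open>x\<close> in \<open>X\<close> has at least \<open>t\<close>
    representations by \<open>u\<close> and \<open>x + u\<close> in \<open>A1\<close>, and each of
    these has at least \<open>n / 2\<close> elements \<open>b\<close> with \<open>x + u + b\<close>
    popular. Subtracting \<open>x\<close> leaves the sum \<open>u + b\<close>, so the pair lies in
    \<open>W\<close>.\<close>
  have WE: "(\<xi> * t * n / 2)\<^sup>2 \<le> w * (8 * real J * (D * n\<^sup>2))"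
  proof -
    have "\<xi> * t * n / 2 = (\<Sum>x\<in>X. t * (n / 2))" by (simp add: \<xi>_def)
    also have "\<dots> \<le> (\<Sum>x\<in>X. \<Sum>u\<in>{u\<in>A1. x + u \<in> A1}. real (card (G (x + u))))"
    proof (rule sum_mono)
      fix x assume x: "x \<in> X"
      have "t * (n / 2) \<le> real (r x) * (n / 2)" using rt(1)[OF x] n1 by (intro mult_right_mono) auto
      also have "\<dots> = (\<Sum>u\<in>{u\<in>A1. x + u \<in> A1}. n / 2)" by (simp add: r_def)
      also have "\<dots> \<le> (\<Sum>u\<in>{u\<in>A1. x + u \<in> A1}. real (card (G (x + u))))"
        by (intro sum_mono) (auto simp: A1_def)
      finally show "t * (n / 2) \<le> (\<Sum>u\<in>{u\<in>A1. x + u \<in> A1}. real (card (G (x + u))))" .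
    qed
    also have "\<dots> = real (\<Sum>x\<in>X. \<Sum>u\<in>{u\<in>A1. x + u \<in> A1}. card (G (x + u)))" by simp
    finally have "(\<xi> * t * n / 2)\<^sup>2 \<le> (real (\<Sum>x\<in>X. \<Sum>u\<in>{u\<in>A1. x + u \<in> A1}. card (G (x + u))))\<^sup>2"
      using \<xi>0 t1 n1 by (intro power_mono) auto
    also have "\<dots> \<le> w * (\<Sum>v\<in>(\<lambda>(a, b). a - b) ` (A \<times> A). (real (card {u\<in>A. v + u \<in> A})) ^ 3)"
      unfolding w_def
    proof (rule card_sq_le_third_moment[OF A finX _ A1(1) _ finW])
      show "G a \<subseteq> A" for a by (auto simp: G_def)
      fix x u b assume h: "x \<in> X" "u \<in> A1" "x + u \<in> A1" "b \<in> G (x + u)"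
      have "x + u + b - x = u + b" by simp
      moreover have "u + b \<in> P" using h A1 by (auto simp: P_def G_def intro: set_plus_intro)
      ultimately show "(x, x + u + b) \<in> W" using h by (simp add: W_def G_def)
    qed
    also have "\<dots> \<le> w * (8 * real J * (D * n\<^sup>2))"
      unfolding n_def using A by (intro mult_left_mono controlled_third_moment[OF ctl A A _ J]) (auto simp: w_def)
    finally show ?thesis .
  qed
  define Y where "Y = (\<lambda>(a, x). a - x) ` (A \<times> X)"
  define S1 where "S1 = (\<Sum>y\<in>Y. (real (card {x\<in>X. y + x \<in> A}))\<^sup>2)"
  define S2 where "S2 = (\<Sum>y\<in>Y. (real (card {s\<in>P. - y + s \<in> A}))\<^sup>2)"
  have finY: "finite Y" using A finX by (simp add: Y_def)
  have S1: "S1\<^sup>2 \<le> 16 * (real J)\<^sup>2 * (n * D * \<xi> ^ 3)"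
    unfolding S1_def n_def \<xi>_def by (rule controlled_second_moment[OF ctl A finX finY J])
  have S2: "S2\<^sup>2 \<le> 16 * (real J)\<^sup>2 * (n * D * m ^ 3)"
  proof -
    have "S2 = (\<Sum>y\<in>uminus ` Y. (real (card {s\<in>P. y + s \<in> A}))\<^sup>2)"
      unfolding S2_def by (subst sum.reindex) auto
    then show ?thesis unfolding n_def m_def P_def[symmetric]
      using controlled_second_moment[OF ctl A finP _ J, of "uminus ` Y"] finY by simp
  qed
  \<comment> \<open>The upper bound for \<open>w\<close>: popularity supplies the factor
    \<open>n\<^sup>2 / (8 * m)\<close>, and the second moments over \<open>X\<close> and over
    \<open>P\<close> bound the rest.\<close>
  have "w * (n\<^sup>2 / (8 * m)) \<le> (\<Sum>y\<in>Y. real (card {x\<in>X. y + x \<in> A}) * real (card {s\<in>P. - y + s \<in> A}))"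
    unfolding w_def W_def Y_def
    by (rule popular_differences_of_sums[OF A finX finP _ finPs]) (auto simp: Ps_def R_def)
  then have "(w * (n\<^sup>2 / (8 * m)))\<^sup>2 \<le> (\<Sum>y\<in>Y. real (card {x\<in>X. y + x \<in> A}) * real (card {s\<in>P. - y + s \<in> A}))\<^sup>2"
    using m1 by (intro power_mono) (auto simp: w_def)
  also have "\<dots> \<le> S1 * S2" unfolding S1_def S2_def by (rule Cauchy_Schwarz_ineq_sum)
  finally have "((w * (n\<^sup>2 / (8 * m)))\<^sup>2)\<^sup>2 \<le> (S1 * S2)\<^sup>2" by (intro power_mono) auto
  also have "\<dots> = S1\<^sup>2 * S2\<^sup>2" by (simp add: power_mult_distrib)
  also have "\<dots> \<le> (16 * (real J)\<^sup>2 * (n * D * \<xi> ^ 3)) * (16 * (real J)\<^sup>2 * (n * D * m ^ 3))"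
    using \<xi>0 n1 D1 by (intro mult_mono S1 S2) auto
  finally have W4: "(w * (n\<^sup>2 / (8 * m))) ^ 4 \<le> 256 * real J ^ 4 * n\<^sup>2 * D\<^sup>2 * \<xi> ^ 3 * m ^ 3"
    by (simp add: eval_nat_numeral mult_ac)
  have w4: "w ^ 4 * n ^ 8 \<le> 2 ^ 20 * real J ^ 4 * n\<^sup>2 * D\<^sup>2 * \<xi> ^ 3 * m ^ 7"
  proof -
    have "w ^ 4 * n ^ 8 = (w * (n\<^sup>2 / (8 * m))) ^ 4 * (8 * m) ^ 4"
      using m1 by (simp add: power_mult_distrib power_divide)
    also have "\<dots> \<le> (256 * real J ^ 4 * n\<^sup>2 * D\<^sup>2 * \<xi> ^ 3 * m ^ 3) * (8 * m) ^ 4"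
      using m1 by (intro mult_right_mono W4) auto
    also have "\<dots> = 2 ^ 20 * real J ^ 4 * n\<^sup>2 * D\<^sup>2 * \<xi> ^ 3 * m ^ 7"
      by (simp add: power_mult_distrib)
    finally show ?thesis .
  qed
  \<comment> \<open>The fourth power of \<open>WE\<close> makes \<open>w4\<close> applicable and
    eliminates \<open>w\<close>.\<close>
  have "((\<xi> * t * n / 2)\<^sup>2) ^ 4 \<le> (w * (8 * real J * (D * n\<^sup>2))) ^ 4" using WE by (intro power_mono) auto
  then have "\<xi> ^ 8 * t ^ 8 * n ^ 8 \<le> 2 ^ 8 * (w * (8 * real J * (D * n\<^sup>2))) ^ 4"
    by (simp add: power_mult_distrib power_divide)
  also have "\<dots> = 2 ^ 20 * real J ^ 4 * D ^ 4 * (w ^ 4 * n ^ 8)" by (simp add: power_mult_distrib)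
  also have "\<dots> \<le> 2 ^ 20 * real J ^ 4 * D ^ 4 * (2 ^ 20 * real J ^ 4 * n\<^sup>2 * D\<^sup>2 * \<xi> ^ 3 * m ^ 7)"
    using D1 by (intro mult_left_mono w4) auto
  finally have "(\<xi> ^ 5 * t ^ 8 * n ^ 6) * (\<xi> ^ 3 * n\<^sup>2) \<le> (2 ^ 40 * real J ^ 8 * D ^ 6 * m ^ 7) * (\<xi> ^ 3 * n\<^sup>2)"
    by (simp add: eval_nat_numeral mult_ac)
  then have main: "\<xi> ^ 5 * t ^ 8 * n ^ 6 \<le> 2 ^ 40 * real J ^ 8 * D ^ 6 * m ^ 7"
    using \<xi>0 n1 by (simp add: mult_le_cancel_right)
  \<comment> \<open>The exponent 7 comes from \<open>\<xi> ^ 7 * t ^ 14 = (\<xi> ^ 5 * t ^ 8) *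
    (\<xi> * t ^ 3)\<^sup>2\<close>: \<open>main\<close> and the square of \<open>Xt3\<close>
    eliminate \<open>\<xi>\<close> and \<open>t\<close> together.\<close>
  have "(n ^ 4) ^ 7 * n ^ 6 \<le> (16 * real J * m * (\<xi> * t\<^sup>2)) ^ 7 * n ^ 6"
    using Xt2 n1 by (intro mult_right_mono power_mono) auto
  also have "\<dots> = 2 ^ 28 * real J ^ 7 * m ^ 7 * ((\<xi> ^ 5 * t ^ 8 * n ^ 6) * (\<xi> * t ^ 3)\<^sup>2)"
    by (simp add: eval_nat_numeral mult_ac)
  also have "\<dots> \<le> 2 ^ 28 * real J ^ 7 * m ^ 7 * ((2 ^ 40 * real J ^ 8 * D ^ 6 * m ^ 7) * (D * n\<^sup>2)\<^sup>2)"
    using m1 D1 n1 \<xi>0 t1 by (intro mult_left_mono mult_mono main power_mono Xt3) auto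
  also have "\<dots> = (2 ^ 68 * real J ^ 15 * m ^ 14 * D ^ 8) * n ^ 4"
    by (simp add: eval_nat_numeral mult_ac)
  also have "(n ^ 4) ^ 7 * n ^ 6 = n ^ 30 * n ^ 4" by (simp flip: power_mult power_add)
  finally have "n ^ 30 * n ^ 4 \<le> (2 ^ 68 * real J ^ 15 * m ^ 14 * D ^ 8) * n ^ 4" .
  moreover have "0 < n ^ 4" using n1 by simp
  ultimately have "n ^ 30 \<le> 2 ^ 68 * real J ^ 15 * m ^ 14 * D ^ 8" by (rule mult_right_le_imp_le)
  then show ?thesis unfolding n_def m_def .
qed

section \<open>Popular ratios\<close>


text \<open>\<open>V\<close> maximises the number of edges minus \<open>2 * d\<close> times the
  number of vertices. Edges are ordered pairs, so deleting a vertex loses at most twice its degree,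
  and maximality forces degree at least \<open>d\<close>. Comparison with \<open>A\<close> itself
  bounds the edges of \<open>V\<close>, hence its size, from below.\<close>

lemma dense_core:
  fixes R :: "'a \<Rightarrow> 'a \<Rightarrow> bool" and d :: real
  assumes A: "finite A" and sym: "\<And>a b. R a b \<Longrightarrow> R b a"
    and e: "4 * d * real (card A) \<le> real (card {(a, b). a \<in> A \<and> b \<in> A \<and> R a b})"
  obtains V where "V \<subseteq> A" "\<And>a. a \<in> V \<Longrightarrow> d \<le> real (card {b\<in>V. R a b})"
    "2 * d * real (card A) \<le> (real (card V))\<^sup>2"
proof -
  define E where "E = (\<lambda>V. {(a, b). a \<in> V \<and> b \<in> V \<and> R a b})"
  define \<phi> where "\<phi> = (\<lambda>V. real (card (E V)) - 2 * d * real (card V))"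
  have finE: "finite (E V)" if "V \<subseteq> A" for V
    by (rule finite_subset[of _ "A \<times> A"]) (use that A in \<open>auto simp: E_def\<close>)
  have fP: "finite (Pow A)" "Pow A \<noteq> {}" using A by auto
  obtain V where V: "V \<in> Pow A" "Max (\<phi> ` Pow A) = \<phi> V" by (rule obtains_MAX[OF fP])
  have Vmax: "\<phi> V' \<le> \<phi> V" if "V' \<subseteq> A" for V' using that fP V(2)[symmetric] by simp
  have VA: "V \<subseteq> A" and finV: "finite V" using V(1) A finite_subset by auto
  show ?thesis
  proof (rule that[OF VA])
    fix a assume a: "a \<in> V"
    have "E V \<subseteq> E (V - {a}) \<union> (Pair a ` {b\<in>V. R a b} \<union> (\<lambda>b. (b, a)) ` {b\<in>V. R a b})"
      using sym by (auto simp: E_def)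
    then have "card (E V) \<le> card (E (V - {a}) \<union> (Pair a ` {b\<in>V. R a b} \<union> (\<lambda>b. (b, a)) ` {b\<in>V. R a b}))"
      using finE[of "V - {a}"] VA finV by (intro card_mono) auto
    also have "\<dots> \<le> card (E (V - {a})) + (card {b\<in>V. R a b} + card {b\<in>V. R a b})"
      using finV by (intro order_trans[OF card_Un_le] add_left_mono order_trans[OF card_Un_le] add_mono card_image_le) auto
    finally have "real (card (E V)) \<le> real (card (E (V - {a}))) + 2 * real (card {b\<in>V. R a b})" by linarith
    moreover have "\<phi> (V - {a}) \<le> \<phi> V" using VA by (intro Vmax) auto
    moreover have "card V = Suc (card (V - {a}))" using card.remove[OF finV a] .
    then have "real (card V) = real (card (V - {a})) + 1" by simp
    then have "2 * d * real (card V) = 2 * d * real (card (V - {a})) + 2 * d" by (simp add: algebra_simps)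
    ultimately show "d \<le> real (card {b\<in>V. R a b})" unfolding \<phi>_def by linarith
  next
    show "2 * d * real (card A) \<le> (real (card V))\<^sup>2"
    proof (cases "0 \<le> d")
      case True
      have "\<phi> A \<le> \<phi> V" by (rule Vmax) simp
      then have "2 * d * real (card A) \<le> real (card (E V)) - 2 * d * real (card V)"
        using e by (simp add: \<phi>_def E_def)
      also have "\<dots> \<le> real (card (E V))" using True by simp
      also have "\<dots> \<le> real (card (V \<times> V))" using finV by (intro of_nat_mono card_mono) (auto simp: E_def)
      finally show ?thesis by (simp add: card_cartesian_product power2_eq_square)
    next
      case False
      then have "2 * d * real (card A) \<le> 0" by (simp add: mult_nonpos_nonneg)
      then show ?thesis using zero_le_power2[of "real (card V)"] by linarith
    qed
  qed
qed

text \<open>A greedy cover, obtained as a largest \<open>F\<close> that covers at least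
  \<open>card F * d / 2\<close> elements. If more than half of \<open>V\<close> stayed uncovered,
  double counting would give a \<open>b\<close> adjacent to at least \<open>d / 2\<close> uncovered
  elements, and \<open>F\<close> could be enlarged.\<close>

lemma half_cover:
  fixes R :: "'a \<Rightarrow> 'a \<Rightarrow> bool" and d :: real
  assumes V: "finite V" and d: "0 < d" and deg: "\<And>a. a \<in> V \<Longrightarrow> d \<le> real (card {b\<in>V. R a b})"
  obtains F where "F \<subseteq> V" "real (card F) * d \<le> 2 * real (card V)"
    "real (card V) \<le> 2 * real (card {a\<in>V. \<exists>b\<in>F. R a b})"
proof -
  define N where "N = (\<lambda>F. {a\<in>V. \<exists>b\<in>F. R a b})"
  define \<F> where "\<F> = {F. F \<subseteq> V \<and> real (card F) * (d / 2) \<le> real (card (N F))}"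
  have fin\<F>: "finite \<F>" by (rule finite_subset[of _ "Pow V"]) (use V in \<open>auto simp: \<F>_def\<close>)
  have "{} \<in> \<F>" by (simp add: \<F>_def)
  then have "\<F> \<noteq> {}" by blast
  obtain F where F: "F \<in> \<F>" "Max (card ` \<F>) = card F" by (rule obtains_MAX[OF fin\<F> \<open>\<F> \<noteq> {}\<close>])
  have Fmax: "card F' \<le> card F" if "F' \<in> \<F>" for F' using that fin\<F> F(2)[symmetric] by simp
  have FV: "F \<subseteq> V" and FN: "real (card F) * (d / 2) \<le> real (card (N F))" using F(1) by (auto simp: \<F>_def)
  have finF: "finite F" using FV V finite_subset by blast
  have finN: "finite (N G)" for G using V by (simp add: N_def)
  have NV: "card (N F) \<le> card V" unfolding N_def using V by (intro card_mono) auto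
  have "real (card V) \<le> 2 * real (card (N F))"
  proof (rule ccontr)
    assume "\<not> ?thesis"
    then have lt: "2 * real (card (N F)) < real (card V)" by simp
    define U where "U = V - N F"
    have finU: "finite U" using V by (simp add: U_def)
    have "card U = card V - card (N F)" unfolding U_def by (rule card_Diff_subset) (use finN in \<open>auto simp: N_def\<close>)
    then have U: "real (card V) / 2 \<le> real (card U)" using lt NV by (simp add: of_nat_diff)
    have "\<exists>b\<in>V. d / 2 \<le> real (card {a\<in>U. R a b})"
    proof (rule ccontr)
      assume "\<not> ?thesis"
      then have sm: "real (card {a\<in>U. R a b}) < d / 2" if "b \<in> V" for b using that by force
      have "V \<noteq> {}" using lt by auto
      have "d * (real (card V) / 2) \<le> d * real (card U)" using U d by (intro mult_left_mono) auto
      also have "\<dots> = (\<Sum>a\<in>U. d)" by simp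
      also have "\<dots> \<le> (\<Sum>a\<in>U. real (card {b\<in>V. R a b}))" by (intro sum_mono deg) (auto simp: U_def)
      also have "\<dots> = (\<Sum>a\<in>U. \<Sum>b\<in>V. if R a b then 1 else 0)"
        using V by (simp add: sum.If_cases Int_def)
      also have "\<dots> = (\<Sum>b\<in>V. \<Sum>a\<in>U. if R a b then 1 else 0)" by (rule sum.swap)
      also have "\<dots> = (\<Sum>b\<in>V. real (card {a\<in>U. R a b}))"
        using finU by (simp add: sum.If_cases Int_def)
      also have "\<dots> < (\<Sum>b\<in>V. d / 2)" using sm V \<open>V \<noteq> {}\<close> by (intro sum_strict_mono) auto
      finally show False by simp
    qed
    then obtain b where b: "b \<in> V" "d / 2 \<le> real (card {a\<in>U. R a b})" by blast
    have "0 < card {a\<in>U. R a b}" using b(2) d by linarith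
    then have "{a\<in>U. R a b} \<noteq> {}" by (metis card.empty less_irrefl)
    then have bF: "b \<notin> F" by (auto simp: U_def N_def)
    have "N (insert b F) = N F \<union> {a\<in>U. R a b}" by (auto simp: N_def U_def)
    moreover have "N F \<inter> {a\<in>U. R a b} = {}" by (auto simp: U_def)
    ultimately have "card (N (insert b F)) = card (N F) + card {a\<in>U. R a b}"
      using finN finU by (simp add: card_Un_disjoint)
    then have "real (card (insert b F)) * (d / 2) \<le> real (card (N (insert b F)))"
      using FN b(2) bF finF by (simp add: algebra_simps)
    then have "insert b F \<in> \<F>" using FV b(1) by (simp add: \<F>_def)
    then show False using Fmax[of "insert b F"] bF finF by simp
  qed
  moreover have "real (card F) * d \<le> 2 * real (card V)" using FN NV by linarith
  ultimately show ?thesis using that[OF FV] by (simp add: N_def)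
qed

section \<open>Ratios with many representations\<close>

lemma card_mult_fibre_inverse:
  assumes "0 < l"
  shows "card (mult_fibre A (1 / l)) = card (mult_fibre A l)"
proof -
  have "mult_fibre A (1 / l) = (\<lambda>a. l * a) ` mult_fibre A l"
  proof
    show "mult_fibre A (1 / l) \<subseteq> (\<lambda>a. l * a) ` mult_fibre A l"
    proof
      fix a assume "a \<in> mult_fibre A (1 / l)"
      then have "a = l * (1 / l * a)" "1 / l * a \<in> mult_fibre A l" using assms by (auto simp: mult_fibre_def)
      then show "a \<in> (\<lambda>a. l * a) ` mult_fibre A l" by blast
    qed
    show "(\<lambda>a. l * a) ` mult_fibre A l \<subseteq> mult_fibre A (1 / l)" using assms by (auto simp: mult_fibre_def)
  qed
  moreover have "inj_on (\<lambda>a. l * a) (mult_fibre A l)" using assms by (auto simp: inj_on_def)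
  ultimately show ?thesis by (simp add: card_image)
qed

lemma card_le_card_times_self:
  fixes A :: "real set"
  assumes A: "finite A" and pos: "\<And>a. a \<in> A \<Longrightarrow> 0 < a"
  shows "card A \<le> card (A * A)"
proof (cases "A = {}")
  case False
  then obtain a where a: "a \<in> A" by blast
  then have "(*) a ` A \<subseteq> A * A" by (auto intro: set_times_intro)
  then have "card ((*) a ` A) \<le> card (A * A)" using A by (intro card_mono) (auto simp: finite_set_times)
  moreover have "inj_on ((*) a) A" using pos[OF a] by (auto simp: inj_on_def)
  ultimately show ?thesis by (simp add: card_image)
qed simp

text \<open>With \<open>n = card A\<close>, the multiplicative energy is at least
  \<open>n ^ 4 / m\<close> by Cauchy-Schwarz. Ratios with fewer than
  \<open>n\<^sup>2 / (2 * m)\<close> representations contribute at most half of it. A dyadic level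
  meeting the other ratios carries the rest up to the factor \<open>J\<close>, and the threshold
  gives the lower bound for \<open>2 ^ j\<close>.\<close>

lemma popular_ratio_level:
  fixes A :: "real set"
  assumes A: "finite A" and pos: "\<And>a. a \<in> A \<Longrightarrow> 0 < a" and ne: "A \<noteq> {}"
    and m: "real (card (A * A)) \<le> m" and J: "card A < 2 ^ J"
  defines "\<Lambda> \<equiv> (\<lambda>(a, b). a / b) ` (A \<times> A)"
  obtains j where
    "(real (card A)) ^ 4 \<le> 8 * m * real J *
      (real (card {l\<in>\<Lambda>. 2 ^ j \<le> card (mult_fibre A l) \<and> card (mult_fibre A l) < 2 ^ Suc j}) * (2 ^ j)\<^sup>2)"
    "(real (card A))\<^sup>2 \<le> 4 * m * 2 ^ j"
proof -
  define n where "n = real (card A)"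
  have n1: "1 \<le> n" using A ne by (simp add: n_def Suc_le_eq card_gt_0_iff)
  have "n \<le> m" using card_le_card_times_self[OF A pos] m unfolding n_def by linarith
  then have m1: "1 \<le> m" using n1 by linarith
  have J0: "0 < J" using J ne A by (cases J) (auto simp: card_gt_0_iff)
  define r where "r = (\<lambda>l. card (mult_fibre A l))"
  have fin\<Lambda>: "finite \<Lambda>" using A by (simp add: \<Lambda>_def)
  \<comment> \<open>\<open>\<Lambda>\<close> contains every ratio with a nonempty fibre, so it can
    replace the set supplied by \<open>card_product_ge\<close>.\<close>
  have out: "r l = 0" if "l \<notin> \<Lambda>" for l
  proof -
    have False if a: "a \<in> mult_fibre A l" for a
    proof -
      have "l = (l * a) / a" "a \<in> A" "l * a \<in> A" using a pos by (force simp: mult_fibre_def)+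
      then have "l \<in> \<Lambda>" unfolding \<Lambda>_def by force
      then show False using \<open>l \<notin> \<Lambda>\<close> by blast
    qed
    then have "mult_fibre A l = {}" by blast
    then show ?thesis by (simp add: r_def)
  qed
  obtain L where L: "finite L" "(real (card A) * real (card A)) ^ 4 \<le> (real (card (A * A)))\<^sup>2 *
      ((\<Sum>l\<in>L. (real (card (mult_fibre A l)))\<^sup>2) * (\<Sum>l\<in>L. (real (card (mult_fibre A l)))\<^sup>2))"
    using card_product_ge[OF A pos A pos] by blast
  define E where "E = (\<Sum>l\<in>\<Lambda>. (real (r l))\<^sup>2)"
  have "(\<Sum>l\<in>L. (real (r l))\<^sup>2) = (\<Sum>l\<in>L \<inter> \<Lambda>. (real (r l))\<^sup>2)"
    using L(1) out by (intro sum.mono_neutral_right) auto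
  also have "\<dots> \<le> E" unfolding E_def using fin\<Lambda> by (intro sum_mono2) auto
  finally have LE: "(\<Sum>l\<in>L. (real (r l))\<^sup>2) \<le> E" .
  have "(n ^ 4)\<^sup>2 = (real (card A) * real (card A)) ^ 4" by (simp add: n_def power2_eq_square power4_eq_xxxx)
  also have "\<dots> \<le> m\<^sup>2 * (E * E)"
    using L(2) LE m unfolding r_def
    by (elim order_trans, intro mult_mono power_mono) (auto intro!: sum_nonneg simp: E_def r_def)
  also have "\<dots> = (m * E)\<^sup>2" by (simp add: power2_eq_square)
  finally have nE: "n ^ 4 \<le> m * E"
    by (rule power2_le_imp_le) (use m1 in \<open>auto simp: E_def sum_nonneg\<close>)
  define \<theta> where "\<theta> = n\<^sup>2 / (2 * m)"
  define \<Lambda>1 where "\<Lambda>1 = {l\<in>\<Lambda>. \<theta> \<le> real (r l)}"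
  have fin1: "finite \<Lambda>1" using fin\<Lambda> by (simp add: \<Lambda>1_def)
  have "E \<le> (\<Sum>l\<in>\<Lambda>. (if \<theta> \<le> real (r l) then (real (r l))\<^sup>2 else 0) + \<theta> * real (r l))"
    unfolding E_def
  proof (rule sum_mono)
    fix l
    have \<theta>0: "0 \<le> \<theta>" using m1 by (simp add: \<theta>_def)
    show "(real (r l))\<^sup>2 \<le> (if \<theta> \<le> real (r l) then (real (r l))\<^sup>2 else 0) + \<theta> * real (r l)"
      using \<theta>0 by (auto simp: power2_eq_square intro: mult_right_mono)
  qed
  also have "\<dots> = (\<Sum>l\<in>\<Lambda>1. (real (r l))\<^sup>2) + \<theta> * (\<Sum>l\<in>\<Lambda>. real (r l))"
    using fin\<Lambda> by (simp add: sum.distrib sum_distrib_left \<Lambda>1_def sum.inter_filter)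
  also have "\<theta> * (\<Sum>l\<in>\<Lambda>. real (r l)) \<le> \<theta> * n\<^sup>2"
    unfolding r_def n_def using sum_mult_fibre_le[OF A pos fin\<Lambda>] m1 by (intro mult_left_mono) (auto simp: \<theta>_def)
  finally have "m * E \<le> m * ((\<Sum>l\<in>\<Lambda>1. (real (r l))\<^sup>2) + \<theta> * n\<^sup>2)" using m1 by (intro mult_left_mono) auto
  also have "\<dots> = m * (\<Sum>l\<in>\<Lambda>1. (real (r l))\<^sup>2) + n ^ 4 / 2"
    using m1 by (simp add: \<theta>_def algebra_simps power2_eq_square power4_eq_xxxx)
  finally have E1: "n ^ 4 \<le> 2 * m * (\<Sum>l\<in>\<Lambda>1. (real (r l))\<^sup>2)" using nE by linarith
  have rJ: "r l < 2 ^ J" for l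
    using card_mono[OF A mult_fibre_subset[of A l]] J unfolding r_def by linarith
  have r1: "1 \<le> r l" if "l \<in> \<Lambda>1" for l
  proof -
    have "0 < \<theta>" using n1 m1 by (simp add: \<theta>_def)
    then have "0 < real (r l)" using that by (simp add: \<Lambda>1_def)
    then show ?thesis by simp
  qed
  obtain j where j: "j < J" "(\<Sum>l\<in>\<Lambda>1. (real (r l))\<^sup>2) \<le>
      real J * (\<Sum>l\<in>{l\<in>\<Lambda>1. 2 ^ j \<le> r l \<and> r l < 2 ^ Suc j}. (real (r l))\<^sup>2)"
    by (rule dyadic_pigeonhole[of \<Lambda>1 r J "\<lambda>l. (real (r l))\<^sup>2"]) (use fin1 r1 rJ J0 in auto)
  define S1 where "S1 = {l\<in>\<Lambda>1. 2 ^ j \<le> r l \<and> r l < 2 ^ Suc j}"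
  define S where "S = {l\<in>\<Lambda>. 2 ^ j \<le> r l \<and> r l < 2 ^ Suc j}"
  have SS: "S1 \<subseteq> S" "finite S" using fin\<Lambda> by (auto simp: S1_def S_def \<Lambda>1_def)
  have up: "real (r l) \<le> 2 * 2 ^ j" if "l \<in> S" for l
  proof -
    have "r l \<le> 2 ^ Suc j" using that by (simp add: S_def)
    then have "real (r l) \<le> real (2 ^ Suc j)" by (simp only: of_nat_le_iff)
    then show ?thesis by simp
  qed
  have "(\<Sum>l\<in>S1. (real (r l))\<^sup>2) \<le> (\<Sum>l\<in>S. (real (r l))\<^sup>2)" using SS by (intro sum_mono2) auto
  also have "\<dots> \<le> (\<Sum>l\<in>S. (2 * 2 ^ j)\<^sup>2)" using up by (intro sum_mono power_mono) auto
  also have "\<dots> = 4 * (real (card S) * (2 ^ j)\<^sup>2)" by (simp add: power_mult_distrib)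
  finally have S4: "(\<Sum>l\<in>S1. (real (r l))\<^sup>2) \<le> 4 * (real (card S) * (2 ^ j)\<^sup>2)" .
  have "n ^ 4 \<le> 2 * m * (real J * (\<Sum>l\<in>S1. (real (r l))\<^sup>2))"
    using E1 j(2) m1 unfolding S1_def by (elim order_trans, intro mult_left_mono) auto
  also have "\<dots> \<le> 2 * m * (real J * (4 * (real (card S) * (2 ^ j)\<^sup>2)))"
    using S4 m1 by (intro mult_left_mono) auto
  finally have main: "n ^ 4 \<le> 8 * m * real J * (real (card S) * (2 ^ j)\<^sup>2)" by (simp add: mult_ac)
  have "S1 \<noteq> {}"
  proof
    assume "S1 = {}"
    then have "(\<Sum>l\<in>\<Lambda>1. (real (r l))\<^sup>2) \<le> 0" using j(2) unfolding S1_def[symmetric] by simp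
    then have "2 * m * (\<Sum>l\<in>\<Lambda>1. (real (r l))\<^sup>2) \<le> 0" using m1 by (simp add: mult_nonneg_nonpos)
    then have "n ^ 4 \<le> 0" using E1 by linarith
    moreover have "0 < n ^ 4" using n1 by simp
    ultimately show False by linarith
  qed
  then obtain l where l: "l \<in> S1" by blast
  have "\<theta> \<le> 2 * 2 ^ j" using l up[of l] SS by (auto simp: S1_def \<Lambda>1_def)
  then have "n\<^sup>2 \<le> 4 * m * 2 ^ j" using m1 by (simp add: \<theta>_def field_simps)
  then show ?thesis using that[of j] main by (simp add: n_def S_def r_def)
qed

section \<open>The sum-product estimate\<close>


text \<open>A fibre with a rich partial sumset makes \<open>A * mult_fibre A l\<close> large, and
  this product consists of elements \<open>p\<close> of \<open>A * A\<close> with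
  \<open>l * p\<close> in \<open>A * A\<close>. If more than half of the slopes failed the bound,
  their fibres would not be rich, and the window estimate for these slopes would contradict the
  bound on \<open>A + A\<close>.\<close>

lemma majority_popular:
  fixes A S :: "real set"
  assumes A: "finite A" and pos: "\<And>a. a \<in> A \<Longrightarrow> 0 < a"
    and S: "finite S" and \<tau>: "1 \<le> \<tau>"
    and fib: "\<And>l. l \<in> S \<Longrightarrow> \<tau> \<le> real (card (mult_fibre A l))" "\<And>l. l \<in> S \<Longrightarrow> real (card (mult_fibre A l)) \<le> 2 * \<tau>"
    and m: "real (card (A + A)) \<le> m" and m1: "1 \<le> m"
    and W: "3 \<le> W" "16 * m\<^sup>2 < real (card S) * \<tau>\<^sup>2 * (real W - 1)" "2 * real W \<le> real (card S)"
    and J: "card A < 2 ^ J" "2 * \<tau> < 2 ^ J" "0 < J"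
  shows "real (card S) \<le> 2 * real (card {l\<in>S. (real (card A))\<^sup>2 * \<tau> \<le>
    2 ^ 14 * real J ^ 3 * m * real W ^ 4 * real (card {p \<in> A * A. l * p \<in> A * A})})"
proof (rule ccontr)
  define good where "good = (\<lambda>l. (real (card A))\<^sup>2 * \<tau> \<le>
    2 ^ 14 * real J ^ 3 * m * real W ^ 4 * real (card {p \<in> A * A. l * p \<in> A * A}))"
  define B where "B = {l\<in>S. \<not> good l}"
  assume "\<not> ?thesis"
  then have lt: "2 * real (card {l\<in>S. good l}) < real (card S)" by (simp add: good_def)
  have finB: "finite B" using S by (simp add: B_def)
  have "S = B \<union> {l\<in>S. good l}" "B \<inter> {l\<in>S. good l} = {}" by (auto simp: B_def)
  then have "card S = card B + card {l\<in>S. good l}"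
    using S finB card_Un_disjoint[of B "{l\<in>S. good l}"] by auto
  then have cB: "real (card S) \<le> 2 * real (card B)" using lt by linarith
  \<comment> \<open>Then the number of pairs of lines in a window times \<open>\<sigma>\<close> is
    at most \<open>\<tau>\<^sup>2\<close>, as \<open>card_sumset_ge_windows\<close> demands.\<close>
  define \<sigma> where "\<sigma> = \<tau>\<^sup>2 / (real W)\<^sup>2"
  have W0: "0 < real W" using W by simp
  have \<sigma>0: "0 \<le> \<sigma>" by (simp add: \<sigma>_def)
  have nr: "\<not> sum_rich (mult_fibre A l) (2 * \<tau>) \<sigma>" if l: "l \<in> B" for l
  proof
    assume rich: "sum_rich (mult_fibre A l) (2 * \<tau>) \<sigma>"
    define T where "T = real (card (A * mult_fibre A l))"
    define T' where "T' = real (card {p \<in> A * A. l * p \<in> A * A})"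
    have "A * mult_fibre A l \<subseteq> {p \<in> A * A. l * p \<in> A * A}"
    proof
      fix p assume "p \<in> A * mult_fibre A l"
      then obtain a b where ab: "p = a * b" "a \<in> A" "b \<in> A" "l * b \<in> A" by (auto simp: set_times_def mult_fibre_def)
      have e: "l * p = a * (l * b)" using ab by simp
      have "a * (l * b) \<in> A * A" using ab by (intro set_times_intro)
      then have "l * p \<in> A * A" by (simp only: e)
      then show "p \<in> {p \<in> A * A. l * p \<in> A * A}" using ab by (auto intro: set_times_intro)
    qed
    then have TT: "T \<le> T'" unfolding T_def T'_def using A by (intro of_nat_mono card_mono) (auto simp: finite_set_times)
    have "(real (card A)) ^ 4 * \<sigma> ^ 4 \<le> 2 ^ 21 * real J ^ 6 * (real (card (A + A)))\<^sup>2 * (2 * \<tau>) ^ 6 * T\<^sup>2"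
      unfolding T_def
      by (rule card_product_fibre_ge[OF A pos mult_fibre_subset _ rich \<sigma>0 J]) (use fib l in \<open>auto simp: B_def\<close>)
    also have "\<dots> \<le> 2 ^ 22 * real J ^ 6 * m\<^sup>2 * (2 * \<tau>) ^ 6 * T'\<^sup>2"
      using m TT \<tau> by (intro mult_mono power_mono) (auto simp: T_def T'_def)
    finally have 1: "(real (card A)) ^ 4 * \<sigma> ^ 4 \<le> 2 ^ 22 * real J ^ 6 * m\<^sup>2 * (2 * \<tau>) ^ 6 * T'\<^sup>2" .
    have "((real (card A))\<^sup>2 * \<tau>)\<^sup>2 * \<tau> ^ 6 = (real (card A)) ^ 4 * \<sigma> ^ 4 * real W ^ 8"
      using W0 by (simp add: \<sigma>_def power_divide) (simp flip: power_mult power_add add: power_mult_distrib)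
    also have "\<dots> \<le> (2 ^ 22 * real J ^ 6 * m\<^sup>2 * (2 * \<tau>) ^ 6 * T'\<^sup>2) * real W ^ 8"
      using 1 by (intro mult_right_mono) auto
    also have "\<dots> = (2 ^ 14 * real J ^ 3 * m * real W ^ 4 * T')\<^sup>2 * \<tau> ^ 6"
      by (simp add: power_mult_distrib flip: power_mult)
    finally have "((real (card A))\<^sup>2 * \<tau>)\<^sup>2 \<le> (2 ^ 14 * real J ^ 3 * m * real W ^ 4 * T')\<^sup>2"
      by (rule mult_right_le_imp_le) (use \<tau> in auto)
    then have "(real (card A))\<^sup>2 * \<tau> \<le> 2 ^ 14 * real J ^ 3 * m * real W ^ 4 * T'"
      by (rule power2_le_imp_le) (use m1 in \<open>auto simp: T'_def\<close>)
    then show False using l by (simp add: B_def good_def T'_def)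
  qed
  have "real (card B div W) * (real W * (real W - 1) / 4) * \<tau>\<^sup>2 \<le> (real (card (A + A)))\<^sup>2"
  proof (rule card_sumset_ge_windows[OF A pos finB, where M="2 * \<tau>" and \<sigma>=\<sigma>])
    show "(real W * (real W - 1) / 2) * \<sigma> \<le> \<tau>\<^sup>2"
    proof -
      have "(real W * (real W - 1) / 2) * \<sigma> \<le> (real W)\<^sup>2 * \<sigma>"
        using W0 \<sigma>0 by (intro mult_right_mono) (auto simp: power2_eq_square algebra_simps)
      then show ?thesis using W0 by (simp add: \<sigma>_def)
    qed
  qed (use W fib \<tau> nr \<sigma>0 in \<open>auto simp: B_def\<close>)
  also have "\<dots> \<le> m\<^sup>2" using m by (intro power_mono) auto
  finally have 2: "real (card B div W) * (real W * (real W - 1) / 4) * \<tau>\<^sup>2 \<le> m\<^sup>2" .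
  \<comment> \<open>There is at least one full window, so dropping the incomplete one loses at most
    a factor 2.\<close>
  have "W \<le> card B" using W(3) cB by linarith
  then have "card B \<le> 2 * (card B div W) * W"
  proof -
    assume le: "W \<le> card B"
    have "card B = card B div W * W + card B mod W" by simp
    moreover have "card B mod W < W" using W by simp
    moreover have "1 \<le> card B div W" using le W by (simp add: Suc_le_eq div_greater_zero_iff)
    then have "W \<le> card B div W * W" by simp
    ultimately show ?thesis by linarith
  qed
  then have "real (card B) \<le> real (2 * (card B div W) * W)" by (simp only: of_nat_le_iff)
  then have "real (card S) \<le> 4 * (real (card B div W) * real W)" using cB by simp
  then have "real (card S) * (\<tau>\<^sup>2 * (real W - 1)) \<le> 4 * (real (card B div W) * real W) * (\<tau>\<^sup>2 * (real W - 1))"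
    using W by (intro mult_right_mono) auto
  also have "\<dots> = 16 * (real (card B div W) * (real W * (real W - 1) / 4) * \<tau>\<^sup>2)" by (simp add: algebra_simps)
  also have "\<dots> \<le> 16 * m\<^sup>2" by (rule mult_left_mono[OF 2]) simp
  finally show False using W(2) by (simp add: mult_ac)
qed

text \<open>If \<open>a / b * p\<close> is in \<open>A * A\<close>, then \<open>c = p / b\<close>
  satisfies \<open>c * a \<in> A * A\<close>. The dilates of \<open>A * A\<close> by
  \<open>1 / b\<close> with \<open>b\<close> in \<open>F\<close> thus form a set of at most
  \<open>card F * m\<close> multipliers, at least \<open>t\<close> of which work for any given
  \<open>a\<close> in \<open>V\<close>; this makes \<open>V\<close> controlled.\<close>

lemma popular_products_sumset:
  fixes A V F :: "real set"
  assumes A: "finite A" and pos: "\<And>a. a \<in> A \<Longrightarrow> 0 < a" and V: "V \<subseteq> A" "V \<noteq> {}" and F: "F \<subseteq> A"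
    and good: "\<And>a. a \<in> V \<Longrightarrow> \<exists>b\<in>F. t \<le> real (card {p \<in> A * A. a / b * p \<in> A * A})" and t: "0 < t"
    and m: "real (card (A * A)) \<le> m" "real (card (A + A)) \<le> m" and J: "card A < 2 ^ J"
  shows "(real (card V)) ^ 30 * t ^ 24 \<le> 2 ^ 148 * real J ^ 15 * m ^ 46 * real (card F) ^ 16"
proof -
  define C where "C = (\<Union>b\<in>F. (\<lambda>p. p / b) ` (A * A))"
  define D where "D = 1024 * (real (card (A * A)))\<^sup>2 * (real (card C))\<^sup>2 / t ^ 3"
  have finV: "finite V" and finF: "finite F" using A V F finite_subset by auto
  have finAA: "finite (A * A)" using A by (simp add: finite_set_times)
  have finC: "finite C" using finF finAA by (simp add: C_def)
  have m0: "0 \<le> m" using m by (smt (verit) of_nat_0_le_iff)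
  have cC: "real (card C) \<le> real (card F) * m"
  proof -
    have "card C \<le> (\<Sum>b\<in>F. card ((\<lambda>p. p / b) ` (A * A)))" unfolding C_def by (rule card_UN_le[OF finF])
    also have "\<dots> \<le> (\<Sum>b\<in>F. card (A * A))" by (intro sum_mono card_image_le finAA)
    finally have "real (card C) \<le> real (card F * card (A * A))" by (simp only: sum_constant of_nat_le_iff mult.commute) simp
    also have "\<dots> \<le> real (card F) * m" using m by (simp add: mult_left_mono)
    finally show ?thesis .
  qed
  have ctl: "controlled V D" unfolding D_def
  proof (rule controlled_of_products[OF finV _ finC _ finAA])
    show "0 < a" if "a \<in> V" for a using that V pos by blast
    show "0 < c" if "c \<in> C" for c
      using that pos F by (auto simp: C_def set_times_def intro!: divide_pos_pos mult_pos_pos)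
    show "card V \<le> card (A * A)"
      using card_mono[OF A V(1)] card_le_card_times_self[OF A pos] by linarith
    show "t \<le> real (card {c \<in> C. c * a \<in> A * A})" if a: "a \<in> V" for a
    proof -
      obtain b where b: "b \<in> F" "t \<le> real (card {p \<in> A * A. a / b * p \<in> A * A})" using good[OF a] by blast
      have b0: "0 < b" using b F pos by blast
      have "card {p \<in> A * A. a / b * p \<in> A * A} \<le> card {c \<in> C. c * a \<in> A * A}"
      proof (rule card_inj_on_le[where f="\<lambda>p. p / b"])
        show "inj_on (\<lambda>p. p / b) {p \<in> A * A. a / b * p \<in> A * A}" using b0 by (auto simp: inj_on_def)
        show "(\<lambda>p. p / b) ` {p \<in> A * A. a / b * p \<in> A * A} \<subseteq> {c \<in> C. c * a \<in> A * A}"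
          using b(1) by (auto simp: C_def mult.commute)
      qed (use finC in auto)
      then show ?thesis using b(2) by linarith
    qed
  qed (use t in auto)
  have "V + V \<subseteq> A + A" using V by (intro set_plus_mono2) auto
  then have "card (V + V) \<le> card (A + A)" using A by (intro card_mono) (auto simp: finite_set_plus)
  then have cVV: "real (card (V + V)) \<le> m" using m by linarith
  have "card V < 2 ^ J" using card_mono[OF A V(1)] J by linarith
  then have "(real (card V)) ^ 30 \<le> 2 ^ 68 * real J ^ 15 * (real (card (V + V))) ^ 14 * D ^ 8"
    by (rule controlled_sumset[OF ctl finV V(2)])
  also have "\<dots> \<le> 2 ^ 68 * real J ^ 15 * m ^ 14 * (1024 * m\<^sup>2 * (real (card F) * m)\<^sup>2 / t ^ 3) ^ 8"
    unfolding D_def using cVV m cC t m0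
    by (intro mult_mono power_mono divide_right_mono) auto
  also have "\<dots> = 2 ^ 148 * real J ^ 15 * m ^ 46 * real (card F) ^ 16 / t ^ 24"
    by (simp add: power_divide power_mult_distrib flip: power_mult power_add)
  finally show ?thesis using t by (simp add: field_simps)
qed

text \<open>Up to logarithms this says \<open>m \<ge> n powr (255 / 191)\<close>, and \<open>255 / 191 = 4 / 3 + 1 / 573\<close>.\<close>
theorem sum_product_positive:
  fixes A :: "real set"
  assumes A: "finite A" and pos: "\<And>a. a \<in> A \<Longrightarrow> 0 < a" and ne: "A \<noteq> {}"
    and m: "real (card (A * A)) \<le> m" "real (card (A + A)) \<le> m" and J: "2 * card A < 2 ^ J"
  shows "(real (card A)) ^ 510 \<le> 2 ^ 1534 * real J ^ 206 * m ^ 382"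
proof -
  define n where "n = real (card A)"
  have n1: "1 \<le> n" using A ne by (simp add: n_def Suc_le_eq card_gt_0_iff)
  have "n \<le> m" using card_le_card_times_self[OF A pos] m unfolding n_def by linarith
  then have m1: "1 \<le> m" using n1 by linarith
  have J': "card A < 2 ^ J" using J by linarith
  have J0: "0 < J" using J ne A by (cases J) (auto simp: card_gt_0_iff)
  then have J1: "1 \<le> real J" by simp
  define \<Lambda> where "\<Lambda> = (\<lambda>(a, b). a / b) ` (A \<times> A)"
  obtain j where j: "n ^ 4 \<le> 8 * m * real J *
      (real (card {l\<in>\<Lambda>. 2 ^ j \<le> card (mult_fibre A l) \<and> card (mult_fibre A l) < 2 ^ Suc j}) * (2 ^ j)\<^sup>2)"
    "n\<^sup>2 \<le> 4 * m * 2 ^ j"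
    unfolding n_def \<Lambda>_def by (rule popular_ratio_level[OF A pos ne m(1) J'])
  define S where "S = {l\<in>\<Lambda>. 2 ^ j \<le> card (mult_fibre A l) \<and> card (mult_fibre A l) < 2 ^ Suc j}"
  define \<tau> where "\<tau> = (2::real) ^ j"
  define s where "s = real (card S)"
  have \<tau>1: "1 \<le> \<tau>" and \<tau>0: "\<tau> \<noteq> 0" by (simp_all add: \<tau>_def)
  have finS: "finite S" using A by (simp add: S_def \<Lambda>_def)
  have n4: "n ^ 4 \<le> 8 * m * real J * (s * \<tau>\<^sup>2)" using j(1) by (simp add: s_def S_def \<tau>_def)
  have n2: "n\<^sup>2 \<le> 4 * m * \<tau>" using j(2) by (simp add: \<tau>_def)
  have fib: "\<tau> \<le> real (card (mult_fibre A l))" "real (card (mult_fibre A l)) \<le> 2 * \<tau>" if "l \<in> S" for l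
  proof -
    have h: "2 ^ j \<le> card (mult_fibre A l)" "card (mult_fibre A l) \<le> 2 ^ Suc j" using that by (auto simp: S_def)
    have "real (2 ^ j) \<le> real (card (mult_fibre A l))" "real (card (mult_fibre A l)) \<le> real (2 ^ Suc j)"
      using h by (simp_all only: of_nat_le_iff)
    then show "\<tau> \<le> real (card (mult_fibre A l))" "real (card (mult_fibre A l)) \<le> 2 * \<tau>" by (simp_all add: \<tau>_def)
  qed
  have s0: "0 < s"
  proof -
    have "0 < n ^ 4" using n1 by simp
    then have "s \<noteq> 0" using n4 by auto
    then show ?thesis by (simp add: s_def)
  qed
  then have "S \<noteq> {}" by (auto simp: s_def)
  then obtain l0 where l0: "l0 \<in> S" by blast
  have \<tau>n: "\<tau> \<le> n" using fib(1)[OF l0] card_mono[OF A mult_fibre_subset[of A l0]] by (simp add: n_def)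
  \<comment> \<open>In the first case \<open>m\<close> is at least of order
    \<open>n powr (3/2)\<close> up to powers of \<open>J\<close>, more than needed. The constant 66
    is such that the other case gives \<open>68 * q \<le> s\<close> below, that is, room for two
    windows.\<close>
  show ?thesis
  proof (cases "n ^ 3 \<le> 66 * real J * m\<^sup>2")
    case True
    have "n ^ 510 = (n ^ 3) ^ 170" by (simp flip: power_mult)
    also have "\<dots> \<le> (66 * real J * m\<^sup>2) ^ 170" using True n1 by (intro power_mono) auto
    also have "\<dots> = 66 ^ 170 * real J ^ 170 * m ^ 340" by (simp add: power_mult_distrib flip: power_mult)
    also have "\<dots> \<le> 2 ^ 1534 * real J ^ 206 * m ^ 382"
    proof (intro mult_mono)
      have "(66::real) ^ 170 \<le> (2 ^ 7) ^ 170" by (intro power_mono) auto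
      also have "\<dots> = 2 ^ 1190" by (simp only: power_mult[symmetric]) simp
      also have "\<dots> \<le> 2 ^ 1534" by (intro power_increasing) auto
      finally show "(66::real) ^ 170 \<le> 2 ^ 1534" .
    qed (use J1 m1 in \<open>auto intro: power_increasing\<close>)
    finally show ?thesis by (simp only: n_def)
  next
    case False
    \<comment> \<open>The slack in Solymosi's inequality; it is at least \<open>1 / 6\<close> and
      determines the window length.\<close>
    define q where "q = m\<^sup>2 / (s * \<tau>\<^sup>2)"
    have st: "0 < s * \<tau>\<^sup>2" using s0 \<tau>1 by simp
    have q0: "0 \<le> q" using st by (simp add: q_def)
    have "s * \<tau>\<^sup>2 \<le> 6 * (real (card (A + A)))\<^sup>2"
      unfolding s_def by (rule solymosi_level[OF A pos finS]) (use fib \<tau>1 in auto)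
    also have "\<dots> \<le> 6 * m\<^sup>2" using m by (intro mult_left_mono power_mono) auto
    finally have q6: "1 \<le> 6 * q" using st by (simp add: q_def field_simps)
    \<comment> \<open>The summand 2 gives \<open>16 * q < W - 1\<close>; it is absorbed in
      \<open>W \<le> 34 * q\<close> by \<open>1 \<le> 6 * q\<close>.\<close>
    define W where "W = nat \<lceil>16 * q\<rceil> + 2"
    have ceil: "16 * q \<le> real (nat \<lceil>16 * q\<rceil>)" "real (nat \<lceil>16 * q\<rceil>) \<le> 16 * q + 1"
      using q0 by linarith+
    have W3: "3 \<le> W"
    proof -
      have "0 < 16 * q" using q6 by linarith
      then have "1 \<le> nat \<lceil>16 * q\<rceil>" by linarith
      then show ?thesis by (simp add: W_def)
    qed
    have Wq: "real W \<le> 34 * q" using ceil(2) q6 unfolding W_def by linarith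
    have W1: "16 * q < real W - 1" using ceil(1) unfolding W_def by linarith
    have W16: "16 * m\<^sup>2 < real (card S) * \<tau>\<^sup>2 * (real W - 1)"
    proof -
      have "16 * m\<^sup>2 = s * \<tau>\<^sup>2 * (16 * q)" using s0 \<tau>0 by (simp add: q_def)
      also have "\<dots> < s * \<tau>\<^sup>2 * (real W - 1)" using W1 st by (intro mult_strict_left_mono) auto
      finally show ?thesis by (simp add: s_def)
    qed
    have WS: "2 * real W \<le> real (card S)"
    proof -
      have "n ^ 3 * n = n ^ 4" by (simp add: eval_nat_numeral)
      also have "\<dots> \<le> (8 * m * real J * (s * \<tau>)) * \<tau>" using n4 by (simp add: power2_eq_square mult_ac)
      also have "\<dots> \<le> (8 * m * real J * (s * \<tau>)) * n" using \<tau>n m1 s0 \<tau>1 by (intro mult_left_mono) auto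
      finally have "n ^ 3 \<le> 8 * m * real J * (s * \<tau>)" by (rule mult_right_le_imp_le) (use n1 in auto)
      then have "66 * real J * m\<^sup>2 \<le> 8 * m * real J * (s * \<tau>)" using False by linarith
      then have "(8 * m * real J) * (66 / 8 * m) \<le> (8 * m * real J) * (s * \<tau>)" by (simp add: power2_eq_square mult_ac)
      then have "66 / 8 * m \<le> s * \<tau>" by (rule mult_left_le_imp_le) (use m1 J1 in auto)
      then have "(66 / 8 * m)\<^sup>2 \<le> (s * \<tau>)\<^sup>2" using m1 by (intro power_mono) auto
      moreover have "(66 / 8 * m)\<^sup>2 = 4356 / 64 * m\<^sup>2" by (simp add: power2_eq_square)
      ultimately have "68 * m\<^sup>2 \<le> (s * \<tau>)\<^sup>2" using zero_le_power2[of m] by linarith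
      then have "68 * q \<le> s" using s0 \<tau>1 by (simp add: q_def field_simps power2_eq_square)
      then show ?thesis using Wq by (simp add: s_def)
    qed
    \<comment> \<open>The number of representations as a quotient of elements of
      \<open>A * A\<close> that \<open>majority_popular\<close> guarantees for at least half of
      \<open>S\<close>.\<close>
    define t where "t = n\<^sup>2 * \<tau> / (2 ^ 14 * real J ^ 3 * m * real W ^ 4)"
    have den: "0 < 2 ^ 14 * real J ^ 3 * m * real W ^ 4" using J1 m1 W3 by simp
    have t0: "0 < t" using den n1 \<tau>1 by (simp add: t_def)
    define S' where "S' = {l\<in>S. t \<le> real (card {p \<in> A * A. l * p \<in> A * A})}"
    have "real (card S) \<le> 2 * real (card {l\<in>S. (real (card A))\<^sup>2 * \<tau> \<le>
      2 ^ 14 * real J ^ 3 * m * real W ^ 4 * real (card {p \<in> A * A. l * p \<in> A * A})})"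
    proof (rule majority_popular[OF A pos finS \<tau>1 fib m(2) m1 W3 W16 WS J'])
      have "2 * \<tau> \<le> real (2 * card A)" using \<tau>n by (simp add: n_def)
      also have "\<dots> < real (2 ^ J)" using J by (simp only: of_nat_less_iff)
      finally show "2 * \<tau> < 2 ^ J" by simp
    qed (use J0 in auto)
    also have "{l\<in>S. (real (card A))\<^sup>2 * \<tau> \<le> 2 ^ 14 * real J ^ 3 * m * real W ^ 4 * real (card {p \<in> A * A. l * p \<in> A * A})} = S'"
      unfolding S'_def t_def n_def using den by (simp add: pos_divide_le_eq mult.commute)
    finally have sS': "s \<le> 2 * real (card S')" by (simp add: s_def)
    \<comment> \<open>The graph on \<open>A\<close> of pairs with popular ratio. It is symmetric
      because \<open>S'\<close> is closed under inversion, and it has at least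
      \<open>s * \<tau> / 2\<close> ordered edges.\<close>
    define R where "R = (\<lambda>a b. a / b \<in> S')"
    have S'inv: "1 / l \<in> S'" if l: "l \<in> S'" for l
    proof -
      obtain a b where ab: "l = a / b" "a \<in> A" "b \<in> A" using l by (auto simp: S'_def S_def \<Lambda>_def)
      have p: "0 < a" "0 < b" using ab pos by auto
      then have l0: "0 < l" using ab by simp
      have "1 / l = b / a" using ab by simp
      then have "1 / l \<in> \<Lambda>" unfolding \<Lambda>_def using ab by force
      moreover have "card (mult_fibre A (1 / l)) = card (mult_fibre A l)" by (rule card_mult_fibre_inverse[OF l0])
      moreover have "card {p \<in> A * A. 1 / l * p \<in> A * A} = card {p \<in> A * A. l * p \<in> A * A}"
        using card_mult_fibre_inverse[OF l0, of "A * A"] by (simp add: mult_fibre_def)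
      ultimately show ?thesis using l by (simp add: S'_def S_def)
    qed
    have Rsym: "R b a" if "R a b" for a b using S'inv[of "a / b"] that by (simp add: R_def)
    define d where "d = s * \<tau> / (8 * n)"
    have d0: "0 < d" using s0 \<tau>1 n1 by (simp add: d_def)
    have finS': "finite S'" using finS by (simp add: S'_def)
    have "4 * d * real (card A) = s * \<tau> / 2" using n1 by (simp add: d_def n_def)
    also have "\<dots> \<le> real (card S') * \<tau>" using sS' \<tau>1 by (simp add: mult_right_mono)
    also have "\<dots> = (\<Sum>l\<in>S'. \<tau>)" by simp
    also have "\<dots> \<le> (\<Sum>l\<in>S'. real (card (mult_fibre A l)))" by (intro sum_mono fib) (auto simp: S'_def)
    also have "\<dots> = real (card (SIGMA l:S'. mult_fibre A l))" using finS' A by (simp add: card_SigmaI)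
    also have "\<dots> \<le> real (card {(a, b). a \<in> A \<and> b \<in> A \<and> R a b})"
    proof -
      have "card (SIGMA l:S'. mult_fibre A l) \<le> card {(a, b). a \<in> A \<and> b \<in> A \<and> R a b}"
      proof (rule card_inj_on_le[where f="\<lambda>(l, b). (l * b, b)"])
        show "inj_on (\<lambda>(l, b). (l * b, b)) (SIGMA l:S'. mult_fibre A l)"
          using pos by (force simp: inj_on_def mult_fibre_def)
        show "(\<lambda>(l, b). (l * b, b)) ` (SIGMA l:S'. mult_fibre A l) \<subseteq> {(a, b). a \<in> A \<and> b \<in> A \<and> R a b}"
          using pos by (force simp: mult_fibre_def R_def)
        show "finite {(a, b). a \<in> A \<and> b \<in> A \<and> R a b}"
          by (rule finite_subset[of _ "A \<times> A"]) (use A in auto)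
      qed
      then show ?thesis by simp
    qed
    finally have edges: "4 * d * real (card A) \<le> real (card {(a, b). a \<in> A \<and> b \<in> A \<and> R a b})" .
    obtain V where V: "V \<subseteq> A" "\<And>a. a \<in> V \<Longrightarrow> d \<le> real (card {b\<in>V. R a b})"
      and V2: "2 * d * real (card A) \<le> (real (card V))\<^sup>2"
      using dense_core[OF A Rsym edges] by blast
    have finV: "finite V" using V A finite_subset by blast
    \<comment> \<open>All degrees in \<open>V\<close> are at least \<open>d\<close>, so a small
      \<open>F\<close> reaches half of \<open>V\<close>: each reached \<open>a\<close> has a popular
      ratio \<open>a / b\<close> with some \<open>b\<close> in \<open>F\<close>.\<close>
    obtain F where F: "F \<subseteq> V" "real (card F) * d \<le> 2 * real (card V)"
      "real (card V) \<le> 2 * real (card {a\<in>V. \<exists>b\<in>F. R a b})"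
      by (rule half_cover[of V d R, OF finV d0 V(2)])
    define v where "v = real (card V)"
    define V' where "V' = {a\<in>V. \<exists>b\<in>F. R a b}"
    have nd0: "0 < n * d" using n1 d0 by simp
    have "2 * d * real (card A) = 2 * (n * d)" by (simp add: n_def)
    then have nd: "n * d \<le> v\<^sup>2" using V2 nd0 unfolding v_def by linarith
    then have "0 < v\<^sup>2" using nd0 by linarith
    then have v0: "0 < v" by (simp add: v_def zero_less_power2)
    have V'0: "0 < real (card V')" using F(3) v0 by (simp add: V'_def v_def)
    then have "V' \<noteq> {}" by auto
    then have H: "(real (card V')) ^ 30 * t ^ 24 \<le> 2 ^ 148 * real J ^ 15 * m ^ 46 * real (card F) ^ 16"
    proof (intro popular_products_sumset[OF A pos _ _ _ _ t0 m J'])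
      show "V' \<subseteq> A" "F \<subseteq> A" using V F by (auto simp: V'_def)
      fix a assume "a \<in> V'"
      then show "\<exists>b\<in>F. t \<le> real (card {p \<in> A * A. a / b * p \<in> A * A})"
        unfolding V'_def R_def S'_def by blast
    qed auto
    \<comment> \<open>The factor \<open>d ^ 16\<close> turns \<open>card F ^ 16\<close> into at most
      \<open>(2 * v) ^ 16\<close>. The remaining \<open>v ^ 14\<close> is then bounded below by
      \<open>(n * d) ^ 7\<close>.\<close>
    have "v ^ 30 * t ^ 24 * d ^ 16 \<le> (2 * real (card V')) ^ 30 * t ^ 24 * d ^ 16"
      using F(3) t0 d0 v0 by (intro mult_right_mono power_mono) (auto simp: v_def V'_def)
    also have "\<dots> = 2 ^ 30 * ((real (card V')) ^ 30 * t ^ 24) * d ^ 16" by (simp only: power_mult_distrib mult_ac)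
    also have "\<dots> \<le> 2 ^ 30 * (2 ^ 148 * real J ^ 15 * m ^ 46 * real (card F) ^ 16) * d ^ 16"
      by (intro mult_right_mono mult_left_mono H) (use d0 in auto)
    also have "\<dots> = 2 ^ 178 * real J ^ 15 * m ^ 46 * (real (card F) * d) ^ 16"
    proof -
      have "(2::real) ^ 178 = 2 ^ 30 * 2 ^ 148" by (simp only: power_add[symmetric]) simp
      then show ?thesis by (simp only: power_mult_distrib mult_ac)
    qed
    also have "\<dots> \<le> 2 ^ 178 * real J ^ 15 * m ^ 46 * (2 * v) ^ 16"
      using F(2) d0 m1 by (intro mult_left_mono power_mono) (auto simp: v_def)
    also have "\<dots> = (2 ^ 194 * real J ^ 15 * m ^ 46) * v ^ 16"
    proof -
      have "(2::real) ^ 194 = 2 ^ 178 * 2 ^ 16" by (simp only: power_add[symmetric]) simp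
      then show ?thesis by (simp only: power_mult_distrib mult_ac)
    qed
    also have "v ^ 30 * t ^ 24 * d ^ 16 = (v ^ 14 * t ^ 24 * d ^ 16) * v ^ 16"
    proof -
      have "v ^ 30 = v ^ 14 * v ^ 16" by (simp flip: power_add)
      then show ?thesis by (simp only: mult_ac)
    qed
    finally have "(v ^ 14 * t ^ 24 * d ^ 16) * v ^ 16 \<le> (2 ^ 194 * real J ^ 15 * m ^ 46) * v ^ 16" .
    then have "v ^ 14 * t ^ 24 * d ^ 16 \<le> 2 ^ 194 * real J ^ 15 * m ^ 46"
      by (rule mult_right_le_imp_le) (use v0 in auto)
    moreover have "(n * d) ^ 7 * t ^ 24 * d ^ 16 \<le> v ^ 14 * t ^ 24 * d ^ 16"
    proof -
      have "(n * d) ^ 7 \<le> (v\<^sup>2) ^ 7" using nd n1 d0 by (intro power_mono) auto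
      then have "(n * d) ^ 7 \<le> v ^ 14" by (simp flip: power_mult)
      then show ?thesis using t0 d0 by (intro mult_right_mono) auto
    qed
    moreover have "(n * d) ^ 7 * t ^ 24 * d ^ 16 = n ^ 7 * t ^ 24 * d ^ 23"
    proof -
      have "d ^ 23 = d ^ 7 * d ^ 16" by (simp flip: power_add)
      then show ?thesis by (simp only: power_mult_distrib mult_ac)
    qed
    ultimately have fin1: "n ^ 7 * t ^ 24 * d ^ 23 \<le> 2 ^ 194 * real J ^ 15 * m ^ 46" by linarith
    define w where "w = 2 ^ 14 * real J ^ 3 * m * real W ^ 4"
    have w0: "0 < w" using den unfolding w_def .
    have "t = n\<^sup>2 * \<tau> / w" unfolding t_def w_def ..
    then have tw: "t * w = n\<^sup>2 * \<tau>" using w0 by simp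
    have d8: "d * (8 * n) = s * \<tau>" using n1 by (simp add: d_def)
    have "n ^ 7 * (n\<^sup>2 * \<tau>) ^ 24 * (s * \<tau>) ^ 23 = (n ^ 7 * t ^ 24 * d ^ 23) * w ^ 24 * (8 * n) ^ 23"
      unfolding tw[symmetric] d8[symmetric] by (simp only: power_mult_distrib mult_ac)
    also have "\<dots> \<le> (2 ^ 194 * real J ^ 15 * m ^ 46) * w ^ 24 * (8 * n) ^ 23"
      using fin1 w0 n1 by (intro mult_right_mono) auto
    also have "\<dots> \<le> (2 ^ 194 * real J ^ 15 * m ^ 46) * (2 ^ 336 * real J ^ 72 * m ^ 24 * (2 ^ 6 * q) ^ 96) * (8 * n) ^ 23"
    proof -
      have "w ^ 24 = (2 ^ 14) ^ 24 * (real J ^ 3) ^ 24 * m ^ 24 * (real W ^ 4) ^ 24"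
        unfolding w_def by (simp only: power_mult_distrib)
      also have "\<dots> = 2 ^ 336 * real J ^ 72 * m ^ 24 * real W ^ 96" by (simp only: power_mult[symmetric]) simp
      also have "\<dots> \<le> 2 ^ 336 * real J ^ 72 * m ^ 24 * (2 ^ 6 * q) ^ 96"
        using Wq q0 m1 by (intro mult_left_mono power_mono) auto
      finally show ?thesis using m1 n1 by (intro mult_right_mono mult_left_mono) auto
    qed
    finally have fin2: "n ^ 7 * (n\<^sup>2 * \<tau>) ^ 24 * (s * \<tau>) ^ 23 \<le>
      (2 ^ 194 * real J ^ 15 * m ^ 46) * (2 ^ 336 * real J ^ 72 * m ^ 24 * (2 ^ 6 * q) ^ 96) * (8 * n) ^ 23" .
    have qs: "q * (s * \<tau>\<^sup>2) = m\<^sup>2" using s0 \<tau>0 by (simp add: q_def)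
    \<comment> \<open>The factor \<open>(s * \<tau>\<^sup>2) ^ 96\<close> cancels
      \<open>q ^ 96\<close> by \<open>qs\<close>. Afterwards \<open>s\<close> occurs only within
      \<open>s * \<tau>\<^sup>2\<close>, next to a single factor \<open>\<tau>\<close>.\<close>
    have "n ^ 23 * (n ^ 32 * \<tau> * (s * \<tau>\<^sup>2) ^ 119) = (n ^ 7 * (n\<^sup>2 * \<tau>) ^ 24 * (s * \<tau>) ^ 23) * (s * \<tau>\<^sup>2) ^ 96"
    proof -
      have "n ^ 23 * n ^ 32 = n ^ 7 * (n\<^sup>2) ^ 24" by (simp flip: power_mult power_add)
      moreover have "\<tau> * (\<tau>\<^sup>2) ^ 119 = \<tau> ^ 24 * \<tau> ^ 23 * (\<tau>\<^sup>2) ^ 96"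
        by (simp flip: power_mult power_add power_Suc)
      moreover have "s ^ 119 = s ^ 23 * s ^ 96" by (simp flip: power_add)
      moreover have "n ^ 23 * (n ^ 32 * \<tau> * (s * \<tau>\<^sup>2) ^ 119) = (n ^ 23 * n ^ 32) * (\<tau> * (\<tau>\<^sup>2) ^ 119) * s ^ 119"
        by (simp only: power_mult_distrib mult_ac)
      moreover have "(n ^ 7 * (n\<^sup>2 * \<tau>) ^ 24 * (s * \<tau>) ^ 23) * (s * \<tau>\<^sup>2) ^ 96 =
          (n ^ 7 * (n\<^sup>2) ^ 24) * (\<tau> ^ 24 * \<tau> ^ 23 * (\<tau>\<^sup>2) ^ 96) * (s ^ 23 * s ^ 96)"
        by (simp only: power_mult_distrib mult_ac)
      ultimately show ?thesis by simp
    qed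
    also have "\<dots> \<le> ((2 ^ 194 * real J ^ 15 * m ^ 46) * (2 ^ 336 * real J ^ 72 * m ^ 24 * (2 ^ 6 * q) ^ 96) * (8 * n) ^ 23) * (s * \<tau>\<^sup>2) ^ 96"
      using fin2 st by (intro mult_right_mono) auto
    also have "\<dots> = n ^ 23 * (2 ^ 1175 * real J ^ 87 * m ^ 70 * (q * (s * \<tau>\<^sup>2)) ^ 96)"
    proof -
      have "(8::real) ^ 23 = 2 ^ 69" by simp
      moreover have "((2::real) ^ 6) ^ 96 = 2 ^ 576" by (simp only: power_mult[symmetric]) simp
      moreover have "(2::real) ^ 1175 = 2 ^ 194 * 2 ^ 336 * 2 ^ 576 * 2 ^ 69" by (simp only: power_add[symmetric]) simp
      moreover have "real J ^ 87 = real J ^ 15 * real J ^ 72" "m ^ 70 = m ^ 46 * m ^ 24" by (simp_all flip: power_add)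
      ultimately show ?thesis by (simp only: power_mult_distrib mult_ac)
    qed
    finally have "n ^ 32 * \<tau> * (s * \<tau>\<^sup>2) ^ 119 \<le> 2 ^ 1175 * real J ^ 87 * m ^ 70 * (q * (s * \<tau>\<^sup>2)) ^ 96"
      by (rule mult_left_le_imp_le) (use n1 in auto)
    also have "(q * (s * \<tau>\<^sup>2)) ^ 96 = m ^ 192" unfolding qs by (simp flip: power_mult)
    finally have fin3: "n ^ 32 * \<tau> * (s * \<tau>\<^sup>2) ^ 119 \<le> 2 ^ 1175 * real J ^ 87 * m ^ 70 * m ^ 192" .
    \<comment> \<open>\<open>n4\<close> is used 119 times and \<open>n2\<close> once, for the single
      \<open>\<tau>\<close>; the degrees add up to \<open>32 + 2 + 476 = 510\<close>.\<close>
    have "n ^ 510 = n ^ 32 * n\<^sup>2 * (n ^ 4) ^ 119" by (simp flip: power_mult power_add)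
    also have "\<dots> \<le> n ^ 32 * (4 * m * \<tau>) * (8 * m * real J * (s * \<tau>\<^sup>2)) ^ 119"
      using n1 n2 n4 m1 \<tau>1 by (intro mult_mono power_mono) auto
    also have "\<dots> = (4 * m) * (8 * m * real J) ^ 119 * (n ^ 32 * \<tau> * (s * \<tau>\<^sup>2) ^ 119)"
      by (simp only: power_mult_distrib mult_ac)
    also have "\<dots> \<le> (4 * m) * (8 * m * real J) ^ 119 * (2 ^ 1175 * real J ^ 87 * m ^ 70 * m ^ 192)"
      using fin3 m1 by (intro mult_left_mono) auto
    also have "\<dots> = 2 ^ 1534 * real J ^ 206 * m ^ 382"
    proof -
      have "(8::real) ^ 119 = 2 ^ 357" by simp
      moreover have "(2::real) ^ 1534 = 4 * 2 ^ 357 * 2 ^ 1175" by simp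
      moreover have "real J ^ 206 = real J ^ 119 * real J ^ 87" "m ^ 382 = m * m ^ 119 * m ^ 70 * m ^ 192"
        by (simp_all flip: power_add power_Suc)
      ultimately show ?thesis by (simp only: power_mult_distrib mult_ac)
    qed
    finally show ?thesis by (simp only: n_def)
  qed
qed


text \<open>Zero is at most one element, so the positive elements or the negative ones make up at
  least a third of \<open>A\<close>. Negation preserves products and reflects sums, so
  \<open>sum_product_positive\<close> applies to either part.\<close>

lemma sum_product_real:
  fixes A :: "real set"
  assumes A: "finite A" and A3: "3 \<le> card A"
    and m: "real (card (A * A)) \<le> m" "real (card (A + A)) \<le> m" and J: "2 * card A < 2 ^ J"
  shows "(real (card A) / 3) ^ 510 \<le> 2 ^ 1534 * real J ^ 206 * m ^ 382"
proof -
  have key: "(real (card A) / 3) ^ 510 \<le> 2 ^ 1534 * real J ^ 206 * m ^ 382"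
    if B: "finite B" "\<And>b. b \<in> B \<Longrightarrow> 0 < b" "card A \<le> 3 * card B" "card B \<le> card A"
      "card (B * B) \<le> card (A * A)" "card (B + B) \<le> card (A + A)" for B :: "real set"
  proof -
    have "B \<noteq> {}" using B(3) A3 by auto
    have "(real (card A) / 3) ^ 510 \<le> (real (card B)) ^ 510" using B(3) by (intro power_mono) auto
    also have "\<dots> \<le> 2 ^ 1534 * real J ^ 206 * m ^ 382"
      by (rule sum_product_positive[OF B(1,2) \<open>B \<noteq> {}\<close>]) (use B m J in linarith)+
    finally show ?thesis .
  qed
  define P where "P = {a\<in>A. 0 < a}"
  define N where "N = {a\<in>A. a < 0}"
  have fin: "finite P" "finite N" using A by (auto simp: P_def N_def)
  have finAA: "finite (A * A)" "finite (A + A)" using A by (auto simp: finite_set_times finite_set_plus)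
  have "A \<subseteq> insert 0 (P \<union> N)" by (auto simp: P_def N_def)
  then have "card A \<le> card (insert 0 (P \<union> N))" using fin by (intro card_mono) auto
  also have "\<dots> \<le> Suc (card (P \<union> N))" by (rule card_insert_le_m1) auto
  also have "\<dots> \<le> Suc (card P + card N)" using card_Un_le by simp
  finally have c: "card A \<le> Suc (card P + card N)" .
  show ?thesis
  proof (cases "card A \<le> 3 * card P")
    case True
    have "P \<subseteq> A" by (auto simp: P_def)
    then have "P * P \<subseteq> A * A" "P + P \<subseteq> A + A" by (simp_all add: set_times_mono2 set_plus_mono2)
    then show ?thesis using fin A finAA True
      by (intro key[of P]) (auto simp: P_def intro!: card_mono)
  next
    case False
    then have N3: "card A \<le> 3 * card N" using c A3 by linarith
    define B where "B = uminus ` N"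
    have cB: "card B = card N" unfolding B_def by (rule card_image) auto
    have "card (B * B) \<le> card (A * A)"
    proof (rule card_mono[OF finAA(1)])
      show "B * B \<subseteq> A * A"
      proof
        fix x assume "x \<in> B * B"
        then obtain a b where "x = (- a) * (- b)" "a \<in> A" "b \<in> A" by (auto simp: B_def N_def set_times_def)
        then show "x \<in> A * A" by (auto intro: set_times_intro)
      qed
    qed
    moreover have "card (B + B) \<le> card (A + A)"
    proof -
      have "B + B \<subseteq> uminus ` (A + A)"
      proof
        fix x assume "x \<in> B + B"
        then obtain a b where "x = - (a + b)" "a \<in> A" "b \<in> A" by (auto simp: B_def N_def set_plus_def)
        then show "x \<in> uminus ` (A + A)" by (blast intro: set_plus_intro)
      qed
      then show ?thesis by (rule surj_card_le[OF finAA(2)])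
    qed
    moreover have "card N \<le> card A" using A by (intro card_mono) (auto simp: N_def)
    ultimately show ?thesis using fin N3 cB by (intro key[of B]) (auto simp: B_def N_def)
  qed
qed

text \<open>The exponent \<open>4/3 + 2/1167 = 1558/1167\<close> lies strictly below
  \<open>510/382 = 255/191\<close>; this gap absorbs the constant and the powers of the
  logarithm.\<close>

theorem theorem1p2:
  shows "\<forall>\<epsilon>::real. \<epsilon> > 0 \<longrightarrow> (\<exists>n\<^sub>0::nat. \<forall>A::real set. finite A \<and> card A \<ge> n\<^sub>0 \<longrightarrow>
           real (max (card (A * A)) (card (A + A))) \<ge> real (card A) powr (4/3 + 2/1167 - \<epsilon>))"
proof (intro allI impI)
  fix \<epsilon> :: real assume \<epsilon>: "\<epsilon> > 0"
  define K :: real where "K = 3 ^ 510 * 2 ^ 1534"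
  have K0: "0 < K" by (simp add: K_def)
  \<comment> \<open>The exponent \<open>1 / 100\<close> is below
    \<open>510 - 382 * 1558 / 1167 = 14 / 1167\<close>, the room left in the exponent of
    \<open>n\<close>.\<close>
  have "((\<lambda>x::real. (log 2 x + 3) ^ 206 / x powr (1 / 100)) \<longlongrightarrow> 0) at_top" by real_asymp
  then have "((\<lambda>n. (log 2 (real n) + 3) ^ 206 / real n powr (1 / 100)) \<longlongrightarrow> 0) sequentially"
    by (rule filterlim_compose[OF _ filterlim_real_sequentially])
  then have "\<forall>\<^sub>F n in sequentially. (log 2 (real n) + 3) ^ 206 / real n powr (1 / 100) < 1 / K"
    by (rule order_tendstoD) (use K0 in simp)
  then obtain N where N: "\<And>n. N \<le> n \<Longrightarrow> (log 2 (real n) + 3) ^ 206 / real n powr (1 / 100) < 1 / K"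
    unfolding eventually_sequentially by blast
  have "real (max (card (A * A)) (card (A + A))) \<ge> real (card A) powr (4/3 + 2/1167 - \<epsilon>)"
    if A: "finite A" and cA: "max N 3 \<le> card A" for A :: "real set"
  proof -
    define n where "n = real (card A)"
    define m where "m = real (max (card (A * A)) (card (A + A)))"
    have n3: "3 \<le> n" using cA by (simp add: n_def)
    \<comment> \<open>The summand 2 gives \<open>4 * n \<le> 2 ^ J\<close>, from which the strict
      bound \<open>2 * n < 2 ^ J\<close> follows.\<close>
    define J where "J = nat \<lceil>log 2 n\<rceil> + 2"
    have l0: "0 \<le> log 2 n" using n3 by simp
    have JJ: "real J \<le> log 2 n + 3" using l0 unfolding J_def by linarith
    have "log 2 n + 2 \<le> real J" using l0 unfolding J_def by linarith
    then have "2 powr (log 2 n + 2) \<le> 2 powr real J" by (intro powr_mono) auto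
    then have "4 * n \<le> 2 ^ J" using n3 by (simp add: powr_add powr_realpow)
    then have "2 * n < 2 ^ J" using n3 by linarith
    then have "real (2 * card A) < real (2 ^ J)" by (simp add: n_def)
    then have J: "2 * card A < 2 ^ J" by (simp only: of_nat_less_iff)
    have "(n / 3) ^ 510 \<le> 2 ^ 1534 * real J ^ 206 * m ^ 382"
      unfolding n_def by (rule sum_product_real[OF A _ _ _ J]) (use cA in \<open>auto simp: m_def\<close>)
    then have "n ^ 510 \<le> 3 ^ 510 * (2 ^ 1534 * real J ^ 206 * m ^ 382)"
      by (simp only: power_divide) (simp add: field_simps)
    also have "\<dots> = (K * real J ^ 206) * m ^ 382" by (simp only: K_def mult_ac)
    also have "\<dots> \<le> n powr (1 / 100) * m ^ 382"
    proof (rule mult_right_mono)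
      have "K * real J ^ 206 \<le> K * (log 2 n + 3) ^ 206" using JJ K0 by (intro mult_left_mono power_mono) auto
      also have "\<dots> \<le> n powr (1 / 100)"
        using N[of "card A"] cA K0 n3 by (simp add: n_def field_simps)
      finally show "K * real J ^ 206 \<le> n powr (1 / 100)" .
    qed (simp add: m_def)
    finally have main: "n ^ 510 \<le> n powr (1 / 100) * m ^ 382" .
    have "n powr (1558 / 1167) \<le> m"
    proof (rule ccontr)
      assume "\<not> ?thesis"
      then have "m ^ 382 \<le> (n powr (1558 / 1167)) ^ 382" by (intro power_mono) (auto simp: m_def)
      also have "\<dots> = n powr (1558 / 1167 * 382)" using n3 by (simp add: powr_power)
      finally have "n ^ 510 \<le> n powr (1 / 100) * n powr (1558 / 1167 * 382)"
        using main by (elim order_trans) (intro mult_left_mono, auto)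
      also have "\<dots> = n powr (1 / 100 + 1558 / 1167 * 382)" by (rule powr_add[symmetric])
      also have "\<dots> < n powr 510" using n3 by (intro powr_less_mono) auto
      also have "\<dots> = n ^ 510" using n3 powr_realpow[of n 510] by simp
      finally show False by simp
    qed
    moreover have "n powr (4/3 + 2/1167 - \<epsilon>) \<le> n powr (1558 / 1167)" using n3 \<epsilon> by (intro powr_mono) auto
    ultimately show ?thesis unfolding n_def m_def by linarith
  qed
  then show "\<exists>n\<^sub>0::nat. \<forall>A::real set. finite A \<and> card A \<ge> n\<^sub>0 \<longrightarrow>
      real (max (card (A * A)) (card (A + A))) \<ge> real (card A) powr (4/3 + 2/1167 - \<epsilon>)"
    by blast
qed

end
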